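(* Let $\Phi:M\rightarrow\mathbb{S}^2\times\mathbb{S}^2$ be a connected orientable hypersurface whose principal curvatures are all constant, with at most two distinct values. Then, up to congruence, either $\Phi(M)$ is an open subset of $\mathbb{S}^1\times\mathbb{S}^2$ (and $M$ is totally geodesic), or $\Phi(M)$ is an open subset of $\mathbb{S}^1(r)\times\mathbb{S}^2$ for some $r\in(0,1)$ (if $M$ has two different constant principal curvatures).
   Context: $\mathbb{S}^2\subset\mathbb{R}^3$ is the unit sphere and $\mathbb{S}^2\times\mathbb{S}^2$ carries the product metric. A hypersurface $\Phi:M\to\mathbb{S}^2\times\mathbb{S}^2$ is a smooth immersion of a 3-manifold $M$. Principal curvatures are the eigenvalues of the shape operator associated to a unit normal field. Up to congruence means up to an isometry of $\mathbb{S}^2\times\mathbb{S}^2$. For $r\in(0,1]$, $\mathbb{S}^1(r)=\{(x,y,z)\in\mathbb{S}^2 : z=\sqrt{1-r^2}\}$, and $\mathbb{S}^1=\mathbb{S}^1(1)$. *)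

theory Defs
  imports "HOL-Analysis.Analysis"
begin

section \<open>Smooth maps and smooth 3-manifolds\<close>

text \<open>For open \<open>S\<close> in a Euclidean space, \<open>Ck_on k S f\<close> says that \<open>f\<close> is of class \<open>C^k\<close> on \<open>S\<close>:
  all iterated directional derivatives up to order \<open>k\<close> exist and are continuous.\<close>

primrec Ck_on :: "nat \<Rightarrow> 'a::euclidean_space set \<Rightarrow> ('a \<Rightarrow> 'b::real_normed_vector) \<Rightarrow> bool" where
  "Ck_on 0 S f \<longleftrightarrow> continuous_on S f"
| "Ck_on (Suc k) S f \<longleftrightarrow>
     (\<forall>x\<in>S. f differentiable (at x)) \<and> (\<forall>v. Ck_on k S (\<lambda>x. frechet_derivative f (at x) v))"

definition smooth_on :: "'a::euclidean_space set \<Rightarrow> ('a \<Rightarrow> 'b::real_normed_vector) \<Rightarrow> bool" where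
  "smooth_on S f \<longleftrightarrow> (\<forall>k. Ck_on k S f)"

definition second_countable_space :: "'m topology \<Rightarrow> bool" where
  "second_countable_space M \<longleftrightarrow>
     (\<exists>\<B>. countable \<B> \<and> (\<forall>V\<in>\<B>. openin M V) \<and>
        (\<forall>U x. openin M U \<and> x \<in> U \<longrightarrow> (\<exists>V\<in>\<B>. x \<in> V \<and> V \<subseteq> U)))"

text \<open>A chart is a pair \<open>(U, \<phi>)\<close> of its domain and its coordinate map; \<open>\<phi>\<close> is irrelevant
  outside \<open>U\<close>.\<close>

type_synonym 'm chart = "'m set \<times> ('m \<Rightarrow> real^3)"

definition chart_inv :: "'m chart \<Rightarrow> real^3 \<Rightarrow> 'm" where
  "chart_inv c = inv_into (fst c) (snd c)"

definition is_chart :: "'m topology \<Rightarrow> 'm chart \<Rightarrow> bool" where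
  "is_chart M c \<longleftrightarrow> openin M (fst c) \<and> open (snd c ` fst c) \<and>
     homeomorphic_map (subtopology M (fst c)) (top_of_set (snd c ` fst c)) (snd c)"

definition smooth_atlas :: "'m topology \<Rightarrow> 'm chart set \<Rightarrow> bool" where
  "smooth_atlas M A \<longleftrightarrow>
     (\<forall>c\<in>A. is_chart M c) \<and> (\<Union>c\<in>A. fst c) = topspace M \<and>
     (\<forall>c\<in>A. \<forall>d\<in>A. smooth_on (snd c ` (fst c \<inter> fst d)) (snd d \<circ> chart_inv c))"

definition smooth_3_manifold :: "'m topology \<Rightarrow> 'm chart set \<Rightarrow> bool" where
  "smooth_3_manifold M A \<longleftrightarrow>
     Hausdorff_space M \<and> second_countable_space M \<and> smooth_atlas M A"

definition smooth_map :: "'m chart set \<Rightarrow> ('m \<Rightarrow> 'b::real_normed_vector) \<Rightarrow> bool" where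
  "smooth_map A F \<longleftrightarrow> (\<forall>c\<in>A. smooth_on (snd c ` fst c) (F \<circ> chart_inv c))"

text \<open>The differential of \<open>F\<close> at \<open>p\<close>, where the tangent space of the manifold at \<open>p\<close> is
  identified with \<open>real^3\<close> by the chart \<open>c\<close>.\<close>

definition differential ::
    "'m chart \<Rightarrow> ('m \<Rightarrow> 'b::real_normed_vector) \<Rightarrow> 'm \<Rightarrow> real^3 \<Rightarrow> 'b" where
  "differential c F p = frechet_derivative (F \<circ> chart_inv c) (at (snd c p))"

definition orientable :: "'m topology \<Rightarrow> 'm chart set \<Rightarrow> bool" where
  "orientable M A \<longleftrightarrow>
     (\<exists>B. smooth_atlas M B \<and> smooth_atlas M (A \<union> B) \<and>
        (\<forall>c\<in>B. \<forall>d\<in>B. \<forall>p\<in>fst c \<inter> fst d. 0 < det (matrix (differential c (snd d) p))))"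


section \<open>The ambient manifold\<close>

type_synonym R33 = "(real^3) \<times> (real^3)"

text \<open>The inner product of \<open>R33\<close> restricts to the product metric on the product
  of the two unit spheres.\<close>

definition S2S2 :: "R33 set" where
  "S2S2 = sphere 0 1 \<times> sphere 0 1"

definition tangent_S2S2 :: "R33 \<Rightarrow> R33 set" where
  "tangent_S2S2 q = {w. fst w \<bullet> fst q = 0 \<and> snd w \<bullet> snd q = 0}"

text \<open>Orthogonal projection onto \<open>tangent_S2S2 q\<close>, for \<open>q \<in> S2S2\<close>. The Levi-Civita connection of
  \<open>S2S2\<close> is the Euclidean derivative followed by this projection.\<close>

definition proj_S2S2 :: "R33 \<Rightarrow> R33 \<Rightarrow> R33" where
  "proj_S2S2 q w =
     (fst w - (fst w \<bullet> fst q) *\<^sub>R fst q, snd w - (snd w \<bullet> snd q) *\<^sub>R snd q)"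

text \<open>\<open>G\<close> is a smooth extension of \<open>g\<close> to a neighbourhood of \<open>S2S2\<close>. The restriction of the derivative
  of \<open>G\<close> at \<open>q\<close> to \<open>tangent_S2S2 q\<close> is the differential of \<open>g\<close>, whatever the extension.\<close>

definition smooth_extension ::
    "(R33 \<Rightarrow> R33) \<Rightarrow> (R33 \<Rightarrow> R33) \<Rightarrow> bool" where
  "smooth_extension g G \<longleftrightarrow>
     (\<exists>W. open W \<and> S2S2 \<subseteq> W \<and> smooth_on W G) \<and> (\<forall>q\<in>S2S2. G q = g q)"

text \<open>Riemannian isometries of \<open>S2S2\<close> onto itself: diffeomorphisms preserving the metric.\<close>

definition isometry_S2S2 :: "(R33 \<Rightarrow> R33) \<Rightarrow> bool" where
  "isometry_S2S2 g \<longleftrightarrow>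
     bij_betw g S2S2 S2S2 \<and>
     (\<exists>H. smooth_extension (inv_into S2S2 g) H) \<and>
     (\<exists>G. smooth_extension g G \<and>
        (\<forall>q\<in>S2S2. \<forall>u\<in>tangent_S2S2 q. \<forall>v\<in>tangent_S2S2 q.
           frechet_derivative G (at q) u \<bullet> frechet_derivative G (at q) v = u \<bullet> v))"

definition circle_S2 :: "real \<Rightarrow> (real^3) set" where
  "circle_S2 r = {x \<in> sphere 0 1. x $ 3 = sqrt (1 - r\<^sup>2)}"


section \<open>Hypersurfaces and principal curvatures\<close>

definition hypersurface ::
    "'m topology \<Rightarrow> 'm chart set \<Rightarrow> ('m \<Rightarrow> R33) \<Rightarrow> bool" where
  "hypersurface M A \<Phi> \<longleftrightarrow>
     smooth_3_manifold M A \<and> smooth_map A \<Phi> \<and> \<Phi> ` topspace M \<subseteq> S2S2 \<and>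
     (\<forall>c\<in>A. \<forall>p\<in>fst c. inj (differential c \<Phi> p))"

definition unit_normal_field ::
    "'m chart set \<Rightarrow> ('m \<Rightarrow> R33) \<Rightarrow> ('m \<Rightarrow> R33) \<Rightarrow> bool" where
  "unit_normal_field A \<Phi> N \<longleftrightarrow>
     smooth_map A N \<and>
     (\<forall>c\<in>A. \<forall>p\<in>fst c. norm (N p) = 1 \<and> N p \<in> tangent_S2S2 (\<Phi> p) \<and>
        (\<forall>v. N p \<bullet> differential c \<Phi> p v = 0))"

text \<open>The shape operator at \<open>p\<close>, in the coordinates of the chart \<open>c\<close>: it sends \<open>v\<close> to the tangent vector
  whose image under the differential of \<open>\<Phi>\<close> is minus the covariant derivative of \<open>N\<close> along \<open>v\<close>.
  That derivative is orthogonal to \<open>N\<close>, hence in the image, and the differential is injective.\<close>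

definition shape_operator ::
    "('m \<Rightarrow> R33) \<Rightarrow> ('m \<Rightarrow> R33) \<Rightarrow> 'm chart \<Rightarrow> 'm \<Rightarrow> real^3 \<Rightarrow> real^3" where
  "shape_operator \<Phi> N c p v =
     (THE w. differential c \<Phi> p w = - proj_S2S2 (\<Phi> p) (differential c N p v))"

definition principal_curvatures ::
    "'m chart set \<Rightarrow> ('m \<Rightarrow> R33) \<Rightarrow> ('m \<Rightarrow> R33) \<Rightarrow> 'm \<Rightarrow> real set" where
  "principal_curvatures A \<Phi> N p =
     {\<kappa>. \<exists>c\<in>A. p \<in> fst c \<and> (\<exists>v. v \<noteq> 0 \<and> shape_operator \<Phi> N c p v = \<kappa> *\<^sub>R v)}"

text \<open>The eigenspace of the shape operator, carried to \<open>R33\<close> by the injective differential of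
  \<open>\<Phi>\<close>. Unlike its coordinate expression, it does not depend on the chart. The shape operator is
  self-adjoint for the induced metric, so the dimension of the eigenspace is the multiplicity of the
  principal curvature (and 0 if \<open>\<kappa>\<close> is not a principal curvature).\<close>

definition principal_space ::
    "'m chart set \<Rightarrow> ('m \<Rightarrow> R33) \<Rightarrow> ('m \<Rightarrow> R33) \<Rightarrow> 'm \<Rightarrow> real
      \<Rightarrow> R33 set" where
  "principal_space A \<Phi> N p \<kappa> =
     {differential c \<Phi> p v |c v. c \<in> A \<and> p \<in> fst c \<and> shape_operator \<Phi> N c p v = \<kappa> *\<^sub>R v}"

text \<open>The principal curvatures, listed in increasing order with their multiplicities, are three
  functions on \<open>M\<close>; all three are constant.\<close>

definition constant_principal_curvatures ::
    "'m topology \<Rightarrow> 'm chart set \<Rightarrow> ('m \<Rightarrow> R33) \<Rightarrow> ('m \<Rightarrow> R33) \<Rightarrow> bool" where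
  "constant_principal_curvatures M A \<Phi> N \<longleftrightarrow>
     (\<forall>p\<in>topspace M. \<forall>q\<in>topspace M. \<forall>\<kappa>.
        dim (principal_space A \<Phi> N p \<kappa>) = dim (principal_space A \<Phi> N q \<kappa>))"

definition totally_geodesic ::
    "'m chart set \<Rightarrow> ('m \<Rightarrow> R33) \<Rightarrow> ('m \<Rightarrow> R33) \<Rightarrow> bool" where
  "totally_geodesic A \<Phi> N \<longleftrightarrow> (\<forall>c\<in>A. \<forall>p\<in>fst c. \<forall>v. shape_operator \<Phi> N c p v = 0)"

end

theory Submission
  imports Defs "HOL-Analysis.Cross3"
begin

text \<open>Write \<open>\<Phi> = (f\<^sub>1, f\<^sub>2)\<close> and \<open>N = (n\<^sub>1, n\<^sub>2)\<close>. Where \<open>0 < \<bar>n\<^sub>1\<bar> < 1\<close>, the vectors \<open>n\<^sub>i\<close> and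
  \<open>w\<^sub>i = f\<^sub>i \<times> n\<^sub>i\<close> frame the two spheres, and the Gauss and Codazzi equations become the structure
  equations of the 1-forms obtained by pairing this frame with \<open>df\<^sub>i\<close> and \<open>dn\<^sub>i\<close>. If \<open>\<mu>\<close> is a principal
  curvature of multiplicity at least 2, then \<open>A - \<mu>\<close> has rank at most one, so the three 1-forms
  \<open>\<sigma>\<^sub>i\<close> that represent it are proportional. Expanding \<open>d(\<sigma>\<^sub>i \<and> \<sigma>\<^sub>j) = 0\<close> leaves only
  two shapes for \<open>A\<close>; each persists on an open set and is there incompatible with the structure
  equations. Hence \<open>N\<close> is tangent to one of the two factors, the same one everywhere since \<open>M\<close> is
  connected. If \<open>n\<^sub>2 = 0\<close>, then \<open>dn\<^sub>1 = - \<kappa> df\<^sub>1\<close> with \<open>\<kappa>\<close> constant, so \<open>n\<^sub>1 + \<kappa> f\<^sub>1\<close> is a constant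
  vector, and \<open>f\<^sub>1\<close> runs in the circle which is cut out by \<open>z \<bullet> (n\<^sub>1 + \<kappa> f\<^sub>1) = \<kappa>\<close>.\<close>

section \<open>Smooth maps\<close>

text \<open>The obstacle is that the principal line of \<mu> + \<kappa> is known only point by
  point: no smooth unit vector field along it is at hand. The relations \<sigma>i \<and> \<sigma>j =
  0 do not mention such a field, so they can be differentiated without choosing one. If \<eta>
  denotes the pairing with the principal vector, then in each d\<sigma>i \<and> \<eta> all terms
  cancel except the one that the curvature of the sphere contributes; this is why a pointwise
  algebraic dichotomy comes out. A second difficulty is that each shape of A is a closed condition.
  It becomes usable on an open set because the failure of the other shape is open, and at every
  point where both factors of N are nonzero at least one of the two shapes fails. The radius: the
  constant vector n1 + \<kappa> f1 has squared length 1 + \<kappa>^2 and inner product \<kappa> with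
  f1, so f1 runs in a circle of radius 1 / sqrt (1 + \<kappa>^2), a great circle exactly when
  \<kappa> = 0.\<close>

lemma Ck_on_cong:
  assumes "open S" and "\<And>x. x \<in> S \<Longrightarrow> f x = g x" and "Ck_on k S f"
  shows "Ck_on k S g"
  using assms
proof (induction k arbitrary: f g)
  case 0
  then show ?case by (metis Ck_on.simps(1) continuous_on_cong)
next
  case (Suc k)
  have D: "(g has_derivative frechet_derivative f (at x)) (at x)" if "x \<in> S" for x
    using Suc.prems that
    by (metis Ck_on.simps(2) frechet_derivative_works has_derivative_transform_within_open)
  then have eq: "frechet_derivative f (at x) v = frechet_derivative g (at x) v" if "x \<in> S" for x v
    using that by (metis frechet_derivative_at)
  have "Ck_on k S (\<lambda>x. frechet_derivative f (at x) v)" for v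
    using Suc.prems by simp
  then have "Ck_on k S (\<lambda>x. frechet_derivative g (at x) v)" for v
    by (intro Suc.IH[of "\<lambda>x. frechet_derivative f (at x) v" "\<lambda>x. frechet_derivative g (at x) v"]
        eq assms(1))
  then show ?case
    using D by (auto simp: differentiable_def)
qed

lemma Ck_on_bounded_linear:
  assumes "open S" and L: "bounded_linear L" and "Ck_on k S f"
  shows "Ck_on k S (\<lambda>x. L (f x))"
  using assms(3)
proof (induction k arbitrary: f)
  case 0
  then show ?case
    by (simp add: L linear_continuous_on_compose bounded_linear.continuous_on)
next
  case (Suc k)
  have D: "((\<lambda>y. L (f y)) has_derivative (\<lambda>v. L (frechet_derivative f (at x) v))) (at x)"
    if "x \<in> S" for x
    using Suc.prems that
    by (intro bounded_linear.has_derivative[OF L]) (auto simp: frechet_derivative_works)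
  then have "(\<lambda>v. L (frechet_derivative f (at x) v)) = frechet_derivative (\<lambda>y. L (f y)) (at x)"
    if "x \<in> S" for x
    using that by (metis frechet_derivative_at)
  then have *: "L (frechet_derivative f (at x) v) = frechet_derivative (\<lambda>y. L (f y)) (at x) v"
    if "x \<in> S" for x v
    using that by metis
  then have "Ck_on k S (\<lambda>x. frechet_derivative (\<lambda>y. L (f y)) (at x) v)" for v
    using Suc.prems
    by (intro Ck_on_cong[OF assms(1) *] Suc.IH) auto
  then show ?case
    using D by (auto simp: differentiable_def)
qed

lemma smooth_on_bounded_linear_comp:
  assumes "open S" "bounded_linear L" "smooth_on S f"
  shows "smooth_on S (\<lambda>x. L (f x))"
  using Ck_on_bounded_linear[OF assms(1,2)] assms(3) by (simp add: smooth_on_def)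

lemma smooth_on_const: "smooth_on S (\<lambda>x. c)"
proof -
  have "Ck_on k S (\<lambda>x. c)" for k and c :: 'b
    by (induction k arbitrary: c) auto
  then show ?thesis by (simp add: smooth_on_def)
qed

lemma smooth_on_bounded_linear:
  assumes "bounded_linear L"
  shows "smooth_on S L"
proof -
  have D: "frechet_derivative L (at x) = L" for x
    by (metis assms bounded_linear_imp_has_derivative frechet_derivative_at)
  have "Ck_on k S L" for k
  proof (cases k)
    case 0
    then show ?thesis using assms by (simp add: linear_continuous_on)
  next
    case (Suc n)
    then show ?thesis
      using assms smooth_on_const[of S] by (auto simp: D bounded_linear_imp_differentiable smooth_on_def)
  qed
  then show ?thesis by (simp add: smooth_on_def)
qed

lemma smooth_on_subset: "smooth_on S f \<Longrightarrow> T \<subseteq> S \<Longrightarrow> smooth_on T f"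
proof -
  have "Ck_on k S f \<Longrightarrow> T \<subseteq> S \<Longrightarrow> Ck_on k T f" for k
    by (induction k arbitrary: f) (auto intro: continuous_on_subset)
  then show "smooth_on S f \<Longrightarrow> T \<subseteq> S \<Longrightarrow> smooth_on T f"
    by (auto simp: smooth_on_def)
qed

lemma smooth_on_frechet:
  assumes "smooth_on S f"
  shows "smooth_on S (\<lambda>x. frechet_derivative f (at x) v)"
  unfolding smooth_on_def
proof
  fix k
  have "Ck_on (Suc k) S f" using assms unfolding smooth_on_def by (rule spec)
  then show "Ck_on k S (\<lambda>x. frechet_derivative f (at x) v)" by simp
qed

lemma smooth_on_differentiable: "smooth_on S f \<Longrightarrow> x \<in> S \<Longrightarrow> f differentiable (at x)"
  unfolding smooth_on_def by (drule spec[of _ "Suc 0"]) simp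

lemma smooth_on_has_derivative:
  "smooth_on S f \<Longrightarrow> x \<in> S \<Longrightarrow> (f has_derivative frechet_derivative f (at x)) (at x)"
  unfolding frechet_derivative_works[symmetric] by (rule smooth_on_differentiable)

lemma smooth_on_continuous_on: "smooth_on S f \<Longrightarrow> continuous_on S f"
  unfolding smooth_on_def by (drule spec[of _ 0]) simp

section \<open>Symmetry of second derivatives\<close>

lemma mean_value_segment:
  fixes g :: "'a::real_normed_vector \<Rightarrow> real"
  assumes "0 < t"
    and "\<And>s. 0 \<le> s \<Longrightarrow> s \<le> t \<Longrightarrow> (g has_derivative g' (y + s *\<^sub>R v)) (at (y + s *\<^sub>R v))"
  obtains s where "0 < s" "s < t" "g (y + t *\<^sub>R v) - g y = t * g' (y + s *\<^sub>R v) v"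
proof -
  have "((\<lambda>s. g (y + s *\<^sub>R v)) has_derivative (\<lambda>h. g' (y + s *\<^sub>R v) (h *\<^sub>R v))) (at s)"
    if "0 \<le> s" "s \<le> t" for s
  proof -
    have "((\<lambda>s. y + s *\<^sub>R v) has_derivative (\<lambda>h. h *\<^sub>R v)) (at s)"
      by (auto intro!: derivative_eq_intros)
    from diff_chain_at[OF this assms(2)[OF that]] show ?thesis by (simp add: o_def)
  qed
  then obtain s where s: "s \<in> {0<..<t}"
      "g (y + t *\<^sub>R v) - g (y + 0 *\<^sub>R v) = g' (y + s *\<^sub>R v) ((t - 0) *\<^sub>R v)"
    using mvt_simple[OF assms(1), of "\<lambda>s. g (y + s *\<^sub>R v)" "\<lambda>s h. g' (y + s *\<^sub>R v) (h *\<^sub>R v)"]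
    by (metis atLeastAtMost_iff has_derivative_at_withinI)
  then have "linear (g' (y + s *\<^sub>R v))"
    using assms(2)[of s] by (auto intro: has_derivative_linear)
  then show ?thesis
    using s that[of s] by (auto simp: linear_cmul)
qed

text \<open>The left side of the equation is symmetric in \<open>v\<close> and \<open>w\<close>,
  which is the source of Schwarz's theorem. The mean value theorem is used twice: along
  \<open>v\<close> for the difference \<open>G\<close>, then along \<open>w\<close> for the
  derivative of \<open>g\<close> in direction \<open>v\<close>.\<close>

lemma second_difference_mean_value:
  fixes g :: "'a::euclidean_space \<Rightarrow> real"
  assumes g: "smooth_on (ball x e) g" and t: "0 < t" "t * (norm v + norm w) < e"
  obtains z where "dist x z \<le> t * (norm v + norm w)"
    "g (x + t *\<^sub>R v + t *\<^sub>R w) - g (x + t *\<^sub>R v) - g (x + t *\<^sub>R w) + g x =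
      t * t * frechet_derivative (\<lambda>y. frechet_derivative g (at y) v) (at z) w"
proof -
  let ?D = "\<lambda>y. frechet_derivative g (at y)"
  have near: "dist x (x + s *\<^sub>R v + r *\<^sub>R w) \<le> t * (norm v + norm w)"
    if "0 \<le> s" "s \<le> t" "0 \<le> r" "r \<le> t" for s r
  proof -
    have "dist x (x + s *\<^sub>R v + r *\<^sub>R w) = norm (s *\<^sub>R v + r *\<^sub>R w)"
      by (metis add.assoc add_diff_cancel_left' dist_commute dist_norm)
    also have "\<dots> \<le> s * norm v + r * norm w"
      using norm_triangle_ineq[of "s *\<^sub>R v" "r *\<^sub>R w"] that by simp
    also have "\<dots> \<le> t * norm v + t * norm w"
      using that by (intro add_mono mult_right_mono) auto
    finally show ?thesis by (simp add: algebra_simps)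
  qed
  define G where "G y = g (y + t *\<^sub>R w) - g y" for y
  have "(G has_derivative (\<lambda>h. ?D (x + s *\<^sub>R v + t *\<^sub>R w) h - ?D (x + s *\<^sub>R v) h)) (at (x + s *\<^sub>R v))"
    if "0 \<le> s" "s \<le> t" for s
  proof -
    have A: "(g has_derivative ?D (x + s *\<^sub>R v + t *\<^sub>R w)) (at (x + s *\<^sub>R v + t *\<^sub>R w))"
      using near[of s t] that t by (intro smooth_on_has_derivative[OF g]) auto
    have B: "(g has_derivative ?D (x + s *\<^sub>R v)) (at (x + s *\<^sub>R v))"
      using near[of s 0] that t by (intro smooth_on_has_derivative[OF g]) auto
    have "((\<lambda>y. y + t *\<^sub>R w) has_derivative (\<lambda>h. h)) (at (x + s *\<^sub>R v))"
      by (auto intro!: derivative_eq_intros)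
    from diff_chain_at[OF this A] B show ?thesis
      unfolding G_def by (auto simp: o_def intro!: derivative_intros)
  qed
  then obtain s where s: "0 < s" "s < t"
    and Gs: "G (x + t *\<^sub>R v) - G x = t * (?D (x + s *\<^sub>R v + t *\<^sub>R w) v - ?D (x + s *\<^sub>R v) v)"
    by (rule mean_value_segment[of t G "\<lambda>y h. ?D (y + t *\<^sub>R w) h - ?D y h" x v, OF t(1)])
  obtain r where r: "0 < r" "r < t"
    and "?D (x + s *\<^sub>R v + t *\<^sub>R w) v - ?D (x + s *\<^sub>R v) v =
      t * frechet_derivative (\<lambda>y. ?D y v) (at (x + s *\<^sub>R v + r *\<^sub>R w)) w"
  proof (rule mean_value_segment[of t "\<lambda>y. ?D y v" "\<lambda>z. frechet_derivative (\<lambda>y. ?D y v) (at z)" "x + s *\<^sub>R v" w])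
    fix r assume "0 \<le> r" "r \<le> t"
    then show "((\<lambda>y. ?D y v) has_derivative frechet_derivative (\<lambda>y. ?D y v)
        (at (x + s *\<^sub>R v + r *\<^sub>R w))) (at (x + s *\<^sub>R v + r *\<^sub>R w))"
      using near[of s r] s t
      by (intro smooth_on_has_derivative[OF smooth_on_frechet[OF g]]) auto
  qed (use t in auto)
  with Gs have "g (x + t *\<^sub>R v + t *\<^sub>R w) - g (x + t *\<^sub>R v) - g (x + t *\<^sub>R w) + g x =
      t * t * frechet_derivative (\<lambda>y. ?D y v) (at (x + s *\<^sub>R v + r *\<^sub>R w)) w"
    by (simp add: G_def)
  moreover have "dist x (x + s *\<^sub>R v + r *\<^sub>R w) \<le> t * (norm v + norm w)"
    using near s r by simp
  ultimately show ?thesis using that by blast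
qed

text \<open>Both mixed derivatives, each at some point close to \<open>x\<close>, equal the same
  second difference divided by \<open>t * t\<close>; continuity at \<open>x\<close> does the
  rest.\<close>

lemma second_derivative_symmetric_real:
  fixes g :: "'a::euclidean_space \<Rightarrow> real"
  assumes "open U" "smooth_on U g" "x \<in> U"
  shows "frechet_derivative (\<lambda>y. frechet_derivative g (at y) v) (at x) w =
    frechet_derivative (\<lambda>y. frechet_derivative g (at y) w) (at x) v"
proof -
  define P where "P z = frechet_derivative (\<lambda>y. frechet_derivative g (at y) v) (at z) w" for z
  define Q where "Q z = frechet_derivative (\<lambda>y. frechet_derivative g (at y) w) (at z) v" for z
  obtain e where e: "0 < e" "ball x e \<subseteq> U"
    using assms open_contains_ball by blast
  have g: "smooth_on (ball x e) g"
    using assms e smooth_on_subset by blast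
  have cont: "isCont P x" "isCont Q x"
    using assms smooth_on_continuous_on[OF smooth_on_frechet[OF smooth_on_frechet[OF assms(2)]]]
    unfolding P_def Q_def by (simp_all add: continuous_on_eq_continuous_at)
  have bound: "\<bar>P x - Q x\<bar> \<le> \<epsilon>" if "0 < \<epsilon>" for \<epsilon>
  proof -
    have "\<exists>d>0. \<forall>z. dist z x < d \<longrightarrow> dist (P z) (P x) < \<epsilon> / 2"
      using cont(1) that unfolding continuous_at_eps_delta by (meson half_gt_zero)
    then obtain d1 where d1: "0 < d1" "\<And>z. dist z x < d1 \<Longrightarrow> dist (P z) (P x) < \<epsilon> / 2"
      by blast
    have "\<exists>d>0. \<forall>z. dist z x < d \<longrightarrow> dist (Q z) (Q x) < \<epsilon> / 2"
      using cont(2) that unfolding continuous_at_eps_delta by (meson half_gt_zero)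
    then obtain d2 where d2: "0 < d2" "\<And>z. dist z x < d2 \<Longrightarrow> dist (Q z) (Q x) < \<epsilon> / 2"
      by blast
    \<comment> \<open>The summand 1 keeps the denominator of \<open>t\<close> positive when
      \<open>v\<close> and \<open>w\<close> vanish.\<close>
    define m where "m = norm v + norm w + 1"
    define d where "d = min e (min d1 d2)"
    define t where "t = d / (2 * m)"
    have m: "0 < m" unfolding m_def by (simp add: add_nonneg_pos)
    have d: "0 < d" using d1 d2 e by (simp add: d_def)
    have t: "0 < t" using m d by (simp add: t_def)
    have "t * (norm v + norm w) \<le> t * m"
      using t by (intro mult_left_mono) (auto simp: m_def)
    also have "t * m < d" using m d by (simp add: t_def)
    finally have td: "t * (norm v + norm w) < d" .
    then have te: "t * (norm v + norm w) < e" by (simp add: d_def)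
    obtain z where z: "dist x z \<le> t * (norm v + norm w)"
      "g (x + t *\<^sub>R v + t *\<^sub>R w) - g (x + t *\<^sub>R v) - g (x + t *\<^sub>R w) + g x = t * t * P z"
      unfolding P_def using second_difference_mean_value[OF g t, of v w] te by (metis add.commute)
    obtain z' where z': "dist x z' \<le> t * (norm w + norm v)"
      "g (x + t *\<^sub>R w + t *\<^sub>R v) - g (x + t *\<^sub>R w) - g (x + t *\<^sub>R v) + g x = t * t * Q z'"
      unfolding Q_def using second_difference_mean_value[OF g t, of w v] te by (metis add.commute)
    have "t * t * P z = t * t * Q z'"
    proof -
      have "x + t *\<^sub>R w + t *\<^sub>R v = x + t *\<^sub>R v + t *\<^sub>R w" by (simp add: add_ac)
      then have "g (x + t *\<^sub>R w + t *\<^sub>R v) = g (x + t *\<^sub>R v + t *\<^sub>R w)"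
        by (rule arg_cong)
      then show ?thesis using z(2) z'(2) by linarith
    qed
    then have eq: "P z = Q z'" using t by simp
    have "dist z x < d1" "dist z' x < d2"
      using z(1) z'(1) td by (auto simp: dist_commute d_def add.commute)
    with d1 d2 have "\<bar>P z - P x\<bar> < \<epsilon> / 2" "\<bar>Q z' - Q x\<bar> < \<epsilon> / 2"
      by (auto simp: dist_real_def)
    with eq show ?thesis by linarith
  qed
  have "\<bar>P x - Q x\<bar> \<le> 0"
    by (rule field_le_epsilon) (metis add_0 bound)
  then have "P x = Q x" by simp
  then show ?thesis by (simp add: P_def Q_def)
qed

lemma frechet_derivative_bounded_linear:
  assumes "bounded_linear L" "f differentiable (at x)"
  shows "frechet_derivative (\<lambda>y. L (f y)) (at x) v = L (frechet_derivative f (at x) v)"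
proof -
  have "((\<lambda>y. L (f y)) has_derivative (\<lambda>v. L (frechet_derivative f (at x) v))) (at x)"
    using assms(2) unfolding frechet_derivative_works by (rule bounded_linear.has_derivative[OF assms(1)])
  from frechet_derivative_at[OF this, symmetric] show ?thesis by simp
qed

lemma frechet_derivative_cong:
  assumes "open S" "x \<in> S" "\<And>y. y \<in> S \<Longrightarrow> f y = g y" "f differentiable (at x)"
  shows "frechet_derivative g (at x) = frechet_derivative f (at x)"
proof -
  have "(g has_derivative frechet_derivative f (at x)) (at x)"
    using assms by (intro has_derivative_transform_within_open[of f _ x UNIV S g])
      (auto simp flip: frechet_derivative_works)
  then show ?thesis by (rule frechet_derivative_at[symmetric])
qed

lemma second_derivative_symmetric:
  fixes f :: "'a::euclidean_space \<Rightarrow> 'b::euclidean_space"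
  assumes "open U" "smooth_on U f" "x \<in> U"
  shows "frechet_derivative (\<lambda>y. frechet_derivative f (at y) v) (at x) w =
    frechet_derivative (\<lambda>y. frechet_derivative f (at y) w) (at x) v"
proof (rule euclidean_eqI)
  fix b :: 'b
  let ?L = "\<lambda>y. y \<bullet> b"
  have L: "bounded_linear ?L" by (rule bounded_linear_inner_left)
  have "smooth_on U (\<lambda>y. ?L (f y))"
    by (rule smooth_on_bounded_linear_comp[OF assms(1) L assms(2)])
  from second_derivative_symmetric_real[OF assms(1) this assms(3)]
  have sym: "frechet_derivative (\<lambda>y. frechet_derivative (\<lambda>y. ?L (f y)) (at y) v) (at x) w =
    frechet_derivative (\<lambda>y. frechet_derivative (\<lambda>y. ?L (f y)) (at y) w) (at x) v" for v w .
  have "frechet_derivative (\<lambda>y. frechet_derivative (\<lambda>y. ?L (f y)) (at y) v) (at x) w =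
      ?L (frechet_derivative (\<lambda>y. frechet_derivative f (at y) v) (at x) w)" for v w
  proof -
    have d: "(\<lambda>y. frechet_derivative f (at y) v) differentiable (at x)"
      using smooth_on_differentiable smooth_on_frechet assms by blast
    have "frechet_derivative (\<lambda>y. frechet_derivative (\<lambda>y. ?L (f y)) (at y) v) (at x) =
      frechet_derivative (\<lambda>y. ?L (frechet_derivative f (at y) v)) (at x)"
    proof (rule frechet_derivative_cong[OF assms(1,3)])
      show "?L (frechet_derivative f (at y) v) = frechet_derivative (\<lambda>y. ?L (f y)) (at y) v"
        if "y \<in> U" for y
        using frechet_derivative_bounded_linear[OF L] smooth_on_differentiable assms(2) that by metis
      show "(\<lambda>y. ?L (frechet_derivative f (at y) v)) differentiable (at x)"
        using d by simp
    qed
    then show ?thesis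
      using frechet_derivative_bounded_linear[OF L d] by metis
  qed
  with sym show "frechet_derivative (\<lambda>y. frechet_derivative f (at y) v) (at x) w \<bullet> b =
      frechet_derivative (\<lambda>y. frechet_derivative f (at y) w) (at x) v \<bullet> b"
    by metis
qed

section \<open>Differential 1-forms\<close>

abbreviation D :: "('a::real_normed_vector \<Rightarrow> 'b::real_normed_vector) \<Rightarrow> 'a \<Rightarrow> 'a \<Rightarrow> 'b" where
  "D f x \<equiv> frechet_derivative f (at x)"

text \<open>The exterior derivative evaluated on the constant vector fields \<open>u\<close> and
  \<open>v\<close>: their bracket is zero, so Cartan's formula has no third term. The normalization
  is the one without the factor 1/2.\<close>

definition ext_d :: "('a::real_normed_vector \<Rightarrow> 'a \<Rightarrow> real) \<Rightarrow> 'a \<Rightarrow> 'a \<Rightarrow> 'a \<Rightarrow> real" where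
  "ext_d \<omega> x u v = D (\<lambda>y. \<omega> y v) x u - D (\<lambda>y. \<omega> y u) x v"

definition diff_form :: "('a::real_normed_vector \<Rightarrow> 'a \<Rightarrow> real) \<Rightarrow> 'a \<Rightarrow> bool" where
  "diff_form \<omega> x \<longleftrightarrow> (\<forall>v. (\<lambda>y. \<omega> y v) differentiable (at x))"

lemma diff_form_has_derivative:
  "diff_form \<omega> x \<Longrightarrow> ((\<lambda>y. \<omega> y v) has_derivative D (\<lambda>y. \<omega> y v) x) (at x)"
  unfolding diff_form_def frechet_derivative_works[symmetric] by (rule spec)

lemma ext_d_eqI:
  assumes "\<And>v. ((\<lambda>y. \<omega> y v) has_derivative \<omega>' v) (at x)"
  shows "diff_form \<omega> x" "ext_d \<omega> x u v = \<omega>' v u - \<omega>' u v"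
proof -
  show "diff_form \<omega> x"
    unfolding diff_form_def differentiable_def using assms by blast
  have "D (\<lambda>y. \<omega> y v) x = \<omega>' v" for v
    by (rule frechet_derivative_at[OF assms, symmetric])
  then show "ext_d \<omega> x u v = \<omega>' v u - \<omega>' u v"
    by (simp add: ext_d_def)
qed

lemma ext_d_add_scale:
  assumes "diff_form \<omega> x" "diff_form \<rho> x"
  shows "diff_form (\<lambda>y v. \<omega> y v + c * \<rho> y v) x"
    and "ext_d (\<lambda>y v. \<omega> y v + c * \<rho> y v) x u v = ext_d \<omega> x u v + c * ext_d \<rho> x u v"
proof -
  have *: "((\<lambda>y. \<omega> y v + c * \<rho> y v) has_derivative
      (\<lambda>u. D (\<lambda>y. \<omega> y v) x u + c * D (\<lambda>y. \<rho> y v) x u)) (at x)" for v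
    using assms by (intro derivative_intros diff_form_has_derivative)
  from ext_d_eqI[OF *] show "diff_form (\<lambda>y v. \<omega> y v + c * \<rho> y v) x"
    and "ext_d (\<lambda>y v. \<omega> y v + c * \<rho> y v) x u v = ext_d \<omega> x u v + c * ext_d \<rho> x u v"
    by (auto simp: ext_d_def algebra_simps)
qed

lemma ext_d_zero:
  assumes "open W" "x \<in> W" "\<And>y v. y \<in> W \<Longrightarrow> \<omega> y v = 0"
  shows "ext_d \<omega> x u v = 0"
proof -
  have "((\<lambda>y. \<omega> y v) has_derivative (\<lambda>h. 0)) (at x)" for v
    by (rule has_derivative_transform_within_open[OF has_derivative_const assms(1,2)]) (simp add: assms(3))
  from ext_d_eqI(2)[OF this] show ?thesis by simp
qed

text \<open>This is how an alternative that is known pointwise spreads to an open set: where the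
  form of one alternative is nonzero, the other alternative must hold.\<close>

lemma open_nonzero_form:
  assumes "\<And>x. x \<in> W \<Longrightarrow> diff_form \<omega> x" "open W"
  shows "open {x \<in> W. \<exists>v. \<omega> x v \<noteq> 0}"
proof -
  have "continuous_on W (\<lambda>x. \<omega> x v)" for v
    using assms(1) unfolding diff_form_def
    by (intro differentiable_imp_continuous_on) (auto simp: differentiable_on_def intro: differentiable_at_withinI)
  then have "open (W \<inter> (\<lambda>x. \<omega> x v) -` (- {0}))" for v
    using assms(2) by (intro continuous_open_preimage) auto
  then have "open (\<Union>v. W \<inter> (\<lambda>x. \<omega> x v) -` (- {0}))"
    by blast
  moreover have "(\<Union>v. W \<inter> (\<lambda>x. \<omega> x v) -` (- {0})) = {x \<in> W. \<exists>v. \<omega> x v \<noteq> 0}"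
    by auto
  ultimately show ?thesis by simp
qed

text \<open>This is \<open>d(\<omega> \<and> \<rho>) = 0\<close>, evaluated on three vectors.\<close>

lemma ext_d_proportional:
  assumes W: "open W" "x \<in> W" and \<omega>: "diff_form \<omega> x" and \<rho>: "diff_form \<rho> x"
    and eq: "\<And>y u v. y \<in> W \<Longrightarrow> \<omega> y u * \<rho> y v = \<omega> y v * \<rho> y u"
  shows "ext_d \<omega> x u v * \<rho> x w + ext_d \<omega> x v w * \<rho> x u + ext_d \<omega> x w u * \<rho> x v =
    \<omega> x w * ext_d \<rho> x u v + \<omega> x u * ext_d \<rho> x v w + \<omega> x v * ext_d \<rho> x w u"
proof -
  define \<omega>' where "\<omega>' v u = D (\<lambda>y. \<omega> y v) x u" for u v
  define \<rho>' where "\<rho>' v u = D (\<lambda>y. \<rho> y v) x u" for u v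
  have "\<omega>' u h * \<rho> x v + \<omega> x u * \<rho>' v h = \<omega>' v h * \<rho> x u + \<omega> x v * \<rho>' u h" for h u v
  proof -
    have A: "((\<lambda>y. \<omega> y u * \<rho> y v) has_derivative (\<lambda>h. \<omega> x u * \<rho>' v h + \<omega>' u h * \<rho> x v)) (at x)" for u v
      unfolding \<omega>'_def \<rho>'_def
      by (intro has_derivative_mult diff_form_has_derivative \<omega> \<rho>)
    have "((\<lambda>y. \<omega> y u * \<rho> y v) has_derivative (\<lambda>h. \<omega> x v * \<rho>' u h + \<omega>' v h * \<rho> x u)) (at x)"
      using W eq by (intro has_derivative_transform_within_open[OF A[of v u], of W]) (metis eq)+
    from has_derivative_unique[OF A[of u v] this] show ?thesis
      by (metis add.commute)
  qed
  \<comment> \<open>The product rule along each of the three vectors, applied to the other two;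
    their cyclic sum turns the derivatives into exterior derivatives.\<close>
  from this[of u w v] this[of v u w] this[of w v u] show ?thesis
    by (simp add: ext_d_def flip: \<omega>'_def \<rho>'_def) (simp add: algebra_simps)
qed

unbundle cross3_syntax

section \<open>Orthogonal frames of a plane in 3-space\<close>

text \<open>Since n x (h x n) = |n|^2 h, this is the Lagrange identity for the inner product of two
  cross products. Keeping the factor |n|^2 instead of dividing by it makes the identity valid at n =
  0 too.\<close>

lemma frame_det:
  fixes h n y z :: "real^3"
  assumes "h \<bullet> n = 0"
  shows "(n \<bullet> n) * ((h \<times> y) \<bullet> z) = (n \<bullet> y) * ((h \<times> n) \<bullet> z) - ((h \<times> n) \<bullet> y) * (n \<bullet> z)"
proof -
  have "(n \<bullet> y) * ((h \<times> n) \<bullet> z) - ((h \<times> n) \<bullet> y) * (n \<bullet> z) = (n \<times> (h \<times> n)) \<bullet> (y \<times> z)"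
    by (simp add: dot_cross inner_commute mult.commute)
  also have "n \<times> (h \<times> n) = (n \<bullet> n) *\<^sub>R h"
    using assms by (simp add: Lagrange inner_commute)
  finally show ?thesis
    using cross_triple[of h y z] by (simp add: inner_commute)
qed

lemma frame_expand:
  fixes h y :: "real^3"
  assumes "h \<bullet> h = 1" "h \<bullet> y = 0"
  shows "h \<times> (h \<times> y) = - y"
  using assms by (simp add: Lagrange)

text \<open>n and h x n are orthogonal, of equal length, and lie in the plane orthogonal to h. The
  identity is \<open>frame_det\<close> applied to h x y, because the quarter turn h x _ has square
  -1 on that plane.\<close>

lemma frame_inner:
  fixes h n y z :: "real^3"
  assumes "h \<bullet> h = 1" "h \<bullet> n = 0" "h \<bullet> y = 0"
  shows "(n \<bullet> n) * (y \<bullet> z) = (n \<bullet> y) * (n \<bullet> z) + ((h \<times> n) \<bullet> y) * ((h \<times> n) \<bullet> z)"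
proof -
  have 1: "n \<bullet> (h \<times> y) = - ((h \<times> n) \<bullet> y)"
    by (metis cross_triple cross_skew inner_commute inner_minus_left)
  have 2: "(h \<times> n) \<bullet> (h \<times> y) = n \<bullet> y"
    using assms by (simp add: dot_cross)
  have "y \<bullet> z = - ((h \<times> (h \<times> y)) \<bullet> z)"
    using frame_expand[OF assms(1,3)] by simp
  then show ?thesis
    using frame_det[OF assms(2), of "h \<times> y" z] 1 2 by (simp add: algebra_simps)
qed

text \<open>Both y and n are orthogonal to h, so y x n is a multiple of h.\<close>

lemma frame_normal:
  fixes h n y z :: "real^3"
  assumes "h \<bullet> h = 1" "h \<bullet> n = 0" "h \<bullet> y = 0"
  shows "(y \<times> n) \<bullet> z = - ((h \<times> n) \<bullet> y) * (h \<bullet> z)"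
proof -
  have "h \<times> (y \<times> n) = 0"
    using assms by (simp add: Lagrange)
  then have "y \<times> n = (h \<bullet> (y \<times> n)) *\<^sub>R h"
    using Lagrange[of h h "y \<times> n"] assms(1) by simp
  moreover have "h \<bullet> (y \<times> n) = - ((h \<times> n) \<bullet> y)"
    by (metis cross_triple cross_skew inner_commute inner_minus_left)
  ultimately show ?thesis
    by (metis inner_scaleR_left)
qed

section \<open>Structure equations\<close>

text \<open>The frame \<open>n, w\<close> of the tangent plane at \<open>h x\<close> is orthogonal but not normalized: the four
  1-forms are then smooth also at the zeros of \<open>n\<close>. Note that \<open>\<delta>\<close> is half the differential of \<open>a\<close>.\<close>

locale spherical =
  fixes U :: "(real^3) set" and h n :: "real^3 \<Rightarrow> real^3"
  assumes U: "open U" and h_smooth: "smooth_on U h" and n_smooth: "smooth_on U n"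
    and hh: "x \<in> U \<Longrightarrow> h x \<bullet> h x = 1" and hn: "x \<in> U \<Longrightarrow> h x \<bullet> n x = 0"
begin

definition w where "w x = h x \<times> n x"
definition a where "a x = n x \<bullet> n x"
definition \<alpha> where "\<alpha> x v = n x \<bullet> D h x v"
definition \<beta> where "\<beta> x v = w x \<bullet> D h x v"
text \<open>Where a > 0, the forms \<alpha> / sqrt a and \<beta> / sqrt a are the coframe of the
  normalized frame, pulled back by \<open>h\<close>, and \<gamma> / a is its connection
  form.\<close>

definition \<gamma> where "\<gamma> x v = w x \<bullet> D n x v"
definition \<delta> where "\<delta> x v = n x \<bullet> D n x v"

context fixes x assumes x: "x \<in> U"
begin

lemma dh: "(h has_derivative D h x) (at x)"
  by (rule smooth_on_has_derivative[OF h_smooth x])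

lemma dn: "(n has_derivative D n x) (at x)"
  by (rule smooth_on_has_derivative[OF n_smooth x])

lemma dw: "(w has_derivative (\<lambda>u. h x \<times> D n x u + D h x u \<times> n x)) (at x)"
proof -
  have "bounded_bilinear (cross3 :: real^3 \<Rightarrow> _)"
    using bilinear_cross by (simp add: bilinear_conv_bounded_bilinear)
  from bounded_bilinear.FDERIV[OF this dh dn] show ?thesis
    by (simp add: w_def[abs_def])
qed

lemma ddh: "((\<lambda>y. D h y v) has_derivative D (\<lambda>y. D h y v) x) (at x)"
  by (rule smooth_on_has_derivative[OF smooth_on_frechet[OF h_smooth] x])

lemma ddn: "((\<lambda>y. D n y v) has_derivative D (\<lambda>y. D n y v) x) (at x)"
  by (rule smooth_on_has_derivative[OF smooth_on_frechet[OF n_smooth] x])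

lemma h_dh: "h x \<bullet> D h x v = 0"
proof -
  have "((\<lambda>y. h y \<bullet> h y) has_derivative (\<lambda>v. h x \<bullet> D h x v + D h x v \<bullet> h x)) (at x)"
    by (intro has_derivative_inner dh)
  moreover have "((\<lambda>y. h y \<bullet> h y) has_derivative (\<lambda>v. 0)) (at x)"
    using hh by (intro has_derivative_transform_within_open[OF has_derivative_const U x]) auto
  ultimately have "(\<lambda>v. h x \<bullet> D h x v + D h x v \<bullet> h x) = (\<lambda>v. 0)"
    by (rule has_derivative_unique)
  then have "h x \<bullet> D h x v + D h x v \<bullet> h x = 0" by meson
  then show ?thesis by (simp add: inner_commute)
qed

lemma h_dn: "h x \<bullet> D n x v = - \<alpha> x v"
proof -
  have "((\<lambda>y. h y \<bullet> n y) has_derivative (\<lambda>v. h x \<bullet> D n x v + D h x v \<bullet> n x)) (at x)"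
    by (intro has_derivative_inner dh dn)
  moreover have "((\<lambda>y. h y \<bullet> n y) has_derivative (\<lambda>v. 0)) (at x)"
    using hn by (intro has_derivative_transform_within_open[OF has_derivative_const U x]) auto
  ultimately have "(\<lambda>v. h x \<bullet> D n x v + D h x v \<bullet> n x) = (\<lambda>v. 0)"
    by (rule has_derivative_unique)
  then have "h x \<bullet> D n x v + D h x v \<bullet> n x = 0" by meson
  then show ?thesis by (simp add: \<alpha>_def inner_commute)
qed

lemma ww: "w x \<bullet> w x = a x"
  using hh[OF x] hn[OF x] by (simp add: w_def a_def dot_cross inner_commute)

lemma wh: "w x \<bullet> h x = 0" and wn: "w x \<bullet> n x = 0"
  by (simp_all add: w_def dot_cross_self)

lemma inner_h_perp: "h x \<bullet> y = 0 \<Longrightarrow> a x * (y \<bullet> z) = (n x \<bullet> y) * (n x \<bullet> z) + (w x \<bullet> y) * (w x \<bullet> z)"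
  unfolding a_def w_def by (rule frame_inner[OF hh[OF x] hn[OF x]])

lemma form_derivatives:
  "((\<lambda>y. \<alpha> y v) has_derivative (\<lambda>u. n x \<bullet> D (\<lambda>y. D h y v) x u + D n x u \<bullet> D h x v)) (at x)"
  "((\<lambda>y. \<beta> y v) has_derivative
     (\<lambda>u. w x \<bullet> D (\<lambda>y. D h y v) x u + (h x \<times> D n x u + D h x u \<times> n x) \<bullet> D h x v)) (at x)"
  "((\<lambda>y. \<gamma> y v) has_derivative
     (\<lambda>u. w x \<bullet> D (\<lambda>y. D n y v) x u + (h x \<times> D n x u + D h x u \<times> n x) \<bullet> D n x v)) (at x)"
  "((\<lambda>y. \<delta> y v) has_derivative (\<lambda>u. n x \<bullet> D (\<lambda>y. D n y v) x u + D n x u \<bullet> D n x v)) (at x)"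
  unfolding \<alpha>_def \<beta>_def \<gamma>_def \<delta>_def by (intro has_derivative_inner ddh ddn dn dw)+

lemma diff_forms: "diff_form \<alpha> x" "diff_form \<beta> x" "diff_form \<gamma> x" "diff_form \<delta> x"
  by (rule ext_d_eqI(1), rule form_derivatives)+

lemma sym: "D (\<lambda>y. D h y v) x u = D (\<lambda>y. D h y u) x v" "D (\<lambda>y. D n y v) x u = D (\<lambda>y. D n y u) x v"
  using second_derivative_symmetric[OF U h_smooth x] second_derivative_symmetric[OF U n_smooth x] .

lemma ext_d_\<delta>: "ext_d \<delta> x u v = 0"
  using sym(2)[of u v] by (simp add: ext_d_eqI(2)[OF form_derivatives(4)] inner_commute)

text \<open>Together with \<open>ext_d_\<beta>\<close> this is Cartan's first structure equation, up
  to the normalization of the frame. The second derivatives cancel by \<open>sym\<close>; the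
  remaining products of first derivatives are expanded in the frame.\<close>

lemma ext_d_\<alpha>:
  "a x * ext_d \<alpha> x u v = \<delta> x u * \<alpha> x v - \<delta> x v * \<alpha> x u + \<gamma> x u * \<beta> x v - \<gamma> x v * \<beta> x u"
proof -
  have "a x * (D n x u \<bullet> D h x v) = \<delta> x u * \<alpha> x v + \<gamma> x u * \<beta> x v" for u v
    using inner_h_perp[OF h_dh, of v "D n x u"]
    by (simp add: \<delta>_def \<alpha>_def \<gamma>_def \<beta>_def inner_commute mult.commute)
  from this[of u v] this[of v u] show ?thesis
    using sym(1)[of u v] by (simp add: ext_d_eqI(2)[OF form_derivatives(1)] right_diff_distrib)
qed

lemma cross_dn: "a x * ((h x \<times> D n x u) \<bullet> z) = \<delta> x u * (w x \<bullet> z) - \<gamma> x u * (n x \<bullet> z)"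
  unfolding a_def w_def \<delta>_def \<gamma>_def by (rule frame_det[OF hn[OF x]])

lemma cross_dh: "(D h x u \<times> n x) \<bullet> z = - \<beta> x u * (h x \<bullet> z)"
  unfolding \<beta>_def w_def by (rule frame_normal[OF hh[OF x] hn[OF x] h_dh])

lemma ext_d_\<beta>:
  "a x * ext_d \<beta> x u v = \<delta> x u * \<beta> x v - \<delta> x v * \<beta> x u - (\<gamma> x u * \<alpha> x v - \<gamma> x v * \<alpha> x u)"
proof -
  have "a x * ((h x \<times> D n x u + D h x u \<times> n x) \<bullet> D h x v) = \<delta> x u * \<beta> x v - \<gamma> x u * \<alpha> x v" for u v
    using cross_dn[of u "D h x v"] cross_dh[of u "D h x v"] h_dh[of v]
    by (simp add: inner_add_left distrib_left \<beta>_def \<alpha>_def)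
  from this[of u v] this[of v u] show ?thesis
    using sym(1)[of u v] by (simp add: ext_d_eqI(2)[OF form_derivatives(2)] right_diff_distrib)
qed

text \<open>Where a > 0, this says d(\<gamma> / a) = - \<alpha> \<and> \<beta> / a, the Gauss
  equation of the unit sphere. The curvature term \<beta> \<and> \<alpha> comes from the radial part
  of dn, which is - \<alpha> by \<open>h_dn\<close>.\<close>

lemma ext_d_\<gamma>:
  "a x * ext_d \<gamma> x u v = a x * (\<beta> x u * \<alpha> x v - \<beta> x v * \<alpha> x u) + 2 * (\<delta> x u * \<gamma> x v - \<delta> x v * \<gamma> x u)"
proof -
  have "a x * ((h x \<times> D n x u + D h x u \<times> n x) \<bullet> D n x v) =
      \<delta> x u * \<gamma> x v - \<gamma> x u * \<delta> x v + a x * (\<beta> x u * \<alpha> x v)" for u v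
    using cross_dn[of u "D n x v"] cross_dh[of u "D n x v"] h_dn[of v]
    by (simp add: inner_add_left distrib_left \<gamma>_def \<delta>_def)
  from this[of u v] this[of v u] show ?thesis
    using sym(2)[of u v]
    by (simp add: ext_d_eqI(2)[OF form_derivatives(3)] right_diff_distrib mult.commute)
qed

end

end

unbundle no cross3_syntax
unbundle set_product_syntax

lemma ex_orthogonal_pair:
  fixes y z :: "real^3"
  shows "\<exists>u. u \<noteq> 0 \<and> y \<bullet> u = 0 \<and> z \<bullet> u = 0"
proof -
  have "dim {y, z} \<le> card {y, z}" by (rule dim_le_card') simp
  also have "\<dots> < DIM(real^3)" by (simp add: card_insert_if)
  finally obtain u where u: "u \<noteq> 0" "\<And>v. v \<in> span {y, z} \<Longrightarrow> orthogonal u v"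
    by (rule orthogonal_to_subspace_exists) blast
  then have "orthogonal u y" "orthogonal u z" by (simp_all add: span_base)
  then show ?thesis
    using u(1) by (auto simp: orthogonal_def inner_commute)
qed

section \<open>The hypersurface in one chart\<close>

locale patch = p: spherical U f1 n1 + q: spherical U f2 n2
  for U :: "(real^3) set" and f1 n1 f2 n2 :: "real^3 \<Rightarrow> real^3" +
  assumes unit: "x \<in> U \<Longrightarrow> n1 x \<bullet> n1 x + n2 x \<bullet> n2 x = 1"
    and tangent: "x \<in> U \<Longrightarrow> n1 x \<bullet> D f1 x v + n2 x \<bullet> D f2 x v = 0"
    and immersed: "x \<in> U \<Longrightarrow> D f1 x v = 0 \<Longrightarrow> D f2 x v = 0 \<Longrightarrow> v = 0"
begin

text \<open>\<open>DN\<close> is the covariant derivative of the normal field, that is, minus \<open>DF\<close> composed with the shape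
  operator.\<close>

definition DF :: "real^3 \<Rightarrow> real^3 \<Rightarrow> R33" where
  "DF x v = (D f1 x v, D f2 x v)"

definition DN :: "real^3 \<Rightarrow> real^3 \<Rightarrow> R33" where
  "DN x v = (D n1 x v - (D n1 x v \<bullet> f1 x) *\<^sub>R f1 x, D n2 x v - (D n2 x v \<bullet> f2 x) *\<^sub>R f2 x)"

context fixes x assumes x: "x \<in> U"
begin

lemma a_sum: "p.a x + q.a x = 1"
  using unit[OF x] by (simp add: p.a_def q.a_def)

lemma q_\<alpha>: "q.\<alpha> x v = - p.\<alpha> x v"
  using tangent[OF x, of v] by (simp add: p.\<alpha>_def q.\<alpha>_def)

lemma a_derivative: "(p.a has_derivative (\<lambda>v. 2 * p.\<delta> x v)) (at x)"
proof -
  have "((\<lambda>y. n1 y \<bullet> n1 y) has_derivative (\<lambda>v. n1 x \<bullet> D n1 x v + D n1 x v \<bullet> n1 x)) (at x)"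
    by (intro has_derivative_inner p.dn[OF x])
  then show ?thesis
    by (simp add: p.a_def[abs_def] p.\<delta>_def inner_commute)
qed

text \<open>A dimension count in \<open>R33\<close>: the image of the injective differential has
  dimension 3 and is orthogonal to (f1, 0), (0, f2) and (n1, n2), which are nonzero and pairwise
  orthogonal. Hence it is their full orthogonal complement.\<close>

lemma derivative_surj:
  assumes "f1 x \<bullet> y1 = 0" "f2 x \<bullet> y2 = 0" "n1 x \<bullet> y1 + n2 x \<bullet> y2 = 0"
  shows "\<exists>v. D f1 x v = y1 \<and> D f2 x v = y2"
proof -
  let ?F = "\<lambda>v. (D f1 x v, D f2 x v)"
  let ?B = "{(f1 x, 0), (0, f2 x), (n1 x, n2 x)} :: ((real^3) \<times> (real^3)) set"
  have lin: "linear (D f1 x)" "linear (D f2 x)"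
    using p.dh[OF x] q.dh[OF x] by (simp_all add: has_derivative_linear)
  then have linF: "linear ?F"
    by (simp add: linear_iff)
  have "inj ?F"
    unfolding linear_injective_0[OF linF] zero_prod_def prod.inject using immersed[OF x] by blast
  then have dimF: "dim (range ?F) = 3"
    using linF by (simp add: dim_image_eq)
  have orth: "pairwise orthogonal ?B"
    using p.hn[OF x] q.hn[OF x]
    by (auto simp: pairwise_def orthogonal_def inner_commute)
  have nonzero: "f1 x \<noteq> 0" "f2 x \<noteq> 0" "n1 x \<noteq> 0 \<or> n2 x \<noteq> 0"
    using p.hh[OF x] q.hh[OF x] unit[OF x] by auto
  then have "0 \<notin> ?B"
    by (auto simp: zero_prod_def)
  moreover have "f1 x \<noteq> n1 x" "f2 x \<noteq> n2 x"
    using p.hh[OF x] q.hh[OF x] p.hn[OF x] q.hn[OF x] by auto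
  then have "card ?B = 3"
    using nonzero by simp
  ultimately have dimB: "dim (span ?B) = 3"
    using pairwise_orthogonal_independent[OF orth] by (simp add: dim_eq_card_independent)
  let ?C = "{z. \<forall>b \<in> span ?B. orthogonal b z}"
  have "dim ?C + 3 = 6"
    using dim_subspace_orthogonal_to_vectors[of "span ?B" UNIV] dimB
    by (simp add: subspace_span orthogonal_commute)
  moreover have "range ?F \<subseteq> ?C"
  proof clarify
    fix v and b assume "b \<in> span ?B"
    then show "orthogonal b (?F v)"
    proof (rule orthogonal_commute[THEN iffD1, OF orthogonal_to_span])
      fix z assume "z \<in> ?B"
      then show "orthogonal (?F v) z"
        using p.h_dh[OF x] q.h_dh[OF x] tangent[OF x, of v]
        by (auto simp: orthogonal_def inner_commute)
    qed
  qed
  moreover have "subspace ?C"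
    by (auto simp: subspace_def orthogonal_def inner_add_right)
  moreover have "subspace (range ?F)"
    using linF by (rule linear_subspace_image) simp
  ultimately have "range ?F = ?C"
    using dimF by (intro subspace_dim_equal) auto
  moreover have "(y1, y2) \<in> ?C"
  proof clarify
    fix b assume "b \<in> span ?B"
    then show "orthogonal b (y1, y2)"
    proof (rule orthogonal_commute[THEN iffD1, OF orthogonal_to_span])
      fix z assume "z \<in> ?B"
      then show "orthogonal (y1, y2) z"
        using assms by (auto simp: orthogonal_def inner_commute)
    qed
  qed
  ultimately have "(y1, y2) \<in> range ?F" by simp
  then show ?thesis by auto
qed

text \<open>The differential maps \<open>V1\<close> to half the tangential part of (n1, - n2),
  \<open>V2\<close> to (w1, 0) and \<open>V3\<close> to (0, w2). These vectors are dual to \<alpha>,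
  \<open>p.\<beta>\<close>, \<open>q.\<beta>\<close> up to factors, so identities between forms can
  be tested on them.\<close>

lemma dual_frame:
  obtains V1 V2 V3 where
    "p.\<alpha> x V1 = p.a x * q.a x" "p.\<beta> x V1 = 0" "q.\<beta> x V1 = 0"
    "p.\<alpha> x V2 = 0" "p.\<beta> x V2 = p.a x" "q.\<beta> x V2 = 0"
    "p.\<alpha> x V3 = 0" "p.\<beta> x V3 = 0" "q.\<beta> x V3 = q.a x"
proof -
  have comm: "f1 x \<bullet> p.w x = 0" "f2 x \<bullet> q.w x = 0" "n1 x \<bullet> p.w x = 0" "n2 x \<bullet> q.w x = 0"
    using p.wn[OF x] q.wn[OF x] p.wh[OF x] q.wh[OF x] by (simp_all add: inner_commute)
  note [simp] = comm p.hn[OF x] q.hn[OF x] p.wn[OF x] q.wn[OF x] p.ww[OF x] q.ww[OF x]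
  obtain V1 where V1: "D f1 x V1 = q.a x *\<^sub>R n1 x" "D f2 x V1 = - (p.a x *\<^sub>R n2 x)"
    using derivative_surj[of "q.a x *\<^sub>R n1 x" "- (p.a x *\<^sub>R n2 x)"] by (auto simp: p.a_def q.a_def)
  obtain V2 where V2: "D f1 x V2 = p.w x" "D f2 x V2 = 0"
    using derivative_surj[of "p.w x" 0] by auto
  obtain V3 where V3: "D f1 x V3 = 0" "D f2 x V3 = q.w x"
    using derivative_surj[of 0 "q.w x"] by auto
  show ?thesis
    by (rule that[of V1 V2 V3]) (simp_all add: p.\<alpha>_def p.\<beta>_def q.\<beta>_def V1 V2 V3 p.a_def[of x, symmetric])
qed

lemma q_\<delta>: "q.\<delta> x v = - p.\<delta> x v"
proof -
  have "((\<lambda>y. n1 y \<bullet> n1 y + n2 y \<bullet> n2 y) has_derivative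
      (\<lambda>v. (n1 x \<bullet> D n1 x v + D n1 x v \<bullet> n1 x) + (n2 x \<bullet> D n2 x v + D n2 x v \<bullet> n2 x))) (at x)"
    by (intro has_derivative_add has_derivative_inner p.dn[OF x] q.dn[OF x])
  moreover have "((\<lambda>y. n1 y \<bullet> n1 y + n2 y \<bullet> n2 y) has_derivative (\<lambda>v. 0)) (at x)"
    by (rule has_derivative_transform_within_open[OF has_derivative_const p.U x]) (simp add: unit)
  ultimately have "(\<lambda>v. (n1 x \<bullet> D n1 x v + D n1 x v \<bullet> n1 x) + (n2 x \<bullet> D n2 x v + D n2 x v \<bullet> n2 x)) = (\<lambda>v. 0)"
    by (rule has_derivative_unique)
  from fun_cong[OF this, of v] show ?thesis
    by (simp add: p.\<delta>_def q.\<delta>_def inner_commute)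
qed

lemma linear_D: "linear (D f1 x)" "linear (D f2 x)" "linear (D n1 x)" "linear (D n2 x)"
  using p.dh[OF x] q.dh[OF x] p.dn[OF x] q.dn[OF x] by (simp_all add: has_derivative_linear)

lemma linear_DF: "linear (DF x)" and linear_DN: "linear (DN x)"
  using linear_D unfolding DF_def DN_def linear_iff
  by (simp_all add: inner_add_left algebra_simps)

lemma inj_DF: "inj (DF x)"
  unfolding linear_injective_0[OF linear_DF] DF_def zero_prod_def prod.inject
  using immersed[OF x] by blast

lemma subspace_DF: "subspace (range (DF x))"
  using linear_DF by (rule linear_subspace_image) simp

lemma dim_DF: "dim (range (DF x)) = 3"
  using linear_DF inj_DF by (simp add: dim_image_eq)

lemma DN_in_range: "DN x v \<in> range (DF x)"
proof -
  have "f1 x \<bullet> fst (DN x v) = 0" "f2 x \<bullet> snd (DN x v) = 0"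
    using p.hh[OF x] q.hh[OF x] by (simp_all add: DN_def inner_diff_right inner_commute)
  moreover have "n1 x \<bullet> fst (DN x v) + n2 x \<bullet> snd (DN x v) = 0"
    using p.hn[OF x] q.hn[OF x] q_\<delta>[of v]
    by (simp add: DN_def inner_diff_right inner_commute p.\<delta>_def q.\<delta>_def)
  ultimately obtain u where "D f1 x u = fst (DN x v)" "D f2 x u = snd (DN x v)"
    using derivative_surj by blast
  then have "DN x v = DF x u" by (simp add: DF_def)
  then show ?thesis by simp
qed

text \<open>Differentiating the relation \<open>tangent\<close> along \<open>u\<close> expresses the
  left side by second derivatives of the immersion, which are symmetric. The radial parts removed in
  \<open>DN\<close> do not matter, because df1 and df2 are orthogonal to f1 and f2.\<close>

lemma DN_symmetric: "DN x u \<bullet> DF x v = DN x v \<bullet> DF x u"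
proof -
  have "D n1 x u \<bullet> D f1 x v + D n2 x u \<bullet> D f2 x v =
    - (n1 x \<bullet> D (\<lambda>y. D f1 y v) x u + n2 x \<bullet> D (\<lambda>y. D f2 y v) x u)" for u v
  proof -
    let ?T = "\<lambda>u. (n1 x \<bullet> D (\<lambda>y. D f1 y v) x u + D n1 x u \<bullet> D f1 x v) +
      (n2 x \<bullet> D (\<lambda>y. D f2 y v) x u + D n2 x u \<bullet> D f2 x v)"
    have "((\<lambda>y. n1 y \<bullet> D f1 y v + n2 y \<bullet> D f2 y v) has_derivative ?T) (at x)"
      by (intro has_derivative_add has_derivative_inner p.dn[OF x] q.dn[OF x] p.ddh[OF x] q.ddh[OF x])
    moreover have "((\<lambda>y. n1 y \<bullet> D f1 y v + n2 y \<bullet> D f2 y v) has_derivative (\<lambda>u. 0)) (at x)"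
      by (rule has_derivative_transform_within_open[OF has_derivative_const p.U x]) (simp add: tangent)
    ultimately have "?T = (\<lambda>u. 0)"
      by (rule has_derivative_unique)
    from fun_cong[OF this, of u] show ?thesis by simp
  qed
  from this[of u v] this[of v u] show ?thesis
    using p.sym(1)[OF x, of u v] q.sym(1)[OF x, of u v] p.h_dh[OF x] q.h_dh[OF x]
    by (simp add: DN_def DF_def inner_diff_left)
qed

text \<open>The shape operator is moved from chart coordinates to the tangent space inside
  \<open>R33\<close>, where it is self-adjoint for the ambient inner product. Its values off the
  tangent space depend on the chosen left inverse and carry no meaning.\<close>

lemma shape_endomorphism:
  obtains S where "linear S" "\<And>v. S (DF x v) = - DN x v" "S ` range (DF x) \<subseteq> range (DF x)"
    "\<And>s t. s \<in> range (DF x) \<Longrightarrow> t \<in> range (DF x) \<Longrightarrow> S s \<bullet> t = s \<bullet> S t"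
proof -
  obtain g where g: "linear g" "g \<circ> DF x = id"
    using linear_injective_left_inverse[OF linear_DF inj_DF] by blast
  then have g': "g (DF x v) = v" for v by (metis comp_apply id_apply)
  define S where "S t = - DN x (g t)" for t
  have S: "S (DF x v) = - DN x v" for v by (simp add: S_def g')
  have "linear S"
    using linear_compose[OF g(1) linear_DN] by (simp add: S_def[abs_def] o_def linear_compose_neg)
  moreover have "S ` range (DF x) \<subseteq> range (DF x)"
    using DN_in_range subspace_DF by (auto simp: S intro!: subspace_neg)
  moreover have "S s \<bullet> t = s \<bullet> S t" if "s \<in> range (DF x)" "t \<in> range (DF x)" for s t
    using that DN_symmetric by (auto simp: S inner_commute)
  ultimately show ?thesis using that S by blast
qed

end

end

text \<open>The shape operator is \<open>\<mu>\<close> plus \<open>\<kappa>\<close> times the orthogonal projection onto the unit vector \<open>DF x e\<close>;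
  the umbilical case is \<open>\<kappa> = 0\<close>.\<close>

locale hypersurface_patch = patch +
  fixes \<mu> \<kappa> :: real
  assumes principal: "x \<in> U \<Longrightarrow> \<exists>e. D f1 x e \<bullet> D f1 x e + D f2 x e \<bullet> D f2 x e = 1 \<and>
      (\<forall>v. D n1 x v - (D n1 x v \<bullet> f1 x) *\<^sub>R f1 x =
             - (\<mu> *\<^sub>R D f1 x v) - (\<kappa> * (D f1 x e \<bullet> D f1 x v + D f2 x e \<bullet> D f2 x v)) *\<^sub>R D f1 x e \<and>
           D n2 x v - (D n2 x v \<bullet> f2 x) *\<^sub>R f2 x =
             - (\<mu> *\<^sub>R D f2 x v) - (\<kappa> * (D f1 x e \<bullet> D f1 x v + D f2 x e \<bullet> D f2 x v)) *\<^sub>R D f2 x e)"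
begin

lemma swap: "hypersurface_patch U f2 n2 f1 n1 \<mu> \<kappa>"
proof (unfold_locales, goal_cases)
  case (1 x) then show ?case using unit[of x] by (simp add: add.commute)
next
  case (2 x v) then show ?case using tangent[of x v] by (simp add: add.commute)
next
  case (3 x v) then show ?case using immersed[of x v] by simp
next
  case (4 x) then show ?case using principal[of x] by (simp add: add.commute conj_commute)
qed

context fixes x assumes x: "x \<in> U"
begin

text \<open>\<open>y1\<close>, \<open>y2\<close>, \<open>y3\<close> are the inner products of the
  principal vector with n1, w1, w2, and \<eta> is the pairing with that vector. The last equation is
  its unit length, written in the frame that is not normalized.\<close>

lemma principal_forms:
  obtains y1 y2 y3 \<eta> where
    "\<And>v. p.\<delta> x v = - \<mu> * p.\<alpha> x v - \<kappa> * y1 * \<eta> v"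
    "\<And>v. q.\<delta> x v = \<mu> * p.\<alpha> x v + \<kappa> * y1 * \<eta> v"
    "\<And>v. p.\<gamma> x v = - \<mu> * p.\<beta> x v - \<kappa> * y2 * \<eta> v"
    "\<And>v. q.\<gamma> x v = - \<mu> * q.\<beta> x v - \<kappa> * y3 * \<eta> v"
    "\<And>v. p.a x * q.a x * \<eta> v = y1 * p.\<alpha> x v + q.a x * y2 * p.\<beta> x v + p.a x * y3 * q.\<beta> x v"
    "p.a x * q.a x = y1\<^sup>2 + q.a x * y2\<^sup>2 + p.a x * y3\<^sup>2"
proof -
  obtain e where e: "D f1 x e \<bullet> D f1 x e + D f2 x e \<bullet> D f2 x e = 1"
    and P: "\<And>v. D n1 x v - (D n1 x v \<bullet> f1 x) *\<^sub>R f1 x =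
             - (\<mu> *\<^sub>R D f1 x v) - (\<kappa> * (D f1 x e \<bullet> D f1 x v + D f2 x e \<bullet> D f2 x v)) *\<^sub>R D f1 x e"
    and Q: "\<And>v. D n2 x v - (D n2 x v \<bullet> f2 x) *\<^sub>R f2 x =
             - (\<mu> *\<^sub>R D f2 x v) - (\<kappa> * (D f1 x e \<bullet> D f1 x v + D f2 x e \<bullet> D f2 x v)) *\<^sub>R D f2 x e"
    using principal[OF x] by blast
  define \<eta> where "\<eta> v = D f1 x e \<bullet> D f1 x v + D f2 x e \<bullet> D f2 x v" for v
  have nf: "n1 x \<bullet> f1 x = 0" "n2 x \<bullet> f2 x = 0"
    using p.hn[OF x] q.hn[OF x] by (simp_all add: inner_commute)
  have P': "z \<bullet> D n1 x v = - \<mu> * (z \<bullet> D f1 x v) - \<kappa> * (z \<bullet> D f1 x e) * \<eta> v" if "z \<bullet> f1 x = 0" for z v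
    using arg_cong[OF P[of v], of "\<lambda>y. z \<bullet> y"] that by (simp add: inner_diff_right \<eta>_def)
  have Q': "z \<bullet> D n2 x v = - \<mu> * (z \<bullet> D f2 x v) - \<kappa> * (z \<bullet> D f2 x e) * \<eta> v" if "z \<bullet> f2 x = 0" for z v
    using arg_cong[OF Q[of v], of "\<lambda>y. z \<bullet> y"] that by (simp add: inner_diff_right \<eta>_def)
  let ?y1 = "n1 x \<bullet> D f1 x e" and ?y2 = "p.w x \<bullet> D f1 x e" and ?y3 = "q.w x \<bullet> D f2 x e"
  have y1: "n2 x \<bullet> D f2 x e = - ?y1"
    using tangent[OF x, of e] by simp
  have ab: "p.a x * q.a x * \<eta> v = ?y1 * p.\<alpha> x v + q.a x * ?y2 * p.\<beta> x v + p.a x * ?y3 * q.\<beta> x v" for v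
  proof -
    have "p.a x * (D f1 x e \<bullet> D f1 x v) = ?y1 * p.\<alpha> x v + ?y2 * p.\<beta> x v"
      using p.inner_h_perp[OF x p.h_dh[OF x], of e "D f1 x v"] by (simp add: p.\<alpha>_def p.\<beta>_def)
    moreover have "q.a x * (D f2 x e \<bullet> D f2 x v) = ?y1 * p.\<alpha> x v + ?y3 * q.\<beta> x v"
      using q.inner_h_perp[OF x q.h_dh[OF x], of e "D f2 x v"] q_\<alpha>[OF x, of v] y1
      by (simp add: q.\<alpha>_def q.\<beta>_def)
    ultimately show ?thesis
      using a_sum[OF x] unfolding \<eta>_def by algebra
  qed
  show ?thesis
  proof (rule that[of ?y1 \<eta> ?y2 ?y3])
    show "p.a x * q.a x = ?y1\<^sup>2 + q.a x * ?y2\<^sup>2 + p.a x * ?y3\<^sup>2"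
      using ab[of e] e by (simp add: p.\<alpha>_def p.\<beta>_def q.\<beta>_def \<eta>_def power2_eq_square mult.assoc)
    show "p.\<delta> x v = - \<mu> * p.\<alpha> x v - \<kappa> * ?y1 * \<eta> v" for v
      unfolding p.\<delta>_def p.\<alpha>_def by (rule P'[OF nf(1)])
    show "q.\<delta> x v = \<mu> * p.\<alpha> x v + \<kappa> * ?y1 * \<eta> v" for v
      using Q'[OF nf(2), of v] y1 q_\<alpha>[OF x, of v] by (simp add: q.\<delta>_def q.\<alpha>_def)
    show "p.\<gamma> x v = - \<mu> * p.\<beta> x v - \<kappa> * ?y2 * \<eta> v" for v
      unfolding p.\<gamma>_def p.\<beta>_def by (rule P'[OF p.wh[OF x]])
    show "q.\<gamma> x v = - \<mu> * q.\<beta> x v - \<kappa> * ?y3 * \<eta> v" for v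
      unfolding q.\<gamma>_def q.\<beta>_def by (rule Q'[OF q.wh[OF x]])
  qed (rule ab)
qed


text \<open>In the first case the tangential part of \<open>(n1, - n2)\<close> spans the principal line of \<open>\<mu> + \<kappa>\<close>; in the
  second case this line bisects the directions \<open>(w1, 0)\<close> and \<open>(0, w2)\<close>, up to signs.\<close>

lemma dichotomy:
  assumes a: "0 < p.a x" "0 < q.a x" and \<kappa>: "\<kappa> \<noteq> 0"
  obtains (normal) "\<And>v. p.\<delta> x v = - (\<mu> + \<kappa>) * p.\<alpha> x v"
      "\<And>v. p.\<gamma> x v = - \<mu> * p.\<beta> x v" "\<And>v. q.\<gamma> x v = - \<mu> * q.\<beta> x v"
  | (oblique) c d where "c * d = (\<kappa> / 2)\<^sup>2" "\<And>v. p.\<delta> x v = - \<mu> * p.\<alpha> x v"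
      "\<And>v. p.\<gamma> x v + (\<mu> + \<kappa> / 2) * p.\<beta> x v = c * q.\<beta> x v"
      "\<And>v. q.\<gamma> x v + (\<mu> + \<kappa> / 2) * q.\<beta> x v = d * p.\<beta> x v"
proof -
  let ?a = "p.a x" and ?b = "q.a x"
  obtain y1 y2 y3 \<eta> where
    \<delta>: "\<And>v. p.\<delta> x v = - \<mu> * p.\<alpha> x v - \<kappa> * y1 * \<eta> v" and
    \<gamma>1: "\<And>v. p.\<gamma> x v = - \<mu> * p.\<beta> x v - \<kappa> * y2 * \<eta> v" and
    \<gamma>2: "\<And>v. q.\<gamma> x v = - \<mu> * q.\<beta> x v - \<kappa> * y3 * \<eta> v" and
    \<eta>: "\<And>v. ?a * ?b * \<eta> v = y1 * p.\<alpha> x v + ?b * y2 * p.\<beta> x v + ?a * y3 * q.\<beta> x v" and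
    norm: "?a * ?b = y1\<^sup>2 + ?b * y2\<^sup>2 + ?a * y3\<^sup>2"
    by (rule principal_forms) blast
  obtain V1 V2 V3 where V:
    "p.\<alpha> x V1 = ?a * ?b" "p.\<beta> x V1 = 0" "q.\<beta> x V1 = 0"
    "p.\<alpha> x V2 = 0" "p.\<beta> x V2 = ?a" "q.\<beta> x V2 = 0"
    "p.\<alpha> x V3 = 0" "p.\<beta> x V3 = 0" "q.\<beta> x V3 = ?b"
    by (rule dual_frame[OF x])
  have \<eta>V: "\<eta> V1 = y1" "\<eta> V2 = y2" "\<eta> V3 = y3"
    using \<eta>[of V1] \<eta>[of V2] \<eta>[of V3] a by (simp_all add: V)
  \<comment> \<open>The components of \<mu> - A along n1, w1 and w2. Rank one means that each is -
    \<kappa> yi \<eta>.\<close>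
  let ?\<sigma>1 = "\<lambda>y v. p.\<delta> y v + \<mu> * p.\<alpha> y v"
  let ?\<sigma>2 = "\<lambda>y v. p.\<gamma> y v + \<mu> * p.\<beta> y v"
  let ?\<sigma>3 = "\<lambda>y v. q.\<gamma> y v + \<mu> * q.\<beta> y v"
  note diff = p.diff_forms[OF x] q.diff_forms[OF x]
  note d\<sigma> = ext_d_add_scale[OF diff(4,1)] ext_d_add_scale[OF diff(3,2)] ext_d_add_scale[OF diff(7,6)]
  have \<sigma>V: "?\<sigma>1 x v = - \<kappa> * y1 * \<eta> v" "?\<sigma>2 x v = - \<kappa> * y2 * \<eta> v" "?\<sigma>3 x v = - \<kappa> * y3 * \<eta> v" for v
    by (simp_all add: \<delta> \<gamma>1 \<gamma>2)
  \<comment> \<open>This is d\<sigma> \<and> \<eta> on \<open>V1\<close>, \<open>V2\<close>,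
    \<open>V3\<close>, since \<eta> takes the values \<open>y1\<close>, \<open>y2\<close>,
    \<open>y3\<close> there. After cancelling \<kappa>, d(\<sigma>i \<and> \<sigma>j) = 0 reads yj Q
    \<sigma>i = yi Q \<sigma>j.\<close>
  define Q where "Q \<sigma> = ext_d \<sigma> x V1 V2 * y3 + ext_d \<sigma> x V2 V3 * y1 + ext_d \<sigma> x V3 V1 * y2" for \<sigma>
  have proportional: "?\<sigma>1 y u * ?\<sigma>2 y v = ?\<sigma>1 y v * ?\<sigma>2 y u" "?\<sigma>1 y u * ?\<sigma>3 y v = ?\<sigma>1 y v * ?\<sigma>3 y u"
      "?\<sigma>2 y u * ?\<sigma>3 y v = ?\<sigma>2 y v * ?\<sigma>3 y u" if y: "y \<in> U" for y u v
    by (rule hypersurface_patch.principal_forms[OF hypersurface_patch_axioms y], simp)+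
  have "y2 * Q ?\<sigma>1 = y1 * Q ?\<sigma>2"
    using ext_d_proportional[OF p.U x d\<sigma>(1) d\<sigma>(3) proportional(1), of V1 V2 V3] \<kappa>
    unfolding \<sigma>V \<eta>V Q_def by algebra
  moreover have "y3 * Q ?\<sigma>1 = y1 * Q ?\<sigma>3"
    using ext_d_proportional[OF p.U x d\<sigma>(1) d\<sigma>(5) proportional(2), of V1 V2 V3] \<kappa>
    unfolding \<sigma>V \<eta>V Q_def by algebra
  moreover have "y3 * Q ?\<sigma>2 = y2 * Q ?\<sigma>3"
    using ext_d_proportional[OF p.U x d\<sigma>(3) d\<sigma>(5) proportional(3), of V1 V2 V3] \<kappa>
    unfolding \<sigma>V \<eta>V Q_def by algebra
  \<comment> \<open>\<delta> is closed, and a d\<alpha> = \<delta> \<and> \<alpha> + \<gamma> \<and>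
    \<beta> contains the factor \<eta>, because the parts with \<mu> are multiples of \<alpha>
    \<and> \<alpha> and \<beta> \<and> \<beta>.\<close>
  moreover have "Q ?\<sigma>1 = 0"
  proof -
    have "?a * Q ?\<sigma>1 = 0"
      using p.ext_d_\<alpha>[OF x, of V1 V2] p.ext_d_\<alpha>[OF x, of V2 V3] p.ext_d_\<alpha>[OF x, of V3 V1] a_sum[OF x]
      unfolding Q_def d\<sigma> p.ext_d_\<delta>[OF x] \<delta> \<gamma>1 V \<eta>V by algebra
    then show ?thesis using a by simp
  qed
  \<comment> \<open>Modulo \<eta>, the terms with \<mu>^2 in d\<gamma> and \<mu> d\<beta> cancel.
    What is left is the curvature term \<beta> \<and> \<alpha>; the same happens for
    \<open>?\<sigma>3\<close> on the other sphere.\<close>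
  moreover have "Q ?\<sigma>2 = - ?a\<^sup>2 * ?b * y3"
  proof -
    have "?a * Q ?\<sigma>2 = ?a * (- ?a\<^sup>2 * ?b * y3)"
      using p.ext_d_\<beta>[OF x, of V1 V2] p.ext_d_\<beta>[OF x, of V2 V3] p.ext_d_\<beta>[OF x, of V3 V1]
        p.ext_d_\<gamma>[OF x, of V1 V2] p.ext_d_\<gamma>[OF x, of V2 V3] p.ext_d_\<gamma>[OF x, of V3 V1]
      unfolding Q_def d\<sigma> \<delta> \<gamma>1 V \<eta>V by algebra
    then show ?thesis using a unfolding mult_cancel_left by simp
  qed
  moreover have "Q ?\<sigma>3 = - ?a * ?b\<^sup>2 * y2"
  proof -
    have "?b * Q ?\<sigma>3 = ?b * (- ?a * ?b\<^sup>2 * y2)"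
      using q.ext_d_\<beta>[OF x, of V1 V2] q.ext_d_\<beta>[OF x, of V2 V3] q.ext_d_\<beta>[OF x, of V3 V1]
        q.ext_d_\<gamma>[OF x, of V1 V2] q.ext_d_\<gamma>[OF x, of V2 V3] q.ext_d_\<gamma>[OF x, of V3 V1]
      unfolding Q_def d\<sigma> q_\<delta>[OF x] q_\<alpha>[OF x] \<delta> \<gamma>2 V \<eta>V by algebra
    then show ?thesis using a unfolding mult_cancel_left by simp
  qed
  ultimately have y: "y1 * y3 = 0" "y1 * y2 = 0" "?a * y3\<^sup>2 = ?b * y2\<^sup>2"
    using a by (simp_all add: power2_eq_square mult_ac)
  show ?thesis
  proof (cases "y1 = 0")
    case False
    then have y23: "y2 = 0" "y3 = 0" using y by simp_all
    have "y1\<^sup>2 = ?a * ?b" using norm y23 by simp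
    then have "?a * ?b * (y1 * \<eta> v) = ?a * ?b * p.\<alpha> x v" for v
      using \<eta>[of v] y23 by algebra
    then have y\<eta>: "y1 * \<eta> v = p.\<alpha> x v" for v
      using a by simp
    have "p.\<delta> x v = - (\<mu> + \<kappa>) * p.\<alpha> x v" for v
      using \<delta>[of v] y\<eta>[of v] by algebra
    then show ?thesis
      using normal \<gamma>1 \<gamma>2 y23 by simp
  next
    case True
    \<comment> \<open>The third relation in \<open>y\<close> makes the two remaining summands of
      \<open>norm\<close> equal, so each is half of the total.\<close>
    have "?b * (2 * y2\<^sup>2) = ?b * ?a" "?a * (2 * y3\<^sup>2) = ?a * ?b"
      using y(3) norm True by algebra+
    then have "2 * y2\<^sup>2 = ?a" "2 * y3\<^sup>2 = ?b"
      using a unfolding mult_cancel_left by simp_all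
    then have sq: "y2\<^sup>2 = ?a / 2" "y3\<^sup>2 = ?b / 2"
      by simp_all
    show ?thesis
    \<comment> \<open>Both witnesses carry the sign of \<open>y2 * y3\<close>, which is not
      determined; it drops out of their product.\<close>
    proof (rule oblique[of "- \<kappa> * y2 * y3 / ?b" "- \<kappa> * y2 * y3 / ?a"])
      have "?a * ?b * (- \<kappa> * y2 * y3 / ?b * (- \<kappa> * y2 * y3 / ?a)) = \<kappa>\<^sup>2 * (y2\<^sup>2 * y3\<^sup>2)"
        using a by (simp add: field_simps power2_eq_square)
      also have "\<dots> = ?a * ?b * (\<kappa> / 2)\<^sup>2"
        unfolding sq by (simp add: power2_eq_square)
      finally show "- \<kappa> * y2 * y3 / ?b * (- \<kappa> * y2 * y3 / ?a) = (\<kappa> / 2)\<^sup>2"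
        using a unfolding mult_cancel_left by simp
      fix v
      show "p.\<delta> x v = - \<mu> * p.\<alpha> x v"
        using \<delta>[of v] True by simp
      have "?a * ?b * (y2 * \<eta> v) = ?a * ?b * (p.\<beta> x v / 2 + y2 * y3 / ?b * q.\<beta> x v)"
        using \<eta>[of v] True sq a by (simp add: field_simps power2_eq_square)
      then have "y2 * \<eta> v = p.\<beta> x v / 2 + y2 * y3 / ?b * q.\<beta> x v"
        using a by simp
      then show "p.\<gamma> x v + (\<mu> + \<kappa> / 2) * p.\<beta> x v = - \<kappa> * y2 * y3 / ?b * q.\<beta> x v"
        using \<gamma>1[of v] by (simp add: algebra_simps)
      have "?a * ?b * (y3 * \<eta> v) = ?a * ?b * (q.\<beta> x v / 2 + y2 * y3 / ?a * p.\<beta> x v)"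
        using \<eta>[of v] True sq a by (simp add: field_simps power2_eq_square)
      then have "y3 * \<eta> v = q.\<beta> x v / 2 + y2 * y3 / ?a * p.\<beta> x v"
        using a by simp
      then show "q.\<gamma> x v + (\<mu> + \<kappa> / 2) * q.\<beta> x v = - \<kappa> * y2 * y3 / ?a * p.\<beta> x v"
        using \<gamma>2[of v] by (simp add: algebra_simps)
    qed
  qed
qed

lemma umbilic:
  assumes "\<kappa> = 0"
  shows "p.\<delta> x v = - (\<mu> + \<kappa>) * p.\<alpha> x v" "p.\<gamma> x v = - \<mu> * p.\<beta> x v" "q.\<gamma> x v = - \<mu> * q.\<beta> x v"
  by (rule principal_forms, simp add: assms)+

text \<open>Apply d to \<gamma> + \<mu> \<beta> = 0 and evaluate on \<open>V1\<close>,
  \<open>V2\<close>. The curvature term of d\<gamma> produces a, the products of connection and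
  coframe terms produce the right side.\<close>

lemma normal_relation:
  assumes W: "open W" "x \<in> W" and a: "0 < p.a x" "0 < q.a x"
    and \<delta>: "\<And>v. p.\<delta> x v = - \<tau> * p.\<alpha> x v"
    and \<gamma>: "\<And>y v. y \<in> W \<Longrightarrow> p.\<gamma> y v = - \<mu> * p.\<beta> y v"
  shows "p.a x = \<tau> * \<mu> - \<mu>\<^sup>2"
proof -
  obtain V1 V2 V3 where V:
    "p.\<alpha> x V1 = p.a x * q.a x" "p.\<beta> x V1 = 0" "q.\<beta> x V1 = 0"
    "p.\<alpha> x V2 = 0" "p.\<beta> x V2 = p.a x" "q.\<beta> x V2 = 0"
    "p.\<alpha> x V3 = 0" "p.\<beta> x V3 = 0" "q.\<beta> x V3 = q.a x"
    by (rule dual_frame[OF x])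
  have "ext_d (\<lambda>y v. p.\<gamma> y v + \<mu> * p.\<beta> y v) x V1 V2 = 0"
    using \<gamma> by (intro ext_d_zero[OF W]) simp
  then have "p.a x * (ext_d p.\<gamma> x V1 V2 + \<mu> * ext_d p.\<beta> x V1 V2) = 0"
    using ext_d_add_scale(2)[OF p.diff_forms(3,2)[OF x]] by simp
  then have "(p.a x)\<^sup>2 * q.a x * p.a x = (p.a x)\<^sup>2 * q.a x * (\<tau> * \<mu> - \<mu>\<^sup>2)"
    using p.ext_d_\<gamma>[OF x, of V1 V2] p.ext_d_\<beta>[OF x, of V1 V2]
    unfolding \<delta> \<gamma>[OF W(2)] V by algebra
  then show ?thesis using a by simp
qed

text \<open>The proportionality to \<open>q.\<beta>\<close> enters through d(\<omega> \<and>
  \<open>q.\<beta>\<close>) = 0, so the factor at each point of \<open>W\<close> needs no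
  regularity. On the frame this compares the curvature term of \<open>p.\<gamma>\<close> with the
  derivative of \<open>q.\<beta>\<close>, which contributes d.\<close>

lemma oblique_relation:
  assumes W: "open W" "x \<in> W" and a: "0 < p.a x" "0 < q.a x"
    and \<delta>: "\<And>v. p.\<delta> x v = 0"
    and proportional: "\<And>y. y \<in> W \<Longrightarrow> \<exists>c. \<forall>v. p.\<gamma> y v + k * p.\<beta> y v = c * q.\<beta> y v"
    and c: "\<And>v. p.\<gamma> x v + k * p.\<beta> x v = c * q.\<beta> x v"
    and d: "\<And>v. q.\<gamma> x v + k * q.\<beta> x v = d * p.\<beta> x v"
  shows "q.a x * (p.a x + k\<^sup>2) = c * d * p.a x"
proof -
  obtain V1 V2 V3 where V:
    "p.\<alpha> x V1 = p.a x * q.a x" "p.\<beta> x V1 = 0" "q.\<beta> x V1 = 0"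
    "p.\<alpha> x V2 = 0" "p.\<beta> x V2 = p.a x" "q.\<beta> x V2 = 0"
    "p.\<alpha> x V3 = 0" "p.\<beta> x V3 = 0" "q.\<beta> x V3 = q.a x"
    by (rule dual_frame[OF x])
  let ?\<omega> = "\<lambda>y v. p.\<gamma> y v + k * p.\<beta> y v"
  note diff = p.diff_forms[OF x] q.diff_forms[OF x]
  note d\<omega> = ext_d_add_scale[OF diff(3,2)]
  have "?\<omega> y u * q.\<beta> y v = ?\<omega> y v * q.\<beta> y u" if y: "y \<in> W" for y u v
  proof -
    obtain c where "\<And>v. ?\<omega> y v = c * q.\<beta> y v" using proportional[OF y] by blast
    then show ?thesis by simp
  qed
  from ext_d_proportional[OF W d\<omega>(1) diff(6) this, of V1 V2 V3]
  have "q.a x * ext_d ?\<omega> x V1 V2 = q.a x * (c * ext_d q.\<beta> x V1 V2)"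
    by (simp only: c) (simp add: V mult.commute mult.left_commute)
  then have "ext_d p.\<gamma> x V1 V2 + k * ext_d p.\<beta> x V1 V2 = c * ext_d q.\<beta> x V1 V2"
    using a by (simp add: d\<omega>)
  moreover have g: "p.\<gamma> x v = c * q.\<beta> x v - k * p.\<beta> x v" "q.\<gamma> x v = d * p.\<beta> x v - k * q.\<beta> x v" for v
    using c[of v] d[of v] by simp_all
  ultimately have "(p.a x)\<^sup>2 * q.a x * (q.a x * (p.a x + k\<^sup>2)) = (p.a x)\<^sup>2 * q.a x * (c * d * p.a x)"
    using p.ext_d_\<gamma>[OF x, of V1 V2] p.ext_d_\<beta>[OF x, of V1 V2] q.ext_d_\<beta>[OF x, of V1 V2]
    unfolding \<delta> q_\<delta>[OF x] q_\<alpha>[OF x] g V by algebra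
  then show ?thesis using a by simp
qed

text \<open>\<delta> is closed, so \<mu> d\<alpha> = 0. But d\<alpha> takes the nonzero value - c
  \<open>q.a x\<close> on \<open>V2\<close>, \<open>V3\<close>.\<close>

lemma oblique_zero:
  assumes W: "open W" "x \<in> W" and a: "0 < p.a x" "0 < q.a x"
    and \<delta>: "\<And>y v. y \<in> W \<Longrightarrow> p.\<delta> y v = - \<mu> * p.\<alpha> y v"
    and c: "c \<noteq> 0" "\<And>v. p.\<gamma> x v + k * p.\<beta> x v = c * q.\<beta> x v"
  shows "\<mu> = 0"
proof -
  obtain V1 V2 V3 where V:
    "p.\<alpha> x V1 = p.a x * q.a x" "p.\<beta> x V1 = 0" "q.\<beta> x V1 = 0"
    "p.\<alpha> x V2 = 0" "p.\<beta> x V2 = p.a x" "q.\<beta> x V2 = 0"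
    "p.\<alpha> x V3 = 0" "p.\<beta> x V3 = 0" "q.\<beta> x V3 = q.a x"
    by (rule dual_frame[OF x])
  have "ext_d (\<lambda>y v. p.\<delta> y v + \<mu> * p.\<alpha> y v) x V2 V3 = 0"
    using \<delta> by (intro ext_d_zero[OF W]) simp
  then have "\<mu> * ext_d p.\<alpha> x V2 V3 = 0"
    using ext_d_add_scale(2)[OF p.diff_forms(4,1)[OF x]] p.ext_d_\<delta>[OF x] by simp
  moreover have "p.\<gamma> x V3 = c * q.a x"
    using c(2)[of V3] by (simp add: V)
  then have "p.a x * ext_d p.\<alpha> x V2 V3 = - c * q.a x * p.a x"
    using p.ext_d_\<alpha>[OF x, of V2 V3] by (simp add: V)
  ultimately show ?thesis using a c by auto
qed

end

section \<open>Exclusion of normals that are tangent to neither factor\<close>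

text \<open>By \<open>normal_relation\<close>, \<open>p.a\<close> is constant on \<open>W\<close>,
  so its differential 2 \<delta> vanishes. Since \<alpha> is not zero, \<tau> = 0, and then
  \<open>p.a\<close> would be - \<mu>^2.\<close>

lemma no_normal_patch:
  assumes W: "open W" "x \<in> W" "W \<subseteq> U" and a: "\<And>y. y \<in> W \<Longrightarrow> 0 < p.a y" "\<And>y. y \<in> W \<Longrightarrow> 0 < q.a y"
    and \<delta>: "\<And>y v. y \<in> W \<Longrightarrow> p.\<delta> y v = - \<tau> * p.\<alpha> y v"
    and \<gamma>1: "\<And>y v. y \<in> W \<Longrightarrow> p.\<gamma> y v = - \<mu> * p.\<beta> y v"
    and \<gamma>2: "\<And>y v. y \<in> W \<Longrightarrow> q.\<gamma> y v = - \<mu> * q.\<beta> y v"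
  shows False
proof -
  have pa: "p.a y = \<tau> * \<mu> - \<mu>\<^sup>2" if "y \<in> W" for y
    using that W by (intro normal_relation[of y W] a \<delta> \<gamma>1) auto
  have qa: "q.a x = \<tau> * \<mu> - \<mu>\<^sup>2"
  proof (rule hypersurface_patch.normal_relation[OF swap _ W(1,2)])
    show "q.\<delta> x v = - \<tau> * q.\<alpha> x v" for v
      using W \<delta>[of x v] q_\<delta>[of x v] q_\<alpha>[of x v] by auto
  qed (use W a \<gamma>2 in auto)
  have x: "x \<in> U" using W by blast
  have "(p.a has_derivative (\<lambda>v. 0)) (at x)"
    by (rule has_derivative_transform_within_open[OF has_derivative_const W(1,2)]) (simp add: pa)
  from has_derivative_unique[OF a_derivative[OF x] this] have \<delta>0: "p.\<delta> x v = 0" for v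
    by (metis mult_eq_0_iff zero_neq_numeral)
  obtain V where V: "p.\<alpha> x V = p.a x * q.a x"
    using dual_frame[OF x] by metis
  have "\<tau> = 0"
    using \<delta>[OF W(2), of V] \<delta>0[of V] V a[OF W(2)] by simp
  then show False
    using pa[OF W(2)] a(1)[OF W(2)] by simp
qed

text \<open>With \<mu> = 0 and k = \<kappa> / 2, the product c d is k^2. Adding
  \<open>oblique_relation\<close> and its version with the factors exchanged, all terms with k
  cancel and 2 \<open>p.a\<close> \<open>q.a\<close> = 0 remains.\<close>

lemma no_oblique_patch:
  assumes W: "open W" "x \<in> W" "W \<subseteq> U" and a: "0 < p.a x" "0 < q.a x" and \<kappa>: "\<kappa> \<noteq> 0"
    and obl: "\<And>y. y \<in> W \<Longrightarrow> \<exists>c d. c * d = (\<kappa> / 2)\<^sup>2 \<and> (\<forall>v. p.\<delta> y v = - \<mu> * p.\<alpha> y v \<and>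
      p.\<gamma> y v + (\<mu> + \<kappa> / 2) * p.\<beta> y v = c * q.\<beta> y v \<and>
      q.\<gamma> y v + (\<mu> + \<kappa> / 2) * q.\<beta> y v = d * p.\<beta> y v)"
  shows False
proof -
  have x: "x \<in> U" using W by blast
  obtain c d where cd: "c * d = (\<kappa> / 2)\<^sup>2"
    and c: "\<And>v. p.\<gamma> x v + (\<mu> + \<kappa> / 2) * p.\<beta> x v = c * q.\<beta> x v"
    and d: "\<And>v. q.\<gamma> x v + (\<mu> + \<kappa> / 2) * q.\<beta> x v = d * p.\<beta> x v"
    using obl[OF W(2)] by blast
  have "c \<noteq> 0" using cd \<kappa> by auto
  have \<delta>: "p.\<delta> y v = - \<mu> * p.\<alpha> y v" if "y \<in> W" for y v
    using obl[OF that] by blast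
  have \<mu>: "\<mu> = 0"
    by (rule oblique_zero[OF x W(1,2) a \<delta> \<open>c \<noteq> 0\<close> c])
  have "q.a x * (p.a x + (\<mu> + \<kappa> / 2)\<^sup>2) = c * d * p.a x"
    by (rule oblique_relation[OF x W(1,2) a _ _ c d]) (use \<delta>[OF W(2)] \<mu> obl in \<open>simp, blast\<close>)
  moreover have "p.a x * (q.a x + (\<mu> + \<kappa> / 2)\<^sup>2) = d * c * q.a x"
    by (rule hypersurface_patch.oblique_relation[OF swap x W(1,2) a(2,1) _ _ d c])
      (use \<delta>[OF W(2)] \<mu> obl q_\<delta>[OF x] in \<open>simp, blast\<close>)
  ultimately have "2 * p.a x * q.a x = 0"
    using cd \<mu> by algebra
  then show False using a by simp
qed

text \<open>For \<kappa> nonzero, \<open>W1\<close> and \<open>W2\<close> are the open sets where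
  the oblique and the normal shape, respectively, are ruled out by their equation for \<delta>. The
  two forms differ by \<kappa> \<alpha>, which is not zero, so \<open>x\<close> lies in one of the
  sets, and there \<open>dichotomy\<close> leaves one shape on a whole neighbourhood.\<close>

lemma normal_in_factor:
  assumes x: "x \<in> U"
  shows "p.a x = 0 \<or> p.a x = 1"
proof (rule ccontr)
  assume "\<not> ?thesis"
  moreover have "0 \<le> p.a x" "0 \<le> q.a x" by (simp_all add: p.a_def q.a_def)
  ultimately have ax: "0 < p.a x" "0 < q.a x"
    using a_sum[OF x] by auto
  define W where "W = {y \<in> U. 0 < p.a y \<and> 0 < q.a y}"
  have "continuous_on U p.a" "continuous_on U q.a"
    unfolding p.a_def[abs_def] q.a_def[abs_def]
    by (intro continuous_on_inner smooth_on_continuous_on p.n_smooth q.n_smooth)+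
  then have "open (U \<inter> p.a -` {0<..})" "open (U \<inter> q.a -` {0<..})"
    using p.U by (auto intro: continuous_open_preimage)
  then have "open ((U \<inter> p.a -` {0<..}) \<inter> (U \<inter> q.a -` {0<..}))" by blast
  also have "(U \<inter> p.a -` {0<..}) \<inter> (U \<inter> q.a -` {0<..}) = W" by (auto simp: W_def)
  finally have W: "open W" .
  have xW: "x \<in> W" using x ax by (simp add: W_def)
  have WU: "W \<subseteq> U" by (auto simp: W_def)
  have aW: "0 < p.a y" "0 < q.a y" "y \<in> U" if "y \<in> W" for y using that by (auto simp: W_def)
  show False
  proof (cases "\<kappa> = 0")
    case True
    show False
      by (rule no_normal_patch[OF W xW WU aW(1,2) umbilic]) (use True WU in auto)
  next
    case \<kappa>: False
    have form: "diff_form (\<lambda>y v. p.\<delta> y v + c * p.\<alpha> y v) y" if "y \<in> W" for y c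
      using that WU by (intro ext_d_add_scale p.diff_forms) auto
    define W1 where "W1 = {y \<in> W. \<exists>v. p.\<delta> y v + \<mu> * p.\<alpha> y v \<noteq> 0}"
    define W2 where "W2 = {y \<in> W. \<exists>v. p.\<delta> y v + (\<mu> + \<kappa>) * p.\<alpha> y v \<noteq> 0}"
    have op: "open W1" "open W2"
      unfolding W1_def W2_def by (rule open_nonzero_form[OF form W], assumption)+
    have n: "p.\<delta> y v = - (\<mu> + \<kappa>) * p.\<alpha> y v \<and> p.\<gamma> y v = - \<mu> * p.\<beta> y v \<and> q.\<gamma> y v = - \<mu> * q.\<beta> y v"
      if y: "y \<in> W1" for y v
    proof -
      have yW: "y \<in> W" using y by (simp add: W1_def)
      show ?thesis
      proof (rule dichotomy[OF aW(3,1,2)[OF yW] \<kappa>])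
        fix c d
        assume "\<And>v. p.\<delta> y v = - \<mu> * p.\<alpha> y v"
        then show ?thesis using y by (simp add: W1_def)
      qed auto
    qed
    have obl: "\<exists>c d. c * d = (\<kappa> / 2)\<^sup>2 \<and> (\<forall>v. p.\<delta> y v = - \<mu> * p.\<alpha> y v \<and>
      p.\<gamma> y v + (\<mu> + \<kappa> / 2) * p.\<beta> y v = c * q.\<beta> y v \<and>
      q.\<gamma> y v + (\<mu> + \<kappa> / 2) * q.\<beta> y v = d * p.\<beta> y v)" if y: "y \<in> W2" for y
    proof -
      have yW: "y \<in> W" using y by (simp add: W2_def)
      show ?thesis
      proof (rule dichotomy[OF aW(3,1,2)[OF yW] \<kappa>])
        assume *: "\<And>v. p.\<delta> y v = - (\<mu> + \<kappa>) * p.\<alpha> y v"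
        have "p.\<delta> y v + (\<mu> + \<kappa>) * p.\<alpha> y v = 0" for v
          unfolding * by (simp add: algebra_simps)
        then show ?thesis using y by (simp add: W2_def)
      qed blast
    qed
    obtain V where V: "p.\<alpha> x V = p.a x * q.a x"
      using dual_frame[OF x] by metis
    have "\<kappa> * p.\<alpha> x V \<noteq> 0"
      using V ax \<kappa> by simp
    moreover have "\<kappa> * p.\<alpha> x V = (p.\<delta> x V + (\<mu> + \<kappa>) * p.\<alpha> x V) - (p.\<delta> x V + \<mu> * p.\<alpha> x V)"
      by (simp add: algebra_simps)
    ultimately have "p.\<delta> x V + \<mu> * p.\<alpha> x V \<noteq> 0 \<or> p.\<delta> x V + (\<mu> + \<kappa>) * p.\<alpha> x V \<noteq> 0"
      by linarith
    then consider "x \<in> W1" | "x \<in> W2"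
      using xW unfolding W1_def W2_def by blast
    then show False
    proof cases
      case 1
      show False
      proof (rule no_normal_patch[OF op(1) 1])
        show "W1 \<subseteq> U" using WU by (auto simp: W1_def)
        show "0 < p.a y" "0 < q.a y" if "y \<in> W1" for y
          using that aW(1,2)[of y] by (simp_all add: W1_def)
        show "p.\<delta> y v = - (\<mu> + \<kappa>) * p.\<alpha> y v" "p.\<gamma> y v = - \<mu> * p.\<beta> y v" "q.\<gamma> y v = - \<mu> * q.\<beta> y v"
          if "y \<in> W1" for y v
          using n[OF that] by blast+
      qed
    next
      case 2
      show False
      proof (rule no_oblique_patch[OF op(2) 2 _ ax \<kappa> obl])
        show "W2 \<subseteq> U" using WU by (auto simp: W2_def)
      qed
    qed
  qed
qed


section \<open>Normal field tangent to the first factor\<close>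

context
  assumes n2: "\<And>y. y \<in> U \<Longrightarrow> n2 y = 0"
begin

lemma n1_unit: "x \<in> U \<Longrightarrow> n1 x \<bullet> n1 x = 1"
  using unit[of x] n2[of x] by simp

lemma n1_df1: "x \<in> U \<Longrightarrow> n1 x \<bullet> D f1 x v = 0"
  using tangent[of x v] n2[of x] by simp

lemma D_n2: "x \<in> U \<Longrightarrow> D n2 x v = 0"
proof -
  assume x: "x \<in> U"
  have "(n2 has_derivative (\<lambda>v. 0)) (at x)"
    by (rule has_derivative_transform_within_open[OF has_derivative_const q.U x]) (simp add: n2)
  from frechet_derivative_at[OF this] show ?thesis by metis
qed

lemma df1_collinear:
  assumes x: "x \<in> U"
  shows "D f1 x v = (p.w x \<bullet> D f1 x v) *\<^sub>R p.w x"
proof -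
  have "z \<bullet> D f1 x v = z \<bullet> ((p.w x \<bullet> D f1 x v) *\<^sub>R p.w x)" for z
    using p.inner_h_perp[OF x p.h_dh[OF x], of v z] n1_unit[OF x] n1_df1[OF x, of v]
    by (simp add: p.a_def inner_commute)
  then show ?thesis by (metis vector_eq_ldot)
qed

text \<open>Along a vector (0, z) orthogonal to the principal vector, n2 = 0 does not change, which
  forces \<mu> = 0. The same equation along \<open>e\<close> gives \<kappa> df2(e) = 0. So for
  \<kappa> nonzero the principal vector is w1 up to sign, and df1 takes values in the line of
  w1.\<close>

lemma factor_equations:
  assumes x: "x \<in> U"
  shows "\<mu> = 0" and "D n1 x v + \<kappa> *\<^sub>R D f1 x v = 0"
proof -
  obtain e where e: "D f1 x e \<bullet> D f1 x e + D f2 x e \<bullet> D f2 x e = 1"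
    and P: "\<And>v. D n1 x v - (D n1 x v \<bullet> f1 x) *\<^sub>R f1 x =
             - (\<mu> *\<^sub>R D f1 x v) - (\<kappa> * (D f1 x e \<bullet> D f1 x v + D f2 x e \<bullet> D f2 x v)) *\<^sub>R D f1 x e"
    and Q: "\<And>v. D n2 x v - (D n2 x v \<bullet> f2 x) *\<^sub>R f2 x =
             - (\<mu> *\<^sub>R D f2 x v) - (\<kappa> * (D f1 x e \<bullet> D f1 x v + D f2 x e \<bullet> D f2 x v)) *\<^sub>R D f2 x e"
    using principal[OF x] by blast
  have P': "D n1 x v = - (\<mu> *\<^sub>R D f1 x v) -
      (\<kappa> * (D f1 x e \<bullet> D f1 x v + D f2 x e \<bullet> D f2 x v)) *\<^sub>R D f1 x e" for v
    using P[of v] p.h_dn[OF x, of v] n1_df1[OF x, of v] by (simp add: p.\<alpha>_def inner_commute)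
  have Q': "\<mu> *\<^sub>R D f2 x v + (\<kappa> * (D f1 x e \<bullet> D f1 x v + D f2 x e \<bullet> D f2 x v)) *\<^sub>R D f2 x e = 0" for v
    using Q[of v] D_n2[OF x, of v] by (simp add: algebra_simps)
  obtain z where z: "z \<noteq> 0" "f2 x \<bullet> z = 0" "D f2 x e \<bullet> z = 0"
    using ex_orthogonal_pair[of "f2 x" "D f2 x e"] by blast
  obtain u where u: "D f1 x u = 0" "D f2 x u = z"
    using derivative_surj[OF x, of 0 z] z n2[OF x] by auto
  show \<mu>: "\<mu> = 0"
    using Q'[of u] z u by simp
  have \<kappa>: "\<kappa> *\<^sub>R D f2 x e = 0"
    using Q'[of e] e by (simp add: \<mu>)
  show "D n1 x v + \<kappa> *\<^sub>R D f1 x v = 0"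
  proof (cases "\<kappa> = 0")
    case True
    then show ?thesis using P'[of v] \<mu> by simp
  next
    case False
    then have e2: "D f2 x e = 0" using \<kappa> by simp
    define r where "r = p.w x \<bullet> D f1 x e"
    define s where "s = p.w x \<bullet> D f1 x v"
    have w: "p.w x \<bullet> p.w x = 1"
      using p.ww[OF x] n1_unit[OF x] by (simp add: p.a_def)
    have re: "D f1 x e = r *\<^sub>R p.w x" and sv: "D f1 x v = s *\<^sub>R p.w x"
      unfolding r_def s_def by (rule df1_collinear[OF x])+
    have "r * r = 1"
      using e e2 w by (simp add: re)
    then have "r * s * r = s" by algebra
    then show ?thesis
      using P'[of v] unfolding \<mu> e2 re sv by (simp add: w mult_ac)
  qed
qed

lemma image_open:
  assumes n0: "\<And>y. y \<in> U \<Longrightarrow> n1 y + \<kappa> *\<^sub>R f1 y = n0" and x: "x \<in> U"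
  obtains W where "open W" "(f1 x, f2 x) \<in> W"
    "\<And>z1 z2. (z1, z2) \<in> W \<Longrightarrow> norm z1 = 1 \<Longrightarrow> norm z2 = 1 \<Longrightarrow> z1 \<bullet> n0 = \<kappa> \<Longrightarrow>
      \<exists>y\<in>U. f1 y = z1 \<and> f2 y = z2"
proof -
  \<comment> \<open>Thicken the immersion by its three normal directions in \<open>R33\<close>, so that its derivative becomes
    onto; points of the thickening with the stated properties have zero normal coordinates.\<close>
  define H :: "(real^3) \<times> real \<times> real \<times> real \<Rightarrow> R33" where
    "H = (\<lambda>(y, r, t, u). ((1 + r) *\<^sub>R f1 y + t *\<^sub>R n0, (1 + u) *\<^sub>R f2 y))"
  define H' :: "(real^3) \<times> real \<times> real \<times> real \<Rightarrow> R33" where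
    "H' = (\<lambda>(v, r, t, u). (D f1 x v + r *\<^sub>R f1 x + t *\<^sub>R n0, D f2 x v + u *\<^sub>R f2 x))"
  define S where "S = U \<times> (UNIV :: (real \<times> real \<times> real) set)"
  \<comment> \<open>The bounds on \<open>r\<close> and \<open>u\<close> keep 1 + r and 1 + u
    positive, which excludes the second solution of each quadratic equation below.\<close>
  define T where "T = U \<times> ball (0::real) 1 \<times> (UNIV :: real set) \<times> ball (0::real) 1"
  let ?x = "(x, 0::real, 0::real, 0::real)"
  have open_ST: "open S" "open T" "T \<subseteq> S" "?x \<in> T" "?x \<in> S"
    using p.U x by (auto simp: S_def T_def intro!: open_Times)
  have f_cont: "continuous_on U f1" "continuous_on U f2"
    by (rule smooth_on_continuous_on[OF p.h_smooth] smooth_on_continuous_on[OF q.h_smooth])+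
  have contH: "continuous_on S H"
  proof -
    have "continuous_on S (\<lambda>z. f1 (fst z))" "continuous_on S (\<lambda>z. f2 (fst z))"
      by (rule continuous_on_compose2[OF f_cont(1)] continuous_on_compose2[OF f_cont(2)];
          auto simp: S_def intro: continuous_intros)+
    then show ?thesis
      unfolding H_def case_prod_beta by (intro continuous_intros)
  qed
  have derH: "(H has_derivative H') (at ?x)"
  proof -
    have fst: "(fst has_derivative fst) (at ?x)"
      by (rule bounded_linear_imp_has_derivative[OF bounded_linear_fst])
    have F: "((\<lambda>z. f1 (fst z)) has_derivative (\<lambda>h. D f1 x (fst h))) (at ?x)"
      by (rule has_derivative_compose[OF fst]) (simp add: p.dh[OF x])
    have G: "((\<lambda>z. f2 (fst z)) has_derivative (\<lambda>h. D f2 x (fst h))) (at ?x)"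
      by (rule has_derivative_compose[OF fst]) (simp add: q.dh[OF x])
    show ?thesis
      unfolding H_def H'_def case_prod_beta
      by (rule derivative_eq_intros F G refl | simp)+
  qed
  have surj: "surj H'"
    unfolding surj_def
  proof (rule allI)
    fix z :: R33
    define t where "t = fst z \<bullet> n1 x"
    \<comment> \<open>\<open>n0\<close> has component 1 along n1 and \<kappa> along f1: the
      coefficient \<open>t\<close> is read off first and its contribution to f1 is
      subtracted.\<close>
    define r where "r = fst z \<bullet> f1 x - t * \<kappa>"
    define u where "u = snd z \<bullet> f2 x"
    have [simp]: "n1 x \<bullet> f1 x = 0" "f1 x \<bullet> n1 x = 0" "f1 x \<bullet> f1 x = 1" "f2 x \<bullet> f2 x = 1" "n1 x \<bullet> n1 x = 1"
      using p.hn[OF x] p.hh[OF x] q.hh[OF x] n1_unit[OF x] by (simp_all add: inner_commute)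
    have n0x: "n0 = n1 x + \<kappa> *\<^sub>R f1 x" using n0[OF x] by simp
    have "\<exists>v. D f1 x v = fst z - r *\<^sub>R f1 x - t *\<^sub>R n0 \<and> D f2 x v = snd z - u *\<^sub>R f2 x"
      by (rule derivative_surj[OF x])
        (simp_all add: n0x r_def t_def u_def inner_diff_right inner_add_right n2[OF x] inner_commute algebra_simps)
    then obtain v where "D f1 x v = fst z - r *\<^sub>R f1 x - t *\<^sub>R n0" "D f2 x v = snd z - u *\<^sub>R f2 x" by blast
    then have "z = H' (v, r, t, u)"
      by (simp add: H'_def prod_eq_iff)
    then show "\<exists>y. z = H' y" ..
  qed
  have lin: "linear H'" using derH by (rule has_derivative_linear)
  obtain g where g: "linear g" "H' \<circ> g = id"
    using linear_surjective_right_inverse[OF lin surj] by blast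
  have "H ?x \<in> interior (H ` T)"
    using open_ST g
    by (intro sussmann_open_mapping[OF open_ST(1) contH _ derH, of g])
      (auto simp: linear_conv_bounded_linear interior_open)
  moreover have "H ?x = (f1 x, f2 x)" by (simp add: H_def)
  ultimately have "(f1 x, f2 x) \<in> interior (H ` T)" by simp
  moreover have "\<exists>y\<in>U. f1 y = z1 \<and> f2 y = z2"
    if z: "(z1, z2) \<in> interior (H ` T)" "norm z1 = 1" "norm z2 = 1" "z1 \<bullet> n0 = \<kappa>" for z1 z2
  proof -
    have "(z1, z2) \<in> H ` T" using z(1) interior_subset by blast
    then obtain y r t u where "(z1, z2) = H (y, r, t, u)" "(y, r, t, u) \<in> T"
      by (metis imageE prod_cases4)
    then have y: "y \<in> U" "\<bar>r\<bar> < 1" "\<bar>u\<bar> < 1"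
      and z1: "z1 = (1 + r) *\<^sub>R f1 y + t *\<^sub>R n0" and z2: "z2 = (1 + u) *\<^sub>R f2 y"
      by (simp_all add: H_def T_def)
    have ff: "f1 y \<bullet> f1 y = 1" "f2 y \<bullet> f2 y = 1" "n1 y \<bullet> n1 y = 1" "f1 y \<bullet> n1 y = 0"
      using p.hh q.hh n1_unit p.hn y by auto
    have "norm (f2 y) = 1" using ff(2) by (simp add: norm_eq_1)
    then have u: "u = 0" using z(3) y(3) z2 by auto
    have n0y: "n0 = n1 y + \<kappa> *\<^sub>R f1 y" using n0[OF y(1)] by simp
    have zeq: "z1 = (1 + r + t * \<kappa>) *\<^sub>R f1 y + t *\<^sub>R n1 y"
      unfolding z1 n0y by (simp add: algebra_simps)
    have "z1 \<bullet> z1 = 1" using z(2) by (simp add: norm_eq_1)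
    then have 1: "(1 + r + t * \<kappa>)\<^sup>2 + t\<^sup>2 = 1"
      unfolding zeq using ff
      by (simp add: inner_add_left inner_add_right inner_commute power2_eq_square)
    have 2: "(1 + r + t * \<kappa>) * \<kappa> + t = \<kappa>"
      using z(4) ff unfolding zeq n0y by (simp add: inner_add_left inner_add_right inner_commute)
    \<comment> \<open>In the plane of f1 y and n1 y, the line of points whose inner product with
      \<open>n0\<close> is \<kappa> meets the unit circle at f1 y and at one further point (or the
      same again), where 1 + r = -1.\<close>
    have "(1 + r)\<^sup>2 = 1"
    proof -
      have "(1 + \<kappa>\<^sup>2) * ((1 + r)\<^sup>2 - 1) = 0" using 1 2 by algebra
      moreover have "1 + \<kappa>\<^sup>2 \<noteq> 0" by (metis add_nonneg_eq_0_iff zero_le_one zero_le_power2 zero_neq_one)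
      ultimately show ?thesis by simp
    qed
    then have r: "r = 0" using y(2) by (auto simp: power2_eq_1_iff)
    have "t * (1 + \<kappa>\<^sup>2) = 0" using 2 r by (simp add: algebra_simps power2_eq_square)
    moreover have "1 + \<kappa>\<^sup>2 \<noteq> 0" by (metis add_nonneg_eq_0_iff zero_le_one zero_le_power2 zero_neq_one)
    ultimately have "t = 0" by simp
    then show ?thesis using y(1) z1 z2 r u by auto
  qed
  ultimately show ?thesis using that[of "interior (H ` T)"] by blast
qed

end

end

section \<open>Self-adjoint endomorphisms\<close>

text \<open>\<open>e\<close> maximizes the quadratic form of \<open>S\<close> on the unit sphere of
  \<open>T\<close>. Moving from \<open>e\<close> in the direction of the defect u = S e - k e
  increases the form at first order by 2 r |u|^2, so maximality forces u = 0.\<close>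

lemma selfadjoint_eigenvector:
  fixes S :: "'a::euclidean_space \<Rightarrow> 'a"
  assumes S: "linear S" and T: "subspace T" "T \<noteq> {0}" "S ` T \<subseteq> T"
    and sym: "\<And>s t. s \<in> T \<Longrightarrow> t \<in> T \<Longrightarrow> S s \<bullet> t = s \<bullet> S t"
  obtains e k where "e \<in> T" "norm e = 1" "S e = k *\<^sub>R e"
proof -
  let ?K = "T \<inter> sphere 0 1"
  obtain t where t: "t \<in> T" "t \<noteq> 0"
    using T subspace_0 by blast
  then have "t /\<^sub>R norm t \<in> ?K"
    using T(1) by (simp add: subspace_scale)
  then have ne: "?K \<noteq> {}" by blast
  have "compact ?K"
    using closed_subspace[OF T(1)] by (simp add: closed_Int_compact)
  moreover have "continuous_on ?K (\<lambda>t. S t \<bullet> t)"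
    using S by (intro continuous_intros linear_continuous_on) (simp add: linear_conv_bounded_linear)
  ultimately obtain e where e: "e \<in> ?K" and max: "\<And>t. t \<in> ?K \<Longrightarrow> S t \<bullet> t \<le> S e \<bullet> e"
    using continuous_attains_sup[OF _ ne] by blast
  define k where "k = S e \<bullet> e"
  have ee: "e \<bullet> e = 1" "e \<in> T" using e by (simp_all add: norm_eq_1)
  have le: "S t \<bullet> t \<le> k * (t \<bullet> t)" if "t \<in> T" for t
  proof (cases "t = 0")
    case False
    then have "t /\<^sub>R norm t \<in> ?K"
      using T(1) that by (simp add: subspace_scale)
    from max[OF this] have "(S t \<bullet> t) / (norm t * norm t) \<le> k"
      using S by (simp add: k_def linear_cmul divide_inverse mult_ac)
    then show ?thesis
      using False by (simp add: field_simps dot_square_norm power2_eq_square)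
  qed (use S in \<open>simp add: linear_0\<close>)
  define u where "u = S e - k *\<^sub>R e"
  have u: "u \<in> T" unfolding u_def
    using T ee(2) by (intro subspace_diff subspace_scale) auto
  have eu: "e \<bullet> u = 0"
    by (simp add: u_def inner_diff_right k_def ee inner_commute)
  have Seu: "S e \<bullet> u = u \<bullet> u"
    using eu by (simp add: u_def inner_diff_left inner_diff_right inner_commute)
  have "2 * (u \<bullet> u) * r \<le> (k * (u \<bullet> u) - S u \<bullet> u) * r\<^sup>2" for r
  proof -
    have "e + r *\<^sub>R u \<in> T"
      using T(1) ee u by (intro subspace_add subspace_scale)
    from le[OF this] have "S e \<bullet> e + 2 * r * (S e \<bullet> u) + r * r * (S u \<bullet> u) \<le> k * (1 + r * r * (u \<bullet> u))"
      using S sym[OF ee(2) u] eu ee(1)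
      by (simp add: linear_add linear_cmul inner_add_left inner_add_right inner_commute algebra_simps)
    then show ?thesis
      by (simp add: k_def Seu algebra_simps power2_eq_square)
  qed
  then have *: "2 * (u \<bullet> u) * r \<le> b * r\<^sup>2" if "b = k * (u \<bullet> u) - S u \<bullet> u" for r b
    using that by blast
  have "u \<bullet> u \<le> 0"
  proof (rule ccontr)
    assume "\<not> u \<bullet> u \<le> 0"
    then have uu: "0 < u \<bullet> u" by (simp only: not_le)
    \<comment> \<open>A positive bound for the quadratic coefficient; the step \<open>r\<close> is
      chosen so that the quadratic term is only half of the linear one.\<close>
    define b where "b = \<bar>k * (u \<bullet> u) - S u \<bullet> u\<bar> + 1"
    define r where "r = (u \<bullet> u) / b"
    have b: "0 < b" by (simp add: b_def)
    have r: "0 < r" using uu b by (simp add: r_def)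
    have "2 * (u \<bullet> u) * r \<le> b * r\<^sup>2"
      using *[OF refl, of r] by (rule order_trans) (auto simp: b_def intro!: mult_right_mono)
    also have "b * r\<^sup>2 = (u \<bullet> u) * r"
      using b by (simp add: r_def power2_eq_square)
    finally have "2 * (u \<bullet> u) * r \<le> (u \<bullet> u) * r" .
    moreover have "0 < (u \<bullet> u) * r" using uu r by (rule mult_pos_pos)
    ultimately show False by linarith
  qed
  then have "u = 0" by (metis inner_eq_zero_iff inner_ge_zero order_antisym)
  then show ?thesis
    using that[of e k] e by (simp add: u_def)
qed

text \<open>Split off one eigenvector: self-adjointness makes its orthogonal complement in
  \<open>T\<close> invariant, and the dimension drops.\<close>

lemma selfadjoint_eigenbasis:
  fixes S :: "'a::euclidean_space \<Rightarrow> 'a"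
  assumes S: "linear S" and "subspace T" "S ` T \<subseteq> T"
    and "\<And>s t. s \<in> T \<Longrightarrow> t \<in> T \<Longrightarrow> S s \<bullet> t = s \<bullet> S t"
  shows "\<exists>B. B \<subseteq> T \<and> pairwise orthogonal B \<and> (\<forall>b\<in>B. norm b = 1 \<and> (\<exists>k. S b = k *\<^sub>R b)) \<and> span B = T"
  using assms(2-)
proof (induction "dim T" arbitrary: T rule: less_induct)
  case less
  show ?case
  proof (cases "T = {0}")
    case True
    then show ?thesis by (intro exI[of _ "{}"]) auto
  next
    case False
    obtain e k where e: "e \<in> T" "norm e = 1" "S e = k *\<^sub>R e"
      using selfadjoint_eigenvector[OF S less.prems(1) False less.prems(2,3)] by blast
    have ee: "e \<bullet> e = 1" using e by (simp add: norm_eq_1)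
    let ?T = "{t \<in> T. e \<bullet> t = 0}"
    have sub: "subspace ?T"
      using less.prems(1) by (auto simp: subspace_def inner_add_right)
    have "e \<notin> ?T" using ee by simp
    then have "?T \<subset> T" using e by blast
    then have "dim ?T < dim T"
      using sub less.prems(1) by (metis dim_psubset span_eq_iff)
    moreover have "S ` ?T \<subseteq> ?T"
    proof (rule image_subsetI)
      fix t assume t: "t \<in> ?T"
      then have "e \<bullet> S t = S e \<bullet> t" using less.prems(3) e(1) by simp
      then show "S t \<in> ?T" using t e less.prems(2) by auto
    qed
    ultimately obtain B where B: "B \<subseteq> ?T" "pairwise orthogonal B"
      "\<forall>b\<in>B. norm b = 1 \<and> (\<exists>k. S b = k *\<^sub>R b)" "span B = ?T"
      using less.hyps[OF _ sub] less.prems(3) by blast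
    have "t \<in> span (insert e B)" if "t \<in> T" for t
    proof -
      have "t - (e \<bullet> t) *\<^sub>R e \<in> ?T"
        using that e(1) ee less.prems(1) by (simp add: subspace_diff subspace_scale inner_diff_right)
      then have "t - (e \<bullet> t) *\<^sub>R e \<in> span B" using B(4) by simp
      then show ?thesis by (auto simp: span_insert)
    qed
    moreover have "span (insert e B) \<subseteq> T"
      using B(1) e(1) less.prems(1) by (intro span_minimal) auto
    ultimately have "span (insert e B) = T" by blast
    then show ?thesis
      using B e by (intro exI[of _ "insert e B"])
        (auto simp: pairwise_insert orthogonal_def inner_commute)
  qed
qed

lemma eigenspace_subspace:
  assumes "linear S" "subspace T"
  shows "subspace {t \<in> T. S t = k *\<^sub>R t}"
  using assms by (auto simp: subspace_def linear_0 linear_add linear_cmul scaleR_add_right)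

text \<open>Of the three vectors of an orthonormal eigenbasis, two share an eigenvalue \<mu>; the
  third has eigenvalue \<nu>. The conclusion speaks of dimensions because these are what
  \<open>constant_principal_curvatures\<close> carries from point to point.\<close>

lemma two_eigenvalues:
  fixes S :: "'a::euclidean_space \<Rightarrow> 'a"
  assumes S: "linear S" and T: "subspace T" "dim T = 3" "S ` T \<subseteq> T"
    and sym: "\<And>s t. s \<in> T \<Longrightarrow> t \<in> T \<Longrightarrow> S s \<bullet> t = s \<bullet> S t"
    and two: "card {k. \<exists>t\<in>T. t \<noteq> 0 \<and> S t = k *\<^sub>R t} \<le> 2"
  obtains \<nu> \<mu> where "1 \<le> dim {t \<in> T. S t = \<nu> *\<^sub>R t}" "2 \<le> dim {t \<in> T. S t = \<mu> *\<^sub>R t}"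
    "\<nu> = \<mu> \<Longrightarrow> dim {t \<in> T. S t = \<mu> *\<^sub>R t} = 3"
proof -
  let ?E = "\<lambda>k. {t \<in> T. S t = k *\<^sub>R t}"
  obtain B where B: "B \<subseteq> T" "pairwise orthogonal B" "span B = T"
    and eig: "\<And>b. b \<in> B \<Longrightarrow> norm b = 1 \<and> (\<exists>k. S b = k *\<^sub>R b)"
    using selfadjoint_eigenbasis[OF S T(1,3) sym] by blast
  have "0 \<notin> B" using eig by force
  then have ind: "independent B" using B(2) by (rule pairwise_orthogonal_independent[rotated])
  then have "card B = 3" using T(2) B(3) by (metis dim_eq_card_independent dim_span)
  then obtain b1 b2 b3 where b: "B = {b1, b2, b3}" "b1 \<noteq> b2" "b1 \<noteq> b3" "b2 \<noteq> b3"
    by (auto simp: card_3_iff)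
  have "\<exists>k. \<forall>b\<in>B. S b = k b *\<^sub>R b" using eig by metis
  then obtain k where k: "\<And>b. b \<in> B \<Longrightarrow> S b = k b *\<^sub>R b" by blast
  have orth: "c \<bullet> d = (if c = d then 1 else 0)" if "c \<in> B" "d \<in> B" for c d
    using that B(2) eig by (auto simp: pairwise_def orthogonal_def norm_eq_1)
  have "{k. \<exists>t\<in>T. t \<noteq> 0 \<and> S t = k *\<^sub>R t} \<subseteq> k ` B"
  proof clarify
    fix l t assume t: "t \<in> T" "t \<noteq> 0" "S t = l *\<^sub>R t"
    have "\<exists>c\<in>B. c \<bullet> t \<noteq> 0"
    proof (rule ccontr)
      assume "\<not> ?thesis"
      then have "orthogonal t t"
        using t(1) B(3) by (intro orthogonal_to_span[of t B]) (auto simp: orthogonal_def inner_commute)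
      then show False using t(2) by (simp add: orthogonal_def)
    qed
    then obtain c where c: "c \<in> B" "c \<bullet> t \<noteq> 0" by blast
    then have "S c \<bullet> t = c \<bullet> S t" using sym t(1) B(1) by blast
    then have "l = k c" using c t(3) k by simp
    then show "l \<in> k ` B" using c(1) by blast
  qed
  moreover have "k c \<in> {k. \<exists>t\<in>T. t \<noteq> 0 \<and> S t = k *\<^sub>R t}" if "c \<in> B" for c
    using that k B(1) \<open>0 \<notin> B\<close> by (intro CollectI bexI[of _ c]) auto
  \<comment> \<open>The set is finite, so the bound on \<open>card\<close> is a genuine one and not
    the default value 0 for infinite sets.\<close>
  ultimately have "{k. \<exists>t\<in>T. t \<noteq> 0 \<and> S t = k *\<^sub>R t} = {k b1, k b2, k b3}"
    using b(1) by auto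
  then have "card {k b1, k b2, k b3} \<le> 2" using two by simp
  then have "k b1 = k b2 \<or> k b1 = k b3 \<or> k b2 = k b3"
    by (auto simp: card_insert_if split: if_splits)
  then obtain c1 c2 c3 where c: "B = {c1, c2, c3}" "c2 \<noteq> c3" "k c2 = k c3"
    using b by (metis insert_commute)
  have dim_ge: "card C \<le> dim (?E l)" if "C \<subseteq> B" "\<And>c. c \<in> C \<Longrightarrow> k c = l" for C l
  proof (rule independent_card_le_dim)
    show "independent C" using ind that(1) by (rule independent_mono)
    show "C \<subseteq> ?E l" using that k B(1) by auto
  qed
  show ?thesis
  proof (rule that[of "k c1" "k c2"])
    have "card {c1} \<le> dim (?E (k c1))"
      by (rule dim_ge) (use c(1) in auto)
    moreover have "card {c2, c3} \<le> dim (?E (k c2))"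
      by (rule dim_ge) (use c(1,3) in auto)
    ultimately show "1 \<le> dim (?E (k c1))" "2 \<le> dim (?E (k c2))"
      using c(2) by simp_all
    assume "k c1 = k c2"
    then have "card B \<le> dim (?E (k c2))"
      by (intro dim_ge subset_refl) (use c(3) in \<open>unfold c(1), auto\<close>)
    then have "3 \<le> dim (?E (k c2))" by (simp only: \<open>card B = 3\<close>)
    moreover have "dim (?E (k c2)) \<le> 3" using dim_subset[of "?E (k c2)" T] T(2) by auto
    ultimately show "dim (?E (k c2)) = 3" by simp
  qed
qed

text \<open>For \<nu> different from \<mu>, the eigenspace of \<mu> is orthogonal to
  \<open>e\<close> and has dimension at least 2, so it is the whole complement of \<open>e\<close>
  in \<open>T\<close>. For \<nu> = \<mu> it is \<open>T\<close>, and any unit vector serves as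
  \<open>e\<close>.\<close>

lemma selfadjoint_rank_one:
  fixes S :: "'a::euclidean_space \<Rightarrow> 'a"
  assumes S: "linear S" and T: "subspace T" "dim T = 3"
    and sym: "\<And>s t. s \<in> T \<Longrightarrow> t \<in> T \<Longrightarrow> S s \<bullet> t = s \<bullet> S t"
    and dims: "1 \<le> dim {t \<in> T. S t = \<nu> *\<^sub>R t}" "2 \<le> dim {t \<in> T. S t = \<mu> *\<^sub>R t}"
    "\<nu> = \<mu> \<Longrightarrow> dim {t \<in> T. S t = \<mu> *\<^sub>R t} = 3"
  obtains e where "e \<in> T" "e \<bullet> e = 1" "\<And>t. t \<in> T \<Longrightarrow> S t = \<mu> *\<^sub>R t + ((\<nu> - \<mu>) * (e \<bullet> t)) *\<^sub>R e"
proof -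
  let ?E = "\<lambda>k. {t \<in> T. S t = k *\<^sub>R t}"
  have "\<not> ?E \<nu> \<subseteq> {0}" using dims(1) by (metis dim_eq_0 not_one_le_zero)
  then obtain t where t: "t \<in> T" "S t = \<nu> *\<^sub>R t" "t \<noteq> 0" by blast
  define e where "e = t /\<^sub>R norm t"
  have e: "e \<in> T" "S e = \<nu> *\<^sub>R e" "e \<bullet> e = 1"
    using t T(1) S by (auto simp: e_def subspace_scale linear_cmul dot_square_norm power2_eq_square)
  show ?thesis
  proof (cases "\<nu> = \<mu>")
    case True
    then have "?E \<mu> = T"
      using dims(3) T by (intro subspace_dim_equal eigenspace_subspace S) auto
    then show ?thesis using that[OF e(1,3)] True by auto
  next
    case False
    let ?F = "{t \<in> T. e \<bullet> t = 0}"
    have F: "subspace ?F"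
      using T(1) by (auto simp: subspace_def inner_add_right)
    have "e \<notin> ?F" using e by simp
    then have "?F \<subset> T" using e by blast
    then have "dim ?F < 3"
      using F T by (metis dim_psubset span_eq_iff)
    moreover have sub: "?E \<mu> \<subseteq> ?F"
    proof clarify
      fix t assume "t \<in> T" "S t = \<mu> *\<^sub>R t"
      with sym[OF e(1), of t] e(2) False show "e \<bullet> t = 0" by auto
    qed
    ultimately have eq: "?E \<mu> = ?F"
      using dims(2) F by (intro subspace_dim_equal eigenspace_subspace S T) auto
    have "S t = \<mu> *\<^sub>R t + ((\<nu> - \<mu>) * (e \<bullet> t)) *\<^sub>R e" if "t \<in> T" for t
    proof -
      have "t - (e \<bullet> t) *\<^sub>R e \<in> ?F"
        using that e T(1) by (simp add: subspace_diff subspace_scale inner_diff_right)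
      then have "S (t - (e \<bullet> t) *\<^sub>R e) = \<mu> *\<^sub>R (t - (e \<bullet> t) *\<^sub>R e)" using eq by blast
      then show ?thesis using S e(2) by (simp add: linear_diff linear_cmul algebra_simps)
    qed
    then show ?thesis using that[OF e(1,3)] by blast
  qed
qed

section \<open>From eigenvalues to the rank-one form of the shape operator\<close>

context patch
begin

definition curvature_space :: "real^3 \<Rightarrow> real \<Rightarrow> R33 set" where
  "curvature_space x k = {DF x v |v. - DN x v = k *\<^sub>R DF x v}"

definition curvatures :: "real^3 \<Rightarrow> real set" where
  "curvatures x = {k. \<exists>v. v \<noteq> 0 \<and> - DN x v = k *\<^sub>R DF x v}"

lemma curvature_dimensions:
  assumes x: "x \<in> U" and two: "card (curvatures x) \<le> 2"
  obtains \<nu> \<mu> where "1 \<le> dim (curvature_space x \<nu>)" "2 \<le> dim (curvature_space x \<mu>)"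
    "\<nu> = \<mu> \<Longrightarrow> dim (curvature_space x \<mu>) = 3"
proof -
  obtain S where S: "linear S" "\<And>v. S (DF x v) = - DN x v" "S ` range (DF x) \<subseteq> range (DF x)"
    "\<And>s t. s \<in> range (DF x) \<Longrightarrow> t \<in> range (DF x) \<Longrightarrow> S s \<bullet> t = s \<bullet> S t"
    by (rule shape_endomorphism[OF x]) blast
  have space: "curvature_space x k = {t \<in> range (DF x). S t = k *\<^sub>R t}" for k
    by (auto simp: curvature_space_def S(2))
  have "DF x v = 0 \<longleftrightarrow> v = 0" for v
    using inj_DF[OF x] linear_DF[OF x] by (metis injD linear_0)
  then have "curvatures x = {k. \<exists>t\<in>range (DF x). t \<noteq> 0 \<and> S t = k *\<^sub>R t}"
    by (auto simp: curvatures_def S(2))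
  then have "card {k. \<exists>t\<in>range (DF x). t \<noteq> 0 \<and> S t = k *\<^sub>R t} \<le> 2"
    using two by simp
  from two_eigenvalues[OF S(1) subspace_DF[OF x] dim_DF[OF x] S(3,4) this] obtain \<nu> \<mu>
    where "1 \<le> dim {t \<in> range (DF x). S t = \<nu> *\<^sub>R t}" "2 \<le> dim {t \<in> range (DF x). S t = \<mu> *\<^sub>R t}"
      "\<nu> = \<mu> \<Longrightarrow> dim {t \<in> range (DF x). S t = \<mu> *\<^sub>R t} = 3"
    by blast
  then show ?thesis
    unfolding space[symmetric] by (rule that)
qed

lemma principal_direction:
  assumes x: "x \<in> U" and dims: "1 \<le> dim (curvature_space x \<nu>)" "2 \<le> dim (curvature_space x \<mu>)"
    "\<nu> = \<mu> \<Longrightarrow> dim (curvature_space x \<mu>) = 3"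
  obtains e where "DF x e \<bullet> DF x e = 1"
    "\<And>v. DN x v = - (\<mu> *\<^sub>R DF x v) - ((\<nu> - \<mu>) * (DF x e \<bullet> DF x v)) *\<^sub>R DF x e"
proof -
  obtain S where S: "linear S" "\<And>v. S (DF x v) = - DN x v" "S ` range (DF x) \<subseteq> range (DF x)"
    "\<And>s t. s \<in> range (DF x) \<Longrightarrow> t \<in> range (DF x) \<Longrightarrow> S s \<bullet> t = s \<bullet> S t"
    by (rule shape_endomorphism[OF x]) blast
  have space: "curvature_space x k = {t \<in> range (DF x). S t = k *\<^sub>R t}" for k
    by (auto simp: curvature_space_def S(2))
  obtain t where t: "t \<in> range (DF x)" "t \<bullet> t = 1"
    "\<And>s. s \<in> range (DF x) \<Longrightarrow> S s = \<mu> *\<^sub>R s + ((\<nu> - \<mu>) * (t \<bullet> s)) *\<^sub>R t"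
    using selfadjoint_rank_one[OF S(1) subspace_DF[OF x] dim_DF[OF x] S(4) dims[unfolded space]] by metis
  then obtain e where e: "t = DF x e" by blast
  have "DN x v = - (\<mu> *\<^sub>R DF x v) - ((\<nu> - \<mu>) * (DF x e \<bullet> DF x v)) *\<^sub>R DF x e" for v
    using t(3)[of "DF x v"] S(2)[of v] e by (simp add: minus_equation_iff[of "DN x v"] algebra_simps)
  then show ?thesis using that t(2) e by blast
qed

lemma hypersurface_patchI:
  assumes "\<And>x. x \<in> U \<Longrightarrow> 1 \<le> dim (curvature_space x \<nu>)" "\<And>x. x \<in> U \<Longrightarrow> 2 \<le> dim (curvature_space x \<mu>)"
    "\<And>x. x \<in> U \<Longrightarrow> \<nu> = \<mu> \<Longrightarrow> dim (curvature_space x \<mu>) = 3"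
  shows "hypersurface_patch U f1 n1 f2 n2 \<mu> (\<nu> - \<mu>)"
proof unfold_locales
  fix x assume x: "x \<in> U"
  obtain e where "DF x e \<bullet> DF x e = 1"
    "\<And>v. DN x v = - (\<mu> *\<^sub>R DF x v) - ((\<nu> - \<mu>) * (DF x e \<bullet> DF x v)) *\<^sub>R DF x e"
    using principal_direction[OF x assms(1-3)[OF x]] by metis
  then show "\<exists>e. D f1 x e \<bullet> D f1 x e + D f2 x e \<bullet> D f2 x e = 1 \<and>
      (\<forall>v. D n1 x v - (D n1 x v \<bullet> f1 x) *\<^sub>R f1 x =
             - (\<mu> *\<^sub>R D f1 x v) - ((\<nu> - \<mu>) * (D f1 x e \<bullet> D f1 x v + D f2 x e \<bullet> D f2 x v)) *\<^sub>R D f1 x e \<and>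
           D n2 x v - (D n2 x v \<bullet> f2 x) *\<^sub>R f2 x =
             - (\<mu> *\<^sub>R D f2 x v) - ((\<nu> - \<mu>) * (D f1 x e \<bullet> D f1 x v + D f2 x e \<bullet> D f2 x v)) *\<^sub>R D f2 x e)"
    by (intro exI[of _ e]) (simp add: DF_def DN_def)
qed

end

context hypersurface_patch
begin

lemma DN_principal:
  assumes x: "x \<in> U"
  obtains e where "DF x e \<bullet> DF x e = 1"
    "\<And>v. DN x v = - (\<mu> *\<^sub>R DF x v) - (\<kappa> * (DF x e \<bullet> DF x v)) *\<^sub>R DF x e"
proof -
  from principal[OF x] show ?thesis
    using that by (auto simp: DF_def DN_def)
qed

lemma curvatures_distinct:
  assumes x: "x \<in> U" and \<kappa>: "\<kappa> \<noteq> 0"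
  shows "curvatures x = {\<mu>, \<mu> + \<kappa>}"
proof -
  obtain e where e: "DF x e \<bullet> DF x e = 1"
    and N: "\<And>v. DN x v = - (\<mu> *\<^sub>R DF x v) - (\<kappa> * (DF x e \<bullet> DF x v)) *\<^sub>R DF x e"
    by (rule DN_principal[OF x]) blast
  have N': "- DN x v = \<mu> *\<^sub>R DF x v + (\<kappa> * (DF x e \<bullet> DF x v)) *\<^sub>R DF x e" for v
    by (simp add: N)
  have zero: "DF x v = 0 \<longleftrightarrow> v = 0" for v
    using inj_DF[OF x] linear_DF[OF x] by (metis injD linear_0)
  have "k = \<mu> \<or> k = \<mu> + \<kappa>" if "v \<noteq> 0" "- DN x v = k *\<^sub>R DF x v" for k v
  proof (cases "DF x e \<bullet> DF x v = 0")
    case True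
    then have "k *\<^sub>R DF x v = \<mu> *\<^sub>R DF x v"
      using that(2) N'[of v] by (metis add_0_right mult_zero_right scaleR_zero_left)
    moreover have "DF x v \<noteq> 0" using that(1) zero by blast
    ultimately show ?thesis by simp
  next
    case False
    have "k *\<^sub>R DF x v = \<mu> *\<^sub>R DF x v + (\<kappa> * (DF x e \<bullet> DF x v)) *\<^sub>R DF x e"
      using that N'[of v] by simp
    from arg_cong[OF this, of "\<lambda>t. DF x e \<bullet> t"]
    have "k * (DF x e \<bullet> DF x v) = (\<mu> + \<kappa>) * (DF x e \<bullet> DF x v)"
      by (simp add: e inner_add_right algebra_simps)
    then show ?thesis using False by simp
  qed
  moreover have "\<mu> + \<kappa> \<in> curvatures x"
  proof -
    have "e \<noteq> 0"
    proof
      assume "e = 0"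
      then have "DF x e = 0" using zero[of e] by blast
      then show False using e by simp
    qed
    moreover have "- DN x e = (\<mu> + \<kappa>) *\<^sub>R DF x e"
      by (simp add: N' e scaleR_add_left)
    ultimately show ?thesis unfolding curvatures_def by blast
  qed
  \<comment> \<open>The tangent space has dimension 3, so it contains a nonzero vector orthogonal to
    DF x e.\<close>
  moreover have "\<mu> \<in> curvatures x"
  proof -
    have "dim (span {DF x e}) < dim (range (DF x))"
      using dim_DF[OF x] dim_le_card'[of "{DF x e}"] by simp
    moreover have "span {DF x e} \<subseteq> span (range (DF x))"
      by (rule span_mono) simp
    ultimately have "span {DF x e} \<subset> span (range (DF x))"
      by (metis dim_span less_irrefl psubsetI)
    then obtain t where t: "t \<noteq> 0" "t \<in> span (range (DF x))" "\<And>y. y \<in> span {DF x e} \<Longrightarrow> orthogonal t y"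
      by (rule orthogonal_to_subspace_exists_gen) blast
    moreover have "span (range (DF x)) = range (DF x)"
      using subspace_DF[OF x] by (simp add: span_eq_iff)
    ultimately obtain v where v: "t = DF x v" by auto
    have "DF x e \<bullet> DF x v = 0"
      using t(3)[of "DF x e"] v by (simp add: span_base orthogonal_def inner_commute)
    then have "v \<noteq> 0" "- DN x v = \<mu> *\<^sub>R DF x v"
      using t(1) v zero by (auto simp: N')
    then show ?thesis unfolding curvatures_def by blast
  qed
  ultimately show ?thesis by (auto simp: curvatures_def)
qed

end

section \<open>Charts\<close>

lemma chart_inv_right:
  assumes "y \<in> snd c ` fst c"
  shows "chart_inv c y \<in> fst c" "snd c (chart_inv c y) = y"
  using assms by (simp_all add: chart_inv_def inv_into_into f_inv_into_f)

lemma chart_topspace: "is_chart M c \<Longrightarrow> fst c \<subseteq> topspace M"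
  by (simp add: is_chart_def openin_subset)

lemma chart_inv_left:
  assumes "is_chart M c" "p \<in> fst c"
  shows "chart_inv c (snd c p) = p"
proof -
  have "inj_on (snd c) (topspace (subtopology M (fst c)))"
    using assms(1) unfolding is_chart_def by (blast dest: homeomorphic_imp_injective_map)
  moreover have "topspace (subtopology M (fst c)) = fst c"
    using chart_topspace[OF assms(1)] by (simp add: Int_absorb1)
  ultimately show ?thesis
    using assms(2) by (simp add: chart_inv_def)
qed

lemma chart_open_image:
  assumes "is_chart M c" "openin M V"
  shows "open (snd c ` (fst c \<inter> V))"
proof -
  have "openin (subtopology M (fst c)) (fst c \<inter> V)"
    using assms(2) by (metis Int_commute openin_subtopology)
  then have "openin (top_of_set (snd c ` fst c)) (snd c ` (fst c \<inter> V))"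
    using assms(1) homeomorphic_imp_open_map unfolding is_chart_def open_map_def by blast
  then show ?thesis
    using assms(1) unfolding is_chart_def by (metis openin_open_eq)
qed

lemma chart_open_preimage:
  assumes "is_chart M c" "open W"
  shows "openin M {p \<in> fst c. snd c p \<in> W}"
proof -
  have "openin (top_of_set (snd c ` fst c)) (W \<inter> snd c ` fst c)"
    using assms(2) by (metis Int_commute openin_open_Int)
  moreover have "continuous_map (subtopology M (fst c)) (top_of_set (snd c ` fst c)) (snd c)"
    using assms(1) unfolding is_chart_def by (blast dest: homeomorphic_imp_continuous_map)
  ultimately have "openin (subtopology M (fst c)) {p \<in> topspace (subtopology M (fst c)). snd c p \<in> W \<inter> snd c ` fst c}"
    by (rule openin_continuous_map_preimage[rotated])
  moreover have "{p \<in> topspace (subtopology M (fst c)). snd c p \<in> W \<inter> snd c ` fst c} = {p \<in> fst c. snd c p \<in> W}"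
    using chart_topspace[OF assms(1)] by auto
  ultimately show ?thesis
    using assms(1) unfolding is_chart_def by (metis openin_trans_full)
qed

text \<open>The points where \<open>h\<close> has the value \<open>h p\<close> and those where it
  has another value form two disjoint open sets covering \<open>M\<close>.\<close>

lemma locally_constant_on_charts:
  assumes conn: "connected_space M" and atlas: "smooth_atlas M A"
    and loc: "\<And>c x. c \<in> A \<Longrightarrow> x \<in> snd c ` fst c \<Longrightarrow>
      \<exists>e>0. \<forall>y\<in>ball x e \<inter> snd c ` fst c. h (chart_inv c y) = h (chart_inv c x)"
    and p: "p \<in> topspace M" and q: "q \<in> topspace M"
  shows "h p = h q"
proof (rule ccontr)
  assume ne: "h p \<noteq> h q"
  have nbhd: "\<exists>V. openin M V \<and> s \<in> V \<and> (\<forall>t\<in>V. h t = h s)" if s: "s \<in> topspace M" for s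
  proof -
    obtain c where c: "c \<in> A" "s \<in> fst c" "is_chart M c"
      using atlas s unfolding smooth_atlas_def by blast
    obtain e where e: "e > 0" "\<And>y. y \<in> ball (snd c s) e \<inter> snd c ` fst c \<Longrightarrow> h (chart_inv c y) = h (chart_inv c (snd c s))"
      using loc[OF c(1), of "snd c s"] c(2) by blast
    let ?V = "{t \<in> fst c. snd c t \<in> ball (snd c s) e}"
    have "h t = h s" if "t \<in> ?V" for t
      using e(2)[of "snd c t"] that c chart_inv_left[OF c(3)] by auto
    moreover have "openin M ?V" by (rule chart_open_preimage[OF c(3)]) simp
    moreover have "s \<in> ?V" using c e by simp
    ultimately show ?thesis by blast
  qed
  let ?E = "\<lambda>b. {s \<in> topspace M. (h s = h p) = b}"
  have open_E: "openin M (?E b)" for b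
  proof (subst openin_subopen, intro ballI)
    fix s assume s: "s \<in> ?E b"
    then obtain V where V: "openin M V" "s \<in> V" "\<forall>t\<in>V. h t = h s" using nbhd by blast
    have "t \<in> ?E b" if t: "t \<in> V" for t
    proof -
      have "h t = h s" "t \<in> topspace M" using V t openin_subset by blast+
      with s show ?thesis by simp
    qed
    then have "V \<subseteq> ?E b" by blast
    then show "\<exists>V. openin M V \<and> s \<in> V \<and> V \<subseteq> ?E b" using V by blast
  qed
  have "?E True \<inter> ?E False = {}" "topspace M \<subseteq> ?E True \<union> ?E False" by auto
  moreover have "?E True \<noteq> {}" "?E False \<noteq> {}" using p q ne by auto
  ultimately show False
    using conn open_E[of True] open_E[of False] unfolding connected_space_def by blast
qed

text \<open>\<open>J\<close> is the derivative of the transition map and does not depend on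
  \<open>F\<close>. It therefore transforms the differentials of \<Phi> and N simultaneously and
  carries eigenvectors from one chart to the other.\<close>

lemma differential_chart_change:
  assumes atlas: "smooth_atlas M A" and c: "c \<in> A" "p \<in> fst c" and d: "d \<in> A" "p \<in> fst d"
  obtains J where "\<And>(F :: 'm \<Rightarrow> 'b::real_normed_vector) v. smooth_map A F \<Longrightarrow>
    differential d F p v = differential c F p (J v)"
proof -
  let ?V = "snd d ` (fst d \<inter> fst c)"
  let ?T = "snd c \<circ> chart_inv d"
  let ?x = "snd d p"
  have chart: "is_chart M c" "is_chart M d" using atlas c d by (auto simp: smooth_atlas_def)
  then have V: "open ?V"
    by (intro chart_open_image) (auto simp: is_chart_def)
  have x: "?x \<in> ?V" using c d by blast
  have T: "smooth_on ?V ?T" using atlas c d unfolding smooth_atlas_def by blast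
  have inv: "chart_inv d (snd d q) = q" if "q \<in> fst d" for q
    using chart_inv_left[OF chart(2) that] .
  show ?thesis
  proof (rule that[of "D ?T ?x"])
    fix F :: "'m \<Rightarrow> 'b" and v assume F: "smooth_map A F"
    have Tx: "?T ?x = snd c p" using inv d by simp
    have "((F \<circ> chart_inv c) has_derivative D (F \<circ> chart_inv c) (?T ?x)) (at (?T ?x))"
      using F c Tx unfolding smooth_map_def by (intro smooth_on_has_derivative) auto
    then have "((F \<circ> chart_inv c) \<circ> ?T has_derivative D (F \<circ> chart_inv c) (?T ?x) \<circ> D ?T ?x) (at ?x)"
      by (intro diff_chain_at smooth_on_has_derivative[OF T x])
    then have "(F \<circ> chart_inv d has_derivative D (F \<circ> chart_inv c) (?T ?x) \<circ> D ?T ?x) (at ?x)"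
      by (rule has_derivative_transform_within_open[OF _ V x])
        (auto simp: inv chart_inv_left[OF chart(1)])
    from frechet_derivative_at[OF this] show "differential d F p v = differential c F p (D ?T ?x v)"
      unfolding differential_def Tx by (metis comp_apply)
  qed
qed

section \<open>Principal curvatures in charts\<close>

locale oriented_hypersurface =
  fixes M :: "'m topology" and A :: "'m chart set" and \<Phi> N :: "'m \<Rightarrow> R33"
  assumes hyp: "hypersurface M A \<Phi>" and normal: "unit_normal_field A \<Phi> N"
begin

lemma atlas: "smooth_atlas M A" and \<Phi>_smooth: "smooth_map A \<Phi>" and N_smooth: "smooth_map A N"
  using hyp normal by (simp_all add: hypersurface_def smooth_3_manifold_def unit_normal_field_def)

lemma chart: "c \<in> A \<Longrightarrow> is_chart M c"
  using atlas by (simp add: smooth_atlas_def)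

abbreviation "U c \<equiv> snd c ` fst c"
abbreviation "f1 c \<equiv> \<lambda>x. fst (\<Phi> (chart_inv c x))"
abbreviation "f2 c \<equiv> \<lambda>x. snd (\<Phi> (chart_inv c x))"
abbreviation "n1 c \<equiv> \<lambda>x. fst (N (chart_inv c x))"
abbreviation "n2 c \<equiv> \<lambda>x. snd (N (chart_inv c x))"

lemma smooth_chart:
  assumes "c \<in> A"
  shows "smooth_on (U c) (\<lambda>x. \<Phi> (chart_inv c x))" "smooth_on (U c) (\<lambda>x. N (chart_inv c x))"
  using \<Phi>_smooth N_smooth assms by (simp_all add: smooth_map_def o_def)

lemma derivative_components:
  assumes "c \<in> A" "x \<in> U c"
  shows "D (\<lambda>x. \<Phi> (chart_inv c x)) x v = (D (f1 c) x v, D (f2 c) x v)"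
    "D (\<lambda>x. N (chart_inv c x)) x v = (D (n1 c) x v, D (n2 c) x v)"
proof -
  note d = smooth_on_differentiable[OF smooth_chart(1)[OF assms(1)] assms(2)]
    smooth_on_differentiable[OF smooth_chart(2)[OF assms(1)] assms(2)]
  note fst = frechet_derivative_bounded_linear[OF bounded_linear_fst]
  note snd = frechet_derivative_bounded_linear[OF bounded_linear_snd]
  show "D (\<lambda>x. \<Phi> (chart_inv c x)) x v = (D (f1 c) x v, D (f2 c) x v)"
    "D (\<lambda>x. N (chart_inv c x)) x v = (D (n1 c) x v, D (n2 c) x v)"
    unfolding fst[OF d(1)] snd[OF d(1)] fst[OF d(2)] snd[OF d(2)] by simp_all
qed

lemma patch:
  assumes c: "c \<in> A"
  shows "patch (U c) (f1 c) (n1 c) (f2 c) (n2 c)"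
proof -
  have U: "open (U c)" using chart[OF c] by (simp add: is_chart_def)
  have point: "norm (fst (\<Phi> p)) = 1" "norm (snd (\<Phi> p)) = 1" "fst (N p) \<bullet> fst (\<Phi> p) = 0"
      "snd (N p) \<bullet> snd (\<Phi> p) = 0" "norm (N p) = 1" if "p \<in> fst c" for p
  proof -
    have "\<Phi> p \<in> S2S2"
      using hyp that chart_topspace[OF chart[OF c]] unfolding hypersurface_def by blast
    then show "norm (fst (\<Phi> p)) = 1" "norm (snd (\<Phi> p)) = 1"
      by (auto simp: S2S2_def mem_Times_iff)
    show "fst (N p) \<bullet> fst (\<Phi> p) = 0" "snd (N p) \<bullet> snd (\<Phi> p) = 0" "norm (N p) = 1"
      using normal c that by (auto simp: unit_normal_field_def tangent_S2S2_def)
  qed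
  have diff: "differential c F (chart_inv c x) = D (\<lambda>x. F (chart_inv c x)) x" if "x \<in> U c"
    for F :: "'m \<Rightarrow> R33" and x
    using chart_inv_right[OF that] by (simp add: differential_def o_def)
  show ?thesis
  proof
    show "open (U c)" by (rule U)
    show "smooth_on (U c) (f1 c)" "smooth_on (U c) (f2 c)" "smooth_on (U c) (n1 c)" "smooth_on (U c) (n2 c)"
      by (rule smooth_on_bounded_linear_comp[OF U bounded_linear_fst smooth_chart(1)[OF c]]
          smooth_on_bounded_linear_comp[OF U bounded_linear_snd smooth_chart(1)[OF c]]
          smooth_on_bounded_linear_comp[OF U bounded_linear_fst smooth_chart(2)[OF c]]
          smooth_on_bounded_linear_comp[OF U bounded_linear_snd smooth_chart(2)[OF c]])+
    fix x assume x: "x \<in> U c"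
    note p = point[OF chart_inv_right(1)[OF x]]
    show "f1 c x \<bullet> f1 c x = 1" "f2 c x \<bullet> f2 c x = 1" "f1 c x \<bullet> n1 c x = 0" "f2 c x \<bullet> n2 c x = 0"
      using p by (simp_all add: norm_eq_1 inner_commute)
    show "n1 c x \<bullet> n1 c x + n2 c x \<bullet> n2 c x = 1"
      using p(5) by (simp add: norm_eq_1 inner_prod_def)
    fix v
    show "n1 c x \<bullet> D (f1 c) x v + n2 c x \<bullet> D (f2 c) x v = 0"
    proof -
      have "N (chart_inv c x) \<bullet> differential c \<Phi> (chart_inv c x) v = 0"
        using normal c chart_inv_right(1)[OF x] by (auto simp: unit_normal_field_def)
      then show ?thesis
        by (simp add: diff[OF x] derivative_components[OF c x] inner_prod_def)
    qed
    assume "D (f1 c) x v = 0" "D (f2 c) x v = 0"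
    then have "differential c \<Phi> (chart_inv c x) v = 0"
      by (simp add: diff[OF x] derivative_components[OF c x] zero_prod_def)
    moreover have "inj (differential c \<Phi> (chart_inv c x))"
      using hyp c chart_inv_right(1)[OF x] by (auto simp: hypersurface_def)
    moreover have "linear (differential c \<Phi> (chart_inv c x))"
      unfolding diff[OF x] by (rule has_derivative_linear[OF smooth_on_has_derivative[OF smooth_chart(1)[OF c] x]])
    ultimately show "v = 0" by (simp add: linear_injective_0)
  qed
qed

abbreviation "TF c \<equiv> patch.DF (f1 c) (f2 c)"
abbreviation "TN c \<equiv> patch.DN (f1 c) (n1 c) (f2 c) (n2 c)"

lemma differential_patch:
  assumes c: "c \<in> A" "p \<in> fst c"
  shows "differential c \<Phi> p v = TF c (snd c p) v"
    "proj_S2S2 (\<Phi> p) (differential c N p v) = TN c (snd c p) v"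
proof -
  have x: "snd c p \<in> U c" using c by blast
  have p: "chart_inv c (snd c p) = p" using chart_inv_left[OF chart[OF c(1)] c(2)] .
  show "differential c \<Phi> p v = TF c (snd c p) v"
    by (simp add: differential_def o_def derivative_components[OF c(1) x] patch.DF_def[OF patch[OF c(1)]])
  show "proj_S2S2 (\<Phi> p) (differential c N p v) = TN c (snd c p) v"
    by (simp add: differential_def o_def derivative_components[OF c(1) x] patch.DN_def[OF patch[OF c(1)]]
        proj_S2S2_def p)
qed

text \<open>The definite description is well defined: \<open>DN_in_range\<close> gives existence and
  the injectivity of the differential gives uniqueness.\<close>

lemma shape_operator_eq:
  assumes c: "c \<in> A" "p \<in> fst c"
  shows "shape_operator \<Phi> N c p v = w \<longleftrightarrow> TF c (snd c p) w = - TN c (snd c p) v"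
proof -
  interpret patch "U c" "f1 c" "n1 c" "f2 c" "n2 c" by (rule patch[OF c(1)])
  have x: "snd c p \<in> U c" using c by blast
  have "- DN (snd c p) v \<in> range (DF (snd c p))"
    using DN_in_range[OF x] subspace_DF[OF x] by (intro subspace_neg)
  then obtain u where u: "- DN (snd c p) v = DF (snd c p) u" by (rule rangeE)
  have "DF (snd c p) w = - DN (snd c p) v \<longleftrightarrow> w = u" for w
    unfolding u using inj_DF[OF x] by (simp add: inj_eq)
  then show ?thesis
    by (auto simp: shape_operator_def differential_patch[OF c])
qed

lemma shape_operator_eigen:
  assumes c: "c \<in> A" "p \<in> fst c"
  shows "shape_operator \<Phi> N c p v = k *\<^sub>R v \<longleftrightarrow>
    - proj_S2S2 (\<Phi> p) (differential c N p v) = k *\<^sub>R differential c \<Phi> p v"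
proof -
  have "linear (TF c (snd c p))"
    using c by (intro patch.linear_DF[OF patch]) auto
  then show ?thesis
    unfolding shape_operator_eq[OF c] differential_patch[OF c] by (auto simp: linear_cmul)
qed

text \<open>The definitions range over all charts around \<open>p\<close>. Since the eigenvalue
  equation can be transported between charts, the single chart \<open>c\<close> already yields
  everything.\<close>

lemma principal_in_chart:
  assumes c: "c \<in> A" "p \<in> fst c"
  shows "principal_space A \<Phi> N p k = patch.curvature_space (f1 c) (n1 c) (f2 c) (n2 c) (snd c p) k"
    and "principal_curvatures A \<Phi> N p = patch.curvatures (f1 c) (n1 c) (f2 c) (n2 c) (snd c p)"
proof -
  have change: "\<exists>u. differential c \<Phi> p u = differential d \<Phi> p v \<and> (v \<noteq> 0 \<longrightarrow> u \<noteq> 0) \<and>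
      - proj_S2S2 (\<Phi> p) (differential c N p u) = k *\<^sub>R differential c \<Phi> p u"
    if d: "d \<in> A" "p \<in> fst d" and v: "shape_operator \<Phi> N d p v = k *\<^sub>R v" for d v k
  proof -
    obtain J where J: "\<And>(F :: 'm \<Rightarrow> R33) v. smooth_map A F \<Longrightarrow> differential d F p v = differential c F p (J v)"
      using differential_chart_change[OF atlas c d] by blast
    have lin: "linear (differential e \<Phi> p)" "inj (differential e \<Phi> p)" if e: "e \<in> A" "p \<in> fst e" for e
    proof -
      have "differential e \<Phi> p = TF e (snd e p)"
        using differential_patch(1)[OF e] by blast
      then show "linear (differential e \<Phi> p)" "inj (differential e \<Phi> p)"
        using e patch.linear_DF[OF patch[OF e(1)]] patch.inj_DF[OF patch[OF e(1)]] by auto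
    qed
    have "J v \<noteq> 0" if "v \<noteq> 0"
    proof
      assume "J v = 0"
      then have "differential d \<Phi> p v = 0"
        using J[OF \<Phi>_smooth] lin(1)[OF c] by (simp add: linear_0)
      then show False
        using lin[OF d] that by (simp add: linear_injective_0)
    qed
    then show ?thesis
      using v J[OF \<Phi>_smooth, of v] J[OF N_smooth, of v] unfolding shape_operator_eigen[OF d]
      by (intro exI[of _ "J v"]) auto
  qed
  note chart_forms = differential_patch[OF c]
  show "principal_space A \<Phi> N p k = patch.curvature_space (f1 c) (n1 c) (f2 c) (n2 c) (snd c p) k"
  proof -
    have "principal_space A \<Phi> N p k =
      {differential c \<Phi> p v |v. - proj_S2S2 (\<Phi> p) (differential c N p v) = k *\<^sub>R differential c \<Phi> p v}"
    proof (intro subset_antisym subsetI)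
      fix t assume "t \<in> principal_space A \<Phi> N p k"
      then obtain d v where "d \<in> A" "p \<in> fst d" "shape_operator \<Phi> N d p v = k *\<^sub>R v" "t = differential d \<Phi> p v"
        unfolding principal_space_def by blast
      with change[OF this(1-3)] obtain u where "t = differential c \<Phi> p u"
        "- proj_S2S2 (\<Phi> p) (differential c N p u) = k *\<^sub>R differential c \<Phi> p u"
        by metis
      then show "t \<in> {differential c \<Phi> p v |v.
          - proj_S2S2 (\<Phi> p) (differential c N p v) = k *\<^sub>R differential c \<Phi> p v}"
        by blast
    next
      fix t assume "t \<in> {differential c \<Phi> p v |v.
          - proj_S2S2 (\<Phi> p) (differential c N p v) = k *\<^sub>R differential c \<Phi> p v}"
      then show "t \<in> principal_space A \<Phi> N p k"
        using c shape_operator_eigen[OF c] unfolding principal_space_def by blast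
    qed
    then show ?thesis
      by (simp add: patch.curvature_space_def[OF patch[OF c(1)]] chart_forms)
  qed
  have "principal_curvatures A \<Phi> N p =
    {k. \<exists>v. v \<noteq> 0 \<and> - proj_S2S2 (\<Phi> p) (differential c N p v) = k *\<^sub>R differential c \<Phi> p v}"
  proof (intro subset_antisym subsetI)
    fix k assume "k \<in> principal_curvatures A \<Phi> N p"
    then obtain d v where "d \<in> A" "p \<in> fst d" "v \<noteq> 0" "shape_operator \<Phi> N d p v = k *\<^sub>R v"
      unfolding principal_curvatures_def by blast
    with change[OF this(1,2,4)] show "k \<in> {k. \<exists>v. v \<noteq> 0 \<and>
        - proj_S2S2 (\<Phi> p) (differential c N p v) = k *\<^sub>R differential c \<Phi> p v}"
      by blast
  next
    fix k assume "k \<in> {k. \<exists>v. v \<noteq> 0 \<and>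
        - proj_S2S2 (\<Phi> p) (differential c N p v) = k *\<^sub>R differential c \<Phi> p v}"
    then show "k \<in> principal_curvatures A \<Phi> N p"
      using c shape_operator_eigen[OF c] unfolding principal_curvatures_def by blast
  qed
  then show "principal_curvatures A \<Phi> N p = patch.curvatures (f1 c) (n1 c) (f2 c) (n2 c) (snd c p)"
    by (simp add: patch.curvatures_def[OF patch[OF c(1)]] chart_forms)
qed

text \<open>\<nu> and \<mu> are chosen at one point; the constancy of the dimensions makes the same
  two numbers serve in every chart.\<close>

lemma hypersurface_patches:
  assumes const: "constant_principal_curvatures M A \<Phi> N"
    and two: "\<forall>p\<in>topspace M. card (principal_curvatures A \<Phi> N p) \<le> 2"
    and ne: "topspace M \<noteq> {}"
  obtains \<mu> \<kappa> where "\<And>c. c \<in> A \<Longrightarrow> hypersurface_patch (U c) (f1 c) (n1 c) (f2 c) (n2 c) \<mu> \<kappa>"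
proof -
  obtain p where p: "p \<in> topspace M" using ne by blast
  then obtain c where c: "c \<in> A" "p \<in> fst c" using atlas unfolding smooth_atlas_def by blast
  have "card (patch.curvatures (f1 c) (n1 c) (f2 c) (n2 c) (snd c p)) \<le> 2"
    using two p principal_in_chart(2)[OF c] by auto
  from patch.curvature_dimensions[OF patch[OF c(1)] _ this] c
  obtain \<nu> \<mu> where dims: "1 \<le> dim (principal_space A \<Phi> N p \<nu>)" "2 \<le> dim (principal_space A \<Phi> N p \<mu>)"
    "\<nu> = \<mu> \<Longrightarrow> dim (principal_space A \<Phi> N p \<mu>) = 3"
    unfolding principal_in_chart(1)[OF c] by blast
  show ?thesis
  proof (rule that)
    fix d assume d: "d \<in> A"
    have "dim (patch.curvature_space (f1 d) (n1 d) (f2 d) (n2 d) x k) = dim (principal_space A \<Phi> N p k)"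
      if x: "x \<in> U d" for x k
    proof -
      obtain q where q: "q \<in> fst d" "x = snd d q" using x by blast
      have "q \<in> topspace M" using chart_topspace[OF chart[OF d]] q by blast
      then show ?thesis
        using const p principal_in_chart(1)[OF d q(1), of k] q(2)
        unfolding constant_principal_curvatures_def by metis
    qed
    then show "hypersurface_patch (U d) (f1 d) (n1 d) (f2 d) (n2 d) \<mu> (\<nu> - \<mu>)"
      using dims by (intro patch.hypersurface_patchI[OF patch[OF d]]) auto
  qed
qed

end

section \<open>Isometries and the image\<close>

text \<open>A linear map is its own smooth extension and its own derivative.\<close>

lemma isometry_S2S2_linear:
  assumes g: "linear g" and h: "linear h" and gh: "\<And>z. g (h z) = z" and hg: "\<And>z. h (g z) = z"
    and inner: "\<And>u v. g u \<bullet> g v = u \<bullet> v"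
    and S: "\<And>z. z \<in> S2S2 \<Longrightarrow> g z \<in> S2S2" "\<And>z. z \<in> S2S2 \<Longrightarrow> h z \<in> S2S2"
  shows "isometry_S2S2 g"
proof -
  have bl: "bounded_linear g" "bounded_linear h"
    using g h by (simp_all add: linear_conv_bounded_linear)
  have bij: "bij_betw g S2S2 S2S2"
    by (rule bij_betw_byWitness[where f' = h]) (use S gh hg in auto)
  have "inv_into S2S2 g z = h z" if "z \<in> S2S2" for z
    using bij S(2)[OF that] gh[of z] by (metis bij_betw_inv_into_left)
  then have "smooth_extension (inv_into S2S2 g) h"
    unfolding smooth_extension_def using smooth_on_bounded_linear[OF bl(2)] by (auto intro: exI[of _ UNIV])
  moreover have "smooth_extension g g"
    unfolding smooth_extension_def using smooth_on_bounded_linear[OF bl(1)] by (auto intro: exI[of _ UNIV])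
  moreover have "frechet_derivative g (at q) = g" for q
    by (rule frechet_derivative_at[OF bounded_linear_imp_has_derivative[OF bl(1)], symmetric])
  ultimately show ?thesis
    unfolding isometry_S2S2_def using bij inner by (metis (no_types, lifting))
qed

text \<open>The second map also exchanges the factors; it is the congruence for a normal field
  tangent to the second sphere.\<close>

lemma isometry_S2S2_orthogonal:
  fixes L :: "real^3 \<Rightarrow> real^3"
  assumes L: "orthogonal_transformation L"
  shows "isometry_S2S2 (\<lambda>z. (L (fst z), snd z))" "isometry_S2S2 (\<lambda>z. (L (snd z), fst z))"
proof -
  let ?L = "inv L"
  have L': "orthogonal_transformation ?L" using L by (rule orthogonal_transformation_inv)
  have inv: "L (?L x) = x" "?L (L x) = x" for x
    using orthogonal_transformation_bij[OF L] by (simp_all add: bij_is_inj bij_is_surj surj_f_inv_f)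
  have lin: "linear L" "linear ?L"
    using L L' by (simp_all add: orthogonal_transformation_linear)
  have inner: "L x \<bullet> L y = x \<bullet> y" for x y
    using L by (simp add: orthogonal_transformation_def)
  note nrm = orthogonal_transformation_norm[OF L] orthogonal_transformation_norm[OF L']
  have lin': "linear (\<lambda>z. (L (fst z), snd z))" "linear (\<lambda>z. (?L (fst z), snd z))"
    "linear (\<lambda>z. (L (snd z), fst z))" "linear (\<lambda>z. (snd z, ?L (fst z)))"
    using lin by (simp_all add: linear_iff)
  show "isometry_S2S2 (\<lambda>z. (L (fst z), snd z))"
    by (rule isometry_S2S2_linear[OF lin'(1,2)])
      (auto simp: inv inner inner_prod_def S2S2_def nrm)
  show "isometry_S2S2 (\<lambda>z. (L (snd z), fst z))"
    by (rule isometry_S2S2_linear[OF lin'(3,4)])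
      (auto simp: inv inner inner_prod_def S2S2_def nrm)
qed

text \<open>A continuous function with values 0 and 1 cannot change while it varies by less than
  1.\<close>

lemma normal_locally_constant:
  assumes "hypersurface_patch U f1 n1 f2 n2 \<mu> \<kappa>" "x \<in> U"
  shows "\<exists>e>0. \<forall>y\<in>ball x e \<inter> U. n1 y \<bullet> n1 y = n1 x \<bullet> n1 x"
proof -
  interpret hypersurface_patch U f1 n1 f2 n2 \<mu> \<kappa> by fact
  have "continuous_on U n1" by (rule smooth_on_continuous_on[OF p.n_smooth])
  then have "continuous_on U (\<lambda>y. n1 y \<bullet> n1 y)" by (intro continuous_on_inner)
  then obtain e where e: "e > 0" "\<And>y. y \<in> U \<Longrightarrow> dist y x < e \<Longrightarrow> dist (n1 y \<bullet> n1 y) (n1 x \<bullet> n1 x) < 1"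
    using assms(2) unfolding continuous_on_iff by (metis zero_less_one)
  have "n1 y \<bullet> n1 y = n1 x \<bullet> n1 x" if "y \<in> ball x e \<inter> U" for y
  proof -
    have "dist (n1 y \<bullet> n1 y) (n1 x \<bullet> n1 x) < 1"
      using e(2)[of y] that by (simp add: dist_commute)
    then show ?thesis
      using normal_in_factor[of y] normal_in_factor[OF assms(2)] that
      by (auto simp: p.a_def dist_real_def)
  qed
  with e(1) show ?thesis by blast
qed

lemma axis_locally_constant:
  assumes "hypersurface_patch U f1 n1 f2 n2 \<mu> \<kappa>" "x \<in> U" "\<And>y. y \<in> U \<Longrightarrow> n2 y = 0"
  shows "\<exists>e>0. \<forall>y\<in>ball x e \<inter> U. n1 y + \<kappa> *\<^sub>R f1 y = n1 x + \<kappa> *\<^sub>R f1 x"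
proof -
  interpret hypersurface_patch U f1 n1 f2 n2 \<mu> \<kappa> by fact
  obtain e where e: "e > 0" "ball x e \<subseteq> U"
    using p.U assms(2) open_contains_ball by blast
  have "((\<lambda>y. n1 y + \<kappa> *\<^sub>R f1 y) has_derivative (\<lambda>v. 0)) (at y within ball x e)" if "y \<in> ball x e" for y
  proof -
    have y: "y \<in> U" using e that by blast
    have "((\<lambda>y. n1 y + \<kappa> *\<^sub>R f1 y) has_derivative (\<lambda>v. D n1 y v + \<kappa> *\<^sub>R D f1 y v)) (at y)"
      by (intro derivative_intros p.dh[OF y] p.dn[OF y])
    then show ?thesis
      using factor_equations(2)[OF assms(3) y] by (simp add: has_derivative_at_withinI)
  qed
  then have "\<exists>k. \<forall>y\<in>ball x e. n1 y + \<kappa> *\<^sub>R f1 y = k"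
    by (rule has_derivative_zero_constant[OF convex_ball])
  then obtain k where "\<forall>y\<in>ball x e. n1 y + \<kappa> *\<^sub>R f1 y = k" ..
  then have "n1 y + \<kappa> *\<^sub>R f1 y = n1 x + \<kappa> *\<^sub>R f1 x" if "y \<in> ball x e" for y
    using e(1) that by simp
  with e(1) show ?thesis by blast
qed

text \<open>Stated for abstract components, so that it applies to both orders of the factors.
  \<open>n0\<close> is the axis of the circle: it has length \<rho> = sqrt (1 + \<kappa>^2), so the
  plane of the circle has distance |\<kappa>| / \<rho> from the origin and the radius is 1 /
  \<rho>.\<close>

lemma circle_image:
  fixes F1 F2 m1 m2 :: "'m \<Rightarrow> real^3"
  assumes conn: "connected_space M" and atlas: "smooth_atlas M A" and ne: "topspace M \<noteq> {}"
    and patch: "\<And>c. c \<in> A \<Longrightarrow> hypersurface_patch (snd c ` fst c) (\<lambda>x. F1 (chart_inv c x))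
      (\<lambda>x. m1 (chart_inv c x)) (\<lambda>x. F2 (chart_inv c x)) (\<lambda>x. m2 (chart_inv c x)) \<mu> \<kappa>"
    and m2: "\<And>p. p \<in> topspace M \<Longrightarrow> m2 p = 0"
  obtains L :: "real^3 \<Rightarrow> real^3" where "\<mu> = 0" "orthogonal_transformation L"
    "openin (top_of_set (circle_S2 (1 / sqrt (1 + \<kappa>\<^sup>2)) \<times> sphere 0 1))
      ((\<lambda>p. (L (F1 p), F2 p)) ` topspace M)"
proof -
  have chart: "is_chart M c" if "c \<in> A" for c
    using atlas that by (simp add: smooth_atlas_def)
  have inside: "chart_inv c x \<in> topspace M" if "c \<in> A" "x \<in> snd c ` fst c" for c x
    using chart_inv_right(1)[OF that(2)] chart_topspace[OF chart[OF that(1)]] by blast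
  define h where "h p = m1 p + \<kappa> *\<^sub>R F1 p" for p
  have h_const: "h p = h q" if "p \<in> topspace M" "q \<in> topspace M" for p q
  proof (rule locally_constant_on_charts[OF conn atlas _ that])
    fix c x assume c: "c \<in> A" "x \<in> snd c ` fst c"
    show "\<exists>e>0. \<forall>y\<in>ball x e \<inter> snd c ` fst c. h (chart_inv c y) = h (chart_inv c x)"
      unfolding h_def using m2 inside[OF c(1)]
      by (intro axis_locally_constant[OF patch[OF c(1)] c(2)]) blast
  qed
  obtain p0 where p0: "p0 \<in> topspace M" using ne by blast
  define n0 where "n0 = h p0"
  define \<rho> where "\<rho> = sqrt (1 + \<kappa>\<^sup>2)"
  have \<rho>: "0 < \<rho>" "\<rho>\<^sup>2 = 1 + \<kappa>\<^sup>2" unfolding \<rho>_def by (simp_all add: add_pos_nonneg)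
  have in_chart: "\<exists>c\<in>A. p \<in> fst c" if "p \<in> topspace M" for p
    using atlas that unfolding smooth_atlas_def by blast
  have geometry: "F1 p \<bullet> F1 p = 1" "m1 p \<bullet> m1 p = 1" "F1 p \<bullet> m1 p = 0" "norm (F2 p) = 1" "\<mu> = 0"
    if p: "p \<in> topspace M" for p
  proof -
    obtain c where c: "c \<in> A" "p \<in> fst c" using in_chart[OF p] by blast
    interpret hypersurface_patch "snd c ` fst c" "\<lambda>x. F1 (chart_inv c x)" "\<lambda>x. m1 (chart_inv c x)"
      "\<lambda>x. F2 (chart_inv c x)" "\<lambda>x. m2 (chart_inv c x)" \<mu> \<kappa>
      by (rule patch[OF c(1)])
    have x: "snd c p \<in> snd c ` fst c" using c by blast
    have xp: "chart_inv c (snd c p) = p" by (rule chart_inv_left[OF chart[OF c(1)] c(2)])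
    have z: "m2 (chart_inv c y) = 0" if "y \<in> snd c ` fst c" for y
      using m2[OF inside[OF c(1) that]] .
    show "F1 p \<bullet> F1 p = 1" "m1 p \<bullet> m1 p = 1" "F1 p \<bullet> m1 p = 0" "norm (F2 p) = 1"
      using p.hh[OF x] n1_unit[OF z x] p.hn[OF x] q.hh[OF x] by (simp_all add: xp norm_eq_1)
    show "\<mu> = 0" by (rule factor_equations(1)[OF z x])
  qed
  have n0: "n0 = m1 p + \<kappa> *\<^sub>R F1 p" if "p \<in> topspace M" for p
    using h_const[OF p0 that] by (simp add: n0_def h_def)
  have F1_n0: "F1 p \<bullet> n0 = \<kappa>" if "p \<in> topspace M" for p
    using geometry[OF that] by (simp add: n0[OF that] inner_add_right)
  have "n0 \<bullet> n0 = 1 + \<kappa>\<^sup>2"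
    using geometry[OF p0] by (simp add: n0[OF p0] inner_add_right inner_add_left inner_commute power2_eq_square)
  then have norm_n0: "norm n0 = \<rho>" by (simp add: norm_eq_sqrt_inner \<rho>_def)
  \<comment> \<open>\<open>circle_S2\<close> lies at nonnegative height, so for negative \<kappa>
    the axis is turned to the negative third axis.\<close>
  define s where "s = (if 0 \<le> \<kappa> then 1 else - 1 :: real)"
  have s: "s * s = 1" "s * \<kappa> = \<bar>\<kappa>\<bar>" by (simp_all add: s_def)
  have "norm n0 = norm ((s * \<rho>) *\<^sub>R axis 3 1 :: real^3)"
    using \<rho> by (simp add: norm_n0 s_def abs_mult)
  then obtain L :: "real^3 \<Rightarrow> real^3" where L: "orthogonal_transformation L"
    and Ln0: "L n0 = (s * \<rho>) *\<^sub>R axis 3 1"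
    by (rule orthogonal_transformation_exists) blast
  have third: "s * \<rho> * (L z $ 3) = z \<bullet> n0" for z
  proof -
    have "z \<bullet> n0 = L z \<bullet> L n0" using L by (simp add: orthogonal_transformation_def)
    then show ?thesis by (simp add: Ln0 inner_axis)
  qed
  have height: "sqrt (1 - (1 / \<rho>)\<^sup>2) = \<bar>\<kappa>\<bar> / \<rho>"
  proof -
    have "1 - (1 / \<rho>)\<^sup>2 = (\<bar>\<kappa>\<bar> / \<rho>)\<^sup>2"
    proof -
      have "(\<bar>\<kappa>\<bar> / \<rho>)\<^sup>2 = (\<rho>\<^sup>2 - 1) / \<rho>\<^sup>2"
        unfolding \<rho>(2) by (simp add: power_divide \<rho>(2))
      then show ?thesis
        using \<rho>(1) by (simp add: power_divide diff_divide_distrib)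
    qed
    then show ?thesis using \<rho> by (simp only: real_sqrt_abs) simp
  qed
  have circle: "L z \<in> circle_S2 (1 / \<rho>) \<longleftrightarrow> norm z = 1 \<and> z \<bullet> n0 = \<kappa>" for z
  proof -
    have "z \<bullet> n0 = \<kappa> \<longleftrightarrow> s * \<rho> * (L z $ 3) = s * \<rho> * (\<bar>\<kappa>\<bar> / \<rho>)"
      using s \<rho> third[of z] by (auto simp flip: s(2))
    also have "\<dots> \<longleftrightarrow> L z $ 3 = \<bar>\<kappa>\<bar> / \<rho>"
      using \<rho>(1) s(1) unfolding mult_cancel_left by auto
    finally show ?thesis
      by (simp add: circle_S2_def height orthogonal_transformation_norm[OF L])
  qed
  let ?G = "\<lambda>p. (L (F1 p), F2 p)"
  have "openin (top_of_set (circle_S2 (1 / \<rho>) \<times> sphere 0 1)) (?G ` topspace M)"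
  proof (subst openin_subopen, intro ballI)
    fix y assume "y \<in> ?G ` topspace M"
    then obtain p where p: "p \<in> topspace M" "y = ?G p" by blast
    obtain c where c: "c \<in> A" "p \<in> fst c" using in_chart[OF p(1)] by blast
    interpret hypersurface_patch "snd c ` fst c" "\<lambda>x. F1 (chart_inv c x)" "\<lambda>x. m1 (chart_inv c x)"
      "\<lambda>x. F2 (chart_inv c x)" "\<lambda>x. m2 (chart_inv c x)" \<mu> \<kappa>
      by (rule patch[OF c(1)])
    have x: "snd c p \<in> snd c ` fst c" using c by blast
    have xp: "chart_inv c (snd c p) = p" by (rule chart_inv_left[OF chart[OF c(1)] c(2)])
    obtain W where W: "open W" "(F1 p, F2 p) \<in> W"
      and image: "\<And>z1 z2. (z1, z2) \<in> W \<Longrightarrow> norm z1 = 1 \<Longrightarrow> norm z2 = 1 \<Longrightarrow> z1 \<bullet> n0 = \<kappa> \<Longrightarrow>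
        \<exists>y\<in>snd c ` fst c. F1 (chart_inv c y) = z1 \<and> F2 (chart_inv c y) = z2"
    proof (rule image_open[of n0 "snd c p"])
      show "m2 (chart_inv c y) = 0" if "y \<in> snd c ` fst c" for y
        using m2[OF inside[OF c(1) that]] .
      show "m1 (chart_inv c y) + \<kappa> *\<^sub>R F1 (chart_inv c y) = n0" if "y \<in> snd c ` fst c" for y
        using n0[OF inside[OF c(1) that]] by simp
    qed (use x in \<open>auto simp: xp\<close>)
    let ?K = "\<lambda>z :: R33. (inv L (fst z), snd z)"
    have inv: "L (inv L z) = z" "inv L (L z) = z" for z
      using orthogonal_transformation_bij[OF L] by (simp_all add: bij_is_inj bij_is_surj surj_f_inv_f)
    have "linear (inv L)"
      using orthogonal_transformation_inv[OF L] by (rule orthogonal_transformation_linear)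
    then have "linear ?K" by (simp add: linear_iff)
    then have "continuous_on UNIV ?K"
      by (simp add: linear_continuous_on linear_conv_bounded_linear)
    then have "open (?K -` W)" using W(1) by (simp add: open_vimage)
    moreover have "y \<in> ?K -` W" using W(2) p(2) inv by simp
    moreover have "(circle_S2 (1 / \<rho>) \<times> sphere 0 1) \<inter> ?K -` W \<subseteq> ?G ` topspace M"
    proof
      fix z assume z: "z \<in> (circle_S2 (1 / \<rho>) \<times> sphere 0 1) \<inter> ?K -` W"
      then have "norm (inv L (fst z)) = 1" "inv L (fst z) \<bullet> n0 = \<kappa>"
        using circle[of "inv L (fst z)"] inv by (auto simp: mem_Times_iff)
      then obtain y where y: "y \<in> snd c ` fst c" "F1 (chart_inv c y) = inv L (fst z)" "F2 (chart_inv c y) = snd z"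
        using image[of "inv L (fst z)" "snd z"] z by (auto simp: mem_Times_iff)
      then have "z = ?G (chart_inv c y)" using inv by (simp add: prod_eq_iff)
      then show "z \<in> ?G ` topspace M" using inside[OF c(1) y(1)] by blast
    qed
    moreover have "y \<in> circle_S2 (1 / \<rho>) \<times> sphere 0 1"
      using p geometry[OF p(1)] F1_n0[OF p(1)] circle[of "F1 p"] by (simp add: norm_eq_1)
    ultimately show "\<exists>T. openin (top_of_set (circle_S2 (1 / \<rho>) \<times> sphere 0 1)) T \<and> y \<in> T \<and> T \<subseteq> ?G ` topspace M"
      by (intro exI[of _ "(circle_S2 (1 / \<rho>) \<times> sphere 0 1) \<inter> ?K -` W"]) (auto simp: openin_open)
  qed
  then show ?thesis
    using that[of L] L geometry(5)[OF p0] by (simp add: \<rho>_def)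
qed

lemma (in oriented_hypersurface) image_in_circle_times_sphere:
  assumes conn: "connected_space M" and ne: "topspace M \<noteq> {}"
    and patch: "\<And>c. c \<in> A \<Longrightarrow> hypersurface_patch (U c) (f1 c) (n1 c) (f2 c) (n2 c) \<mu> \<kappa>"
  obtains g where "\<mu> = 0" "isometry_S2S2 g"
    "openin (top_of_set (circle_S2 (1 / sqrt (1 + \<kappa>\<^sup>2)) \<times> sphere 0 1)) (g ` \<Phi> ` topspace M)"
proof -
  obtain p0 where p0: "p0 \<in> topspace M" using ne by blast
  have norms: "fst (N p) \<bullet> fst (N p) + snd (N p) \<bullet> snd (N p) = 1"
    and zero_one: "fst (N p) \<bullet> fst (N p) = 0 \<or> fst (N p) \<bullet> fst (N p) = 1" if p: "p \<in> topspace M" for p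
  proof -
    obtain c where c: "c \<in> A" "p \<in> fst c" using atlas p unfolding smooth_atlas_def by blast
    interpret hypersurface_patch "U c" "f1 c" "n1 c" "f2 c" "n2 c" \<mu> \<kappa> by (rule patch[OF c(1)])
    have x: "snd c p \<in> U c" using c by blast
    have xp: "chart_inv c (snd c p) = p" by (rule chart_inv_left[OF chart[OF c(1)] c(2)])
    show "fst (N p) \<bullet> fst (N p) + snd (N p) \<bullet> snd (N p) = 1"
      using unit[OF x] by (simp add: xp)
    show "fst (N p) \<bullet> fst (N p) = 0 \<or> fst (N p) \<bullet> fst (N p) = 1"
      using normal_in_factor[OF x] by (simp add: p.a_def xp)
  qed
  have const: "fst (N p) \<bullet> fst (N p) = fst (N p0) \<bullet> fst (N p0)" if "p \<in> topspace M" for p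
  proof (rule locally_constant_on_charts[OF conn atlas _ that p0])
    fix c x assume c: "c \<in> A" "x \<in> snd c ` fst c"
    show "\<exists>e>0. \<forall>y\<in>ball x e \<inter> snd c ` fst c.
        fst (N (chart_inv c y)) \<bullet> fst (N (chart_inv c y)) = fst (N (chart_inv c x)) \<bullet> fst (N (chart_inv c x))"
      by (rule normal_locally_constant[OF patch[OF c(1)] c(2)])
  qed
  from zero_one[OF p0] show ?thesis
  proof
    assume "fst (N p0) \<bullet> fst (N p0) = 1"
    then have "snd (N p) = 0" if "p \<in> topspace M" for p
      using norms[OF that] const[OF that] by simp
    from circle_image[OF conn atlas ne patch this] obtain L where L: "\<mu> = 0" "orthogonal_transformation L"
      "openin (top_of_set (circle_S2 (1 / sqrt (1 + \<kappa>\<^sup>2)) \<times> sphere 0 1))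
        ((\<lambda>p. (L (fst (\<Phi> p)), snd (\<Phi> p))) ` topspace M)"
      by blast
    show ?thesis
      using that[OF L(1) isometry_S2S2_orthogonal(1)[OF L(2)]] L(3) by (simp add: image_image)
  next
    assume "fst (N p0) \<bullet> fst (N p0) = 0"
    then have "fst (N p) = 0" if "p \<in> topspace M" for p
      using const[OF that] by simp
    from circle_image[OF conn atlas ne hypersurface_patch.swap[OF patch] this] obtain L
      where L: "\<mu> = 0" "orthogonal_transformation L"
      "openin (top_of_set (circle_S2 (1 / sqrt (1 + \<kappa>\<^sup>2)) \<times> sphere 0 1))
        ((\<lambda>p. (L (snd (\<Phi> p)), fst (\<Phi> p))) ` topspace M)"
      by blast
    show ?thesis
      using that[OF L(1) isometry_S2S2_orthogonal(2)[OF L(2)]] L(3) by (simp add: image_image)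
  qed
qed

lemma (in oriented_hypersurface) totally_geodesicI:
  assumes patch: "\<And>c. c \<in> A \<Longrightarrow> hypersurface_patch (U c) (f1 c) (n1 c) (f2 c) (n2 c) 0 0"
  shows "totally_geodesic A \<Phi> N"
  unfolding totally_geodesic_def
proof (intro ballI allI)
  fix c p v assume c: "c \<in> A" "p \<in> fst c"
  interpret hypersurface_patch "U c" "f1 c" "n1 c" "f2 c" "n2 c" 0 0 by (rule patch[OF c(1)])
  have x: "snd c p \<in> U c" using c by blast
  have "DN (snd c p) v = 0"
    by (rule DN_principal[OF x]) simp
  then show "shape_operator \<Phi> N c p v = 0"
    unfolding shape_operator_eq[OF c] using linear_DF[OF x] by (simp add: linear_0)
qed

lemma (in oriented_hypersurface) principal_curvatures_distinct:
  assumes patch: "\<And>c. c \<in> A \<Longrightarrow> hypersurface_patch (U c) (f1 c) (n1 c) (f2 c) (n2 c) \<mu> \<kappa>"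
    and \<kappa>: "\<kappa> \<noteq> 0" and p: "p \<in> topspace M"
  shows "principal_curvatures A \<Phi> N p = {\<mu>, \<mu> + \<kappa>}"
proof -
  obtain c where c: "c \<in> A" "p \<in> fst c" using atlas p unfolding smooth_atlas_def by blast
  then show ?thesis
    unfolding principal_in_chart(2)[OF c]
    by (intro hypersurface_patch.curvatures_distinct[OF patch _ \<kappa>]) auto
qed

theorem theorem3:
  fixes M :: "'m topology" and A :: "'m chart set"
    and \<Phi> N :: "'m \<Rightarrow> R33"
  assumes "hypersurface M A \<Phi>"
    and "connected_space M"
    and "orientable M A"
    and "unit_normal_field A \<Phi> N"
    and "constant_principal_curvatures M A \<Phi> N"
    and "\<forall>p\<in>topspace M. card (principal_curvatures A \<Phi> N p) \<le> 2"
  shows "\<exists>g. isometry_S2S2 g \<and>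
    ((openin (top_of_set (circle_S2 1 \<times> sphere 0 1)) (g ` \<Phi> ` topspace M) \<and>
      totally_geodesic A \<Phi> N) \<or>
     ((\<exists>r. 0 < r \<and> r < 1 \<and>
        openin (top_of_set (circle_S2 r \<times> sphere 0 1)) (g ` \<Phi> ` topspace M)) \<and>
      (\<exists>\<kappa>\<^sub>1 \<kappa>\<^sub>2. \<kappa>\<^sub>1 \<noteq> \<kappa>\<^sub>2 \<and>
        (\<forall>p\<in>topspace M. principal_curvatures A \<Phi> N p = {\<kappa>\<^sub>1, \<kappa>\<^sub>2}))))"
proof -
  interpret oriented_hypersurface M A \<Phi> N
    using assms by unfold_locales
  show ?thesis
  proof (cases "topspace M = {}")
    \<comment> \<open>Without a point there is no eigenvalue to choose \<mu> and \<kappa> from; the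
      first alternative holds vacuously, with empty image.\<close>
    case True
    then have "totally_geodesic A \<Phi> N"
      using chart chart_topspace unfolding totally_geodesic_def by blast
    moreover note isometry_S2S2_orthogonal(1)[OF orthogonal_transformation_id]
    ultimately show ?thesis using True by auto
  next
    case False
    then obtain \<mu> \<kappa> where patch: "\<And>c. c \<in> A \<Longrightarrow> hypersurface_patch (U c) (f1 c) (n1 c) (f2 c) (n2 c) \<mu> \<kappa>"
      using hypersurface_patches[OF assms(5,6)] by blast
    obtain g where \<mu>: "\<mu> = 0" and g: "isometry_S2S2 g"
      "openin (top_of_set (circle_S2 (1 / sqrt (1 + \<kappa>\<^sup>2)) \<times> sphere 0 1)) (g ` \<Phi> ` topspace M)"
      using image_in_circle_times_sphere[OF assms(2) False patch] by blast
    show ?thesis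
    proof (cases "\<kappa> = 0")
      case True
      then have "totally_geodesic A \<Phi> N"
        using patch \<mu> by (intro totally_geodesicI) simp
      then show ?thesis using g True by auto
    next
      case False
      let ?r = "1 / sqrt (1 + \<kappa>\<^sup>2)"
      have "0 < 1 / t \<and> 1 / t < 1" if "1 < t" for t :: real using that by simp
      from this[of "sqrt (1 + \<kappa>\<^sup>2)"] have r: "0 < ?r" "?r < 1" using False by simp_all
      have "\<mu> \<noteq> \<mu> + \<kappa>" using False by simp
      with principal_curvatures_distinct[OF patch False] r g show ?thesis by blast
    qed
  qed
qed

end
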